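(* Let $(M,\mathcal{H},X)$ be a contact system, i.e. $\mathcal{H}$ is a contact structure on the manifold $M$ and $X$ is a Hamiltonian contact field with respect to $\mathcal{H}$. Suppose that a global contact form $\eta$ defining $\mathcal{H}$ is known, with Reeb vector field $\xi$, such that the Hamiltonian function $H$ of $X$ with respect to $\eta$ satisfies $\xi(H)=0$, and that a set of pseudo-isotropic first integrals $F:M\to\Lambda$ of $X$ (for the contact form $\eta$) is known. Then $X$ is integrable by quadratures.
   Context: All manifolds are finite-dimensional and smooth, all maps smooth. A contact structure on a $(2n+1)$-dimensional manifold $M$ is a distribution $\mathcal{H}$ of rank $2n$ such that around every point there are an open neighborhood $U$ and a local 1-form $\alpha$ on $U$ with $\ker\alpha=\mathcal{H}|_U$ and $(d\alpha)^n\wedge\alpha$ nowhere zero. A global contact form defining $\mathcal{H}$ is a 1-form $\eta$ on $M$ with $\ker\eta=\mathcal{H}$ and $(d\eta)^n\wedge\eta$ nowhere zero. The Reeb vector field $\xi$ of $\eta$ is the unique vector field with $i_\xi d\eta=0$, $i_\xi\eta=1$. For $H\in C^\infty(M)$ the contact field $X_H$ with respect to $\eta$ is the unique vector field with $i_{X_H}d\eta=-dH+\xi(H)\,\eta$ and $i_{X_H}\eta=H$. A vector field $X$ is a Hamiltonian contact field with respect to $\mathcal{H}$ if there is a global contact form $\eta$ defining $\mathcal{H}$ and a function $H$ with $X=X_H$ with respect to $\eta$; $H=i_X\eta$ is then the Hamiltonian function of $X$ with respect to $\eta$. (If $X=X_H$ for $\eta$, then $X=X_{gH}$ for any equivalent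 contact form $g\eta$, $g$ non-vanishing.) A set of pseudo-isotropic first integrals of $X$ (for $\eta$) is a submersion $F:M\to\Lambda$ onto a manifold $\Lambda$ such that (a) $X(p)\in\ker F_{*,p}$ for all $p\in M$, and (b) $\ker F_*\subset(\ker F_* )^\perp$, where $\perp$ denotes the orthogonal with respect to the 2-form $d\eta$; that is, $d\eta$ vanishes on pairs of vectors in $\ker F_{*,p}$ for every $p$. "$X$ is integrable by quadratures" has its usual meaning: starting from the known data, the integral curves of $X$ can be obtained (locally, around each point) by a finite number of operations consisting of algebraic operations, differentiation, solving of algebraic (i.e. finite, non-differential) equations via inversion of known local diffeomorphisms or immersions, and quadratures (computing integrals, i.e. primitives, of known functions or known closed 1-forms). *)

theory Defs
  imports "HOL-Analysis.Analysis" "HOL-Combinatorics.Permutations"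
begin

section \<open>Smooth functions on open subsets of Euclidean space\<close>

text \<open>
  Dimensions are natural numbers: the model space of dimension \<open>m\<close> is the library's
  \<^term>\<open>Euclidean_space m\<close>, whose points are the sequences vanishing from index \<open>m\<close> on.
  This also covers dimension 0, and the arity of a function may vary within one definition.
\<close>

definition partial_deriv :: "nat \<Rightarrow> ((nat \<Rightarrow> real) \<Rightarrow> real) \<Rightarrow> (nat \<Rightarrow> real) \<Rightarrow> real" where
  "partial_deriv i f x = deriv (\<lambda>t. f (x(i := t))) (x i)"

primrec C_k_on :: "nat \<Rightarrow> nat \<Rightarrow> (nat \<Rightarrow> real) set \<Rightarrow> ((nat \<Rightarrow> real) \<Rightarrow> real) \<Rightarrow> bool" where
  "C_k_on 0 m U f \<longleftrightarrow>
     continuous_map (subtopology (Euclidean_space m) U) euclideanreal f"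
| "C_k_on (Suc r) m U f \<longleftrightarrow>
     continuous_map (subtopology (Euclidean_space m) U) euclideanreal f \<and>
     (\<forall>i<m. (\<forall>x\<in>U. (\<lambda>t. f (x(i := t))) differentiable (at (x i))) \<and>
            C_k_on r m U (partial_deriv i f))"

definition C_infinity_on :: "nat \<Rightarrow> (nat \<Rightarrow> real) set \<Rightarrow> ((nat \<Rightarrow> real) \<Rightarrow> real) \<Rightarrow> bool" where
  "C_infinity_on m U f \<longleftrightarrow> (\<forall>r. C_k_on r m U f)"

text \<open>The point of the model space of dimension \<open>k\<close> with coordinates \<open>a 0, \<dots>, a (k - 1)\<close>.\<close>

definition tuple :: "nat \<Rightarrow> (nat \<Rightarrow> real) \<Rightarrow> nat \<Rightarrow> real" where
  "tuple k a = (\<lambda>j. if j < k then a j else 0)"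


section \<open>Smooth manifolds\<close>

type_synonym 'a chart = "'a set \<times> ('a \<Rightarrow> nat \<Rightarrow> real)"

text \<open>
  The atlas need not be maximal; the geometric notions below depend only on the smooth structure
  that it generates.
\<close>

record 'a mfd =
  mtop :: "'a topology"
  mdim :: nat
  matlas :: "'a chart set"

definition cdom :: "'a chart \<Rightarrow> 'a set" where
  "cdom c = fst c"

definition cmap :: "'a chart \<Rightarrow> 'a \<Rightarrow> nat \<Rightarrow> real" where
  "cmap c = snd c"

definition cinv :: "'a chart \<Rightarrow> (nat \<Rightarrow> real) \<Rightarrow> 'a" where
  "cinv c = inv_into (cdom c) (cmap c)"

definition is_chart :: "'a topology \<Rightarrow> nat \<Rightarrow> 'a chart \<Rightarrow> bool" where
  "is_chart T m c \<longleftrightarrow>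
     openin T (cdom c) \<and>
     openin (Euclidean_space m) (cmap c ` cdom c) \<and>
     homeomorphic_map (subtopology T (cdom c))
       (subtopology (Euclidean_space m) (cmap c ` cdom c)) (cmap c)"

definition smooth_manifold :: "'a mfd \<Rightarrow> bool" where
  "smooth_manifold M \<longleftrightarrow>
     Hausdorff_space (mtop M) \<and> second_countable (mtop M) \<and>
     (\<forall>c\<in>matlas M. is_chart (mtop M) (mdim M) c) \<and>
     (\<Union>c\<in>matlas M. cdom c) = topspace (mtop M) \<and>
     (\<forall>c\<in>matlas M. \<forall>d\<in>matlas M. \<forall>j<mdim M.
        C_infinity_on (mdim M) (cmap c ` (cdom c \<inter> cdom d)) (\<lambda>x. cmap d (cinv c x) j))"

definition charts_at :: "'a mfd \<Rightarrow> 'a \<Rightarrow> 'a chart set" where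
  "charts_at M p = {c \<in> matlas M. p \<in> cdom c}"

definition smooth_fun_on :: "'a mfd \<Rightarrow> 'a set \<Rightarrow> ('a \<Rightarrow> real) \<Rightarrow> bool" where
  "smooth_fun_on M W f \<longleftrightarrow>
     (\<forall>c\<in>matlas M. C_infinity_on (mdim M) (cmap c ` (cdom c \<inter> W)) (\<lambda>x. f (cinv c x)))"

definition smooth_near :: "'a mfd \<Rightarrow> 'a \<Rightarrow> ('a \<Rightarrow> real) \<Rightarrow> bool" where
  "smooth_near M p f \<longleftrightarrow> (\<exists>W. openin (mtop M) W \<and> p \<in> W \<and> smooth_fun_on M W f)"

definition smooth_map :: "'a mfd \<Rightarrow> 'b mfd \<Rightarrow> ('a \<Rightarrow> 'b) \<Rightarrow> bool" where
  "smooth_map M N F \<longleftrightarrow>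
     continuous_map (mtop M) (mtop N) F \<and>
     (\<forall>c\<in>matlas M. \<forall>d\<in>matlas N. \<forall>j<mdim N.
        C_infinity_on (mdim M) (cmap c ` {q \<in> cdom c. F q \<in> cdom d})
          (\<lambda>x. cmap d (F (cinv c x)) j))"


section \<open>Tangent vectors, vector fields and differential forms\<close>

text \<open>
  Tangent vectors at \<open>p\<close> are derivations at \<open>p\<close> of the functions that are smooth near \<open>p\<close>.
  They are given the value 0 on all other functions, so that equality of tangent vectors is
  equality of functions.
\<close>

type_synonym 'a tvec = "('a \<Rightarrow> real) \<Rightarrow> real"

definition tangent_space :: "'a mfd \<Rightarrow> 'a \<Rightarrow> 'a tvec set" where
  "tangent_space M p = {v.
     (\<forall>f g a b. smooth_near M p f \<and> smooth_near M p g \<longrightarrow>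
        v (\<lambda>q. a * f q + b * g q) = a * v f + b * v g) \<and>
     (\<forall>f g. smooth_near M p f \<and> smooth_near M p g \<longrightarrow>
        v (\<lambda>q. f q * g q) = f p * v g + g p * v f) \<and>
     (\<forall>f. \<not> smooth_near M p f \<longrightarrow> v f = 0)}"

text \<open>The coordinate vector \<open>\<partial>/\<partial>x\<^sub>i\<close> of the chart \<open>c\<close> at \<open>p\<close>.\<close>

definition coord_vec :: "'a mfd \<Rightarrow> 'a chart \<Rightarrow> nat \<Rightarrow> 'a \<Rightarrow> 'a tvec" where
  "coord_vec M c i p =
     (\<lambda>f. if smooth_near M p f then partial_deriv i (\<lambda>x. f (cinv c x)) (cmap c p) else 0)"

definition pushforward :: "'b mfd \<Rightarrow> ('a \<Rightarrow> 'b) \<Rightarrow> 'a \<Rightarrow> 'a tvec \<Rightarrow> 'b tvec" where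
  "pushforward N F p v = (\<lambda>g. if smooth_near N (F p) g then v (\<lambda>q. g (F q)) else 0)"

definition vector_field_on :: "'a mfd \<Rightarrow> 'a set \<Rightarrow> ('a \<Rightarrow> 'a tvec) \<Rightarrow> bool" where
  "vector_field_on M W X \<longleftrightarrow>
     (\<forall>p\<in>W. X p \<in> tangent_space M p) \<and>
     (\<forall>c\<in>matlas M. \<forall>i<mdim M.
        C_infinity_on (mdim M) (cmap c ` (cdom c \<inter> W))
          (\<lambda>x. X (cinv c x) (\<lambda>q. cmap c q i)))"

definition one_form_on :: "'a mfd \<Rightarrow> 'a set \<Rightarrow> ('a \<Rightarrow> 'a tvec \<Rightarrow> real) \<Rightarrow> bool" where
  "one_form_on M W \<alpha> \<longleftrightarrow>
     (\<forall>p\<in>W. \<forall>v\<in>tangent_space M p. \<forall>w\<in>tangent_space M p. \<forall>a b.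
        \<alpha> p (\<lambda>f. a * v f + b * w f) = a * \<alpha> p v + b * \<alpha> p w) \<and>
     (\<forall>c\<in>matlas M. \<forall>i<mdim M.
        C_infinity_on (mdim M) (cmap c ` (cdom c \<inter> W))
          (\<lambda>x. \<alpha> (cinv c x) (coord_vec M c i (cinv c x))))"

text \<open>
  In any chart, \<open>d\<alpha> = (\<Sum>i j. \<partial>\<^sub>i \<alpha>\<^sub>j dx\<^sub>i \<and> dx\<^sub>j)\<close>. The value does not depend on the chart around
  \<open>p\<close>, so the choice made here is immaterial.
\<close>

definition ext_deriv ::
  "'a mfd \<Rightarrow> ('a \<Rightarrow> 'a tvec \<Rightarrow> real) \<Rightarrow> 'a \<Rightarrow> 'a tvec \<Rightarrow> 'a tvec \<Rightarrow> real" where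
  "ext_deriv M \<alpha> p v w =
     (let c = (SOME c. c \<in> charts_at M p);
          comp = (\<lambda>u i. u (\<lambda>q. cmap c q i))
      in \<Sum>i<mdim M. \<Sum>j<mdim M.
           partial_deriv i (\<lambda>x. \<alpha> (cinv c x) (coord_vec M c j (cinv c x))) (cmap c p) *
           (comp v i * comp w j - comp w i * comp v j))"

text \<open>
  An exterior \<open>k\<close>-form at a point is a function of a sequence of tangent vectors, of which it
  uses the entries \<open>0, \<dots>, k - 1\<close>.
\<close>

type_synonym 'a ext_form = "(nat \<Rightarrow> 'a tvec) \<Rightarrow> real"

definition wedge :: "nat \<Rightarrow> nat \<Rightarrow> 'a ext_form \<Rightarrow> 'a ext_form \<Rightarrow> 'a ext_form" where
  "wedge k l a b = (\<lambda>v.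
     (\<Sum>\<sigma> | \<sigma> permutes {..<k + l}.
        of_int (sign \<sigma>) * a (\<lambda>i. v (\<sigma> i)) * b (\<lambda>i. v (\<sigma> (k + i)))) / (fact k * fact l))"

primrec wedge_power2 :: "'a ext_form \<Rightarrow> nat \<Rightarrow> 'a ext_form" where
  "wedge_power2 a 0 = (\<lambda>v. 1)"
| "wedge_power2 a (Suc n) = wedge 2 (2 * n) a (wedge_power2 a n)"


section \<open>Contact geometry\<close>

definition kernel_at :: "'a mfd \<Rightarrow> ('a \<Rightarrow> 'a tvec \<Rightarrow> real) \<Rightarrow> 'a \<Rightarrow> 'a tvec set" where
  "kernel_at M \<alpha> p = {v \<in> tangent_space M p. \<alpha> p v = 0}"

text \<open>\<open>(d\<alpha>)\<^sup>n \<and> \<alpha> \<noteq> 0\<close> at \<open>p\<close>.\<close>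

definition contact_nondegenerate_at ::
  "'a mfd \<Rightarrow> nat \<Rightarrow> ('a \<Rightarrow> 'a tvec \<Rightarrow> real) \<Rightarrow> 'a \<Rightarrow> bool" where
  "contact_nondegenerate_at M n \<alpha> p \<longleftrightarrow>
     (\<exists>v. (\<forall>i. v i \<in> tangent_space M p) \<and>
       wedge (2 * n) 1 (wedge_power2 (\<lambda>u. ext_deriv M \<alpha> p (u 0) (u 1)) n)
         (\<lambda>u. \<alpha> p (u 0)) v \<noteq> 0)"

definition distribution :: "'a mfd \<Rightarrow> nat \<Rightarrow> ('a \<Rightarrow> 'a tvec set) \<Rightarrow> bool" where
  "distribution M r \<H> \<longleftrightarrow>
     (\<forall>p\<in>topspace (mtop M). \<exists>W E. openin (mtop M) W \<and> p \<in> W \<and>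
        (\<forall>i<r. vector_field_on M W (E i)) \<and>
        (\<forall>q\<in>W.
           \<H> q = {\<lambda>f. \<Sum>i<r. a i * E i q f | a. True} \<and>
           (\<forall>a. (\<lambda>f. \<Sum>i<r. a i * E i q f) = (\<lambda>f. 0) \<longrightarrow> (\<forall>i<r. a i = 0))))"

definition contact_structure :: "'a mfd \<Rightarrow> nat \<Rightarrow> ('a \<Rightarrow> 'a tvec set) \<Rightarrow> bool" where
  "contact_structure M n \<H> \<longleftrightarrow>
     mdim M = 2 * n + 1 \<and> distribution M (2 * n) \<H> \<and>
     (\<forall>p\<in>topspace (mtop M). \<exists>U \<alpha>. openin (mtop M) U \<and> p \<in> U \<and> one_form_on M U \<alpha> \<and>
        (\<forall>q\<in>U. kernel_at M \<alpha> q = \<H> q \<and> contact_nondegenerate_at M n \<alpha> q))"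

definition global_contact_form ::
  "'a mfd \<Rightarrow> nat \<Rightarrow> ('a \<Rightarrow> 'a tvec set) \<Rightarrow> ('a \<Rightarrow> 'a tvec \<Rightarrow> real) \<Rightarrow> bool" where
  "global_contact_form M n \<H> \<eta> \<longleftrightarrow>
     one_form_on M (topspace (mtop M)) \<eta> \<and>
     (\<forall>p\<in>topspace (mtop M). kernel_at M \<eta> p = \<H> p \<and> contact_nondegenerate_at M n \<eta> p)"

text \<open>
  The Reeb field and the contact field of a function are unique, so they are given as predicates.
\<close>

definition Reeb_field :: "'a mfd \<Rightarrow> ('a \<Rightarrow> 'a tvec \<Rightarrow> real) \<Rightarrow> ('a \<Rightarrow> 'a tvec) \<Rightarrow> bool" where
  "Reeb_field M \<eta> \<xi> \<longleftrightarrow>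
     vector_field_on M (topspace (mtop M)) \<xi> \<and>
     (\<forall>p\<in>topspace (mtop M).
        (\<forall>v\<in>tangent_space M p. ext_deriv M \<eta> p (\<xi> p) v = 0) \<and> \<eta> p (\<xi> p) = 1)"

definition contact_field ::
  "'a mfd \<Rightarrow> ('a \<Rightarrow> 'a tvec \<Rightarrow> real) \<Rightarrow> ('a \<Rightarrow> 'a tvec) \<Rightarrow> ('a \<Rightarrow> real) \<Rightarrow> ('a \<Rightarrow> 'a tvec) \<Rightarrow> bool"
where
  "contact_field M \<eta> \<xi> H X \<longleftrightarrow>
     vector_field_on M (topspace (mtop M)) X \<and>
     (\<forall>p\<in>topspace (mtop M).
        (\<forall>v\<in>tangent_space M p. ext_deriv M \<eta> p (X p) v = - v H + \<xi> p H * \<eta> p v) \<and>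
        \<eta> p (X p) = H p)"

definition hamiltonian_contact_field ::
  "'a mfd \<Rightarrow> nat \<Rightarrow> ('a \<Rightarrow> 'a tvec set) \<Rightarrow> ('a \<Rightarrow> 'a tvec) \<Rightarrow> bool" where
  "hamiltonian_contact_field M n \<H> X \<longleftrightarrow>
     (\<exists>\<eta> \<xi> H. global_contact_form M n \<H> \<eta> \<and> Reeb_field M \<eta> \<xi> \<and>
        smooth_fun_on M (topspace (mtop M)) H \<and> contact_field M \<eta> \<xi> H X)"

definition contact_system ::
  "'a mfd \<Rightarrow> nat \<Rightarrow> ('a \<Rightarrow> 'a tvec set) \<Rightarrow> ('a \<Rightarrow> 'a tvec) \<Rightarrow> bool" where
  "contact_system M n \<H> X \<longleftrightarrow>
     smooth_manifold M \<and> contact_structure M n \<H> \<and> hamiltonian_contact_field M n \<H> X"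

definition hamiltonian_function ::
  "('a \<Rightarrow> 'a tvec \<Rightarrow> real) \<Rightarrow> ('a \<Rightarrow> 'a tvec) \<Rightarrow> 'a \<Rightarrow> real" where
  "hamiltonian_function \<eta> X = (\<lambda>p. \<eta> p (X p))"

definition submersion_onto :: "'a mfd \<Rightarrow> 'b mfd \<Rightarrow> ('a \<Rightarrow> 'b) \<Rightarrow> bool" where
  "submersion_onto M \<Lambda> F \<longleftrightarrow>
     smooth_map M \<Lambda> F \<and> F ` topspace (mtop M) = topspace (mtop \<Lambda>) \<and>
     (\<forall>p\<in>topspace (mtop M).
        pushforward \<Lambda> F p ` tangent_space M p = tangent_space \<Lambda> (F p))"

definition ker_push :: "'a mfd \<Rightarrow> 'b mfd \<Rightarrow> ('a \<Rightarrow> 'b) \<Rightarrow> 'a \<Rightarrow> 'a tvec set" where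
  "ker_push M \<Lambda> F p = {v \<in> tangent_space M p. pushforward \<Lambda> F p v = (\<lambda>g. 0)}"

definition orthogonal_at ::
  "'a mfd \<Rightarrow> ('a \<Rightarrow> 'a tvec \<Rightarrow> real) \<Rightarrow> 'a \<Rightarrow> 'a tvec set \<Rightarrow> 'a tvec set" where
  "orthogonal_at M \<eta> p V = {v \<in> tangent_space M p. \<forall>w\<in>V. ext_deriv M \<eta> p v w = 0}"

definition pseudo_isotropic_first_integrals ::
  "'a mfd \<Rightarrow> ('a \<Rightarrow> 'a tvec \<Rightarrow> real) \<Rightarrow> ('a \<Rightarrow> 'a tvec) \<Rightarrow> 'b mfd \<Rightarrow> ('a \<Rightarrow> 'b) \<Rightarrow> bool" where
  "pseudo_isotropic_first_integrals M \<eta> X \<Lambda> F \<longleftrightarrow>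
     smooth_manifold \<Lambda> \<and> submersion_onto M \<Lambda> F \<and>
     (\<forall>p\<in>topspace (mtop M). X p \<in> ker_push M \<Lambda> F p) \<and>
     (\<forall>p\<in>topspace (mtop M).
        ker_push M \<Lambda> F p \<subseteq> orthogonal_at M \<eta> p (ker_push M \<Lambda> F p))"


section \<open>Integrability by quadratures\<close>

text \<open>
  \<open>quad D m U f\<close>: the real function \<open>f\<close>, defined on the open subset \<open>U\<close> of the
  \<open>m\<close>-dimensional Euclidean space, is obtained from the known functions in \<open>D\<close> by finitely many
  operations. The operations that are determined only up to a choice are stated so that they
  leave no freedom beyond real constants. Otherwise, e.g. with primitives in one variable up to an
  arbitrary function of the others, or with arbitrary left inverses of immersions, every smooth
  function would be obtained from any \<open>D\<close>. In detail:

  \<^item> \<open>inversion\<close>: solves \<open>f (u w) = h w\<close> for \<open>u\<close>, with \<open>f\<close> a known injective immersion and \<open>h\<close> known.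
    Inverses of local diffeomorphisms are the case where \<open>f\<close> has as many components as variables
    and \<open>h\<close> consists of the coordinate functions.
  \<^item> \<open>integral\<close>: the integral of \<open>f\<close> with respect to the variable \<open>i\<close> from the constant \<open>c\<close> to
    \<open>x i\<close>, i.e. the primitive in that variable that vanishes where \<open>x i = c\<close>.
  \<^item> \<open>primitive\<close>: a primitive of a known closed 1-form on a connected domain.
\<close>

inductive quad ::
  "(nat \<times> (nat \<Rightarrow> real) set \<times> ((nat \<Rightarrow> real) \<Rightarrow> real)) set \<Rightarrow>
   nat \<Rightarrow> (nat \<Rightarrow> real) set \<Rightarrow> ((nat \<Rightarrow> real) \<Rightarrow> real) \<Rightarrow> bool"
  for D :: "(nat \<times> (nat \<Rightarrow> real) set \<times> ((nat \<Rightarrow> real) \<Rightarrow> real)) set"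
where
  known: "(m, U, f) \<in> D \<Longrightarrow> quad D m U f"
| restriction:
    "\<lbrakk>quad D m U f; openin (Euclidean_space m) V; V \<subseteq> U; \<And>x. x \<in> V \<Longrightarrow> g x = f x\<rbrakk>
     \<Longrightarrow> quad D m V g"
| const: "openin (Euclidean_space m) U \<Longrightarrow> quad D m U (\<lambda>x. c)"
| coord: "\<lbrakk>openin (Euclidean_space m) U; i < m\<rbrakk> \<Longrightarrow> quad D m U (\<lambda>x. x i)"
| add: "\<lbrakk>quad D m U f; quad D m U g\<rbrakk> \<Longrightarrow> quad D m U (\<lambda>x. f x + g x)"
| mult: "\<lbrakk>quad D m U f; quad D m U g\<rbrakk> \<Longrightarrow> quad D m U (\<lambda>x. f x * g x)"
| quot:
    "\<lbrakk>quad D m U f; quad D m U g; \<And>x. x \<in> U \<Longrightarrow> g x \<noteq> 0\<rbrakk> \<Longrightarrow> quad D m U (\<lambda>x. f x / g x)"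
| composition:
    "\<lbrakk>quad D k V g; openin (Euclidean_space m) U; \<And>j. j < k \<Longrightarrow> quad D m U (f j);
      \<And>x. x \<in> U \<Longrightarrow> tuple k (\<lambda>j. f j x) \<in> V\<rbrakk>
     \<Longrightarrow> quad D m U (\<lambda>x. g (tuple k (\<lambda>j. f j x)))"
| derivative: "\<lbrakk>quad D m U f; i < m\<rbrakk> \<Longrightarrow> quad D m U (partial_deriv i f)"
| inversion:
    "\<lbrakk>\<And>j. j < k \<Longrightarrow> quad D m U (f j);
      openin (Euclidean_space m) U;
      inj_on (\<lambda>x. tuple k (\<lambda>j. f j x)) U;
      \<And>x a. \<lbrakk>x \<in> U; \<And>j. j < k \<Longrightarrow> (\<Sum>i<m. a i * partial_deriv i (f j) x) = 0\<rbrakk>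
        \<Longrightarrow> \<forall>i<m. a i = 0;
      openin (Euclidean_space l) W;
      \<And>j. j < k \<Longrightarrow> quad D l W (h j);
      continuous_map (subtopology (Euclidean_space l) W) (Euclidean_space m) u;
      u ` W \<subseteq> U;
      \<And>w j. \<lbrakk>w \<in> W; j < k\<rbrakk> \<Longrightarrow> f j (u w) = h j w;
      i < m\<rbrakk>
     \<Longrightarrow> quad D l W (\<lambda>w. u w i)"
| integral:
    "\<lbrakk>quad D m U f; i < m;
      \<And>x t. \<lbrakk>x \<in> U; t \<in> closed_segment c (x i)\<rbrakk> \<Longrightarrow> x(i := t) \<in> U;
      \<And>x. x \<in> U \<Longrightarrow> ((\<lambda>t. F (x(i := t))) has_real_derivative f x) (at (x i));
      \<And>x. \<lbrakk>x \<in> U; x i = c\<rbrakk> \<Longrightarrow> F x = 0\<rbrakk>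
     \<Longrightarrow> quad D m U F"
| primitive:
    "\<lbrakk>\<And>i. i < m \<Longrightarrow> quad D m U (a i);
      openin (Euclidean_space m) U; connectedin (Euclidean_space m) U;
      \<And>i j x. \<lbrakk>i < m; j < m; x \<in> U\<rbrakk> \<Longrightarrow> partial_deriv i (a j) x = partial_deriv j (a i) x;
      \<And>i x. \<lbrakk>i < m; x \<in> U\<rbrakk> \<Longrightarrow> ((\<lambda>t. F (x(i := t))) has_real_derivative a i x) (at (x i))\<rbrakk>
     \<Longrightarrow> quad D m U F"

definition integral_curve_on ::
  "'a mfd \<Rightarrow> ('a \<Rightarrow> 'a tvec) \<Rightarrow> real set \<Rightarrow> (real \<Rightarrow> 'a) \<Rightarrow> bool" where
  "integral_curve_on M X I \<gamma> \<longleftrightarrow>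
     (\<forall>t\<in>I. \<gamma> t \<in> topspace (mtop M) \<and>
        (\<forall>f. smooth_near M (\<gamma> t) f \<longrightarrow>
           ((\<lambda>s. f (\<gamma> s)) has_real_derivative X (\<gamma> t) f) (at t)))"

text \<open>
  Near \<open>p\<close>, the integral curves of \<open>X\<close>, expressed in the chart \<open>c\<close> as functions of the initial
  point (coordinates \<open>0, \<dots>, m - 1\<close>) and of time (coordinate \<open>m\<close>), are obtained from \<open>D\<close>.
\<close>

definition flow_by_quadratures_at ::
  "(nat \<times> (nat \<Rightarrow> real) set \<times> ((nat \<Rightarrow> real) \<Rightarrow> real)) set \<Rightarrow>
   'a mfd \<Rightarrow> 'a chart \<Rightarrow> ('a \<Rightarrow> 'a tvec) \<Rightarrow> 'a \<Rightarrow> bool" where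
  "flow_by_quadratures_at D M c X p \<longleftrightarrow>
     (\<exists>N \<epsilon> \<Gamma>. openin (mtop M) N \<and> p \<in> N \<and> N \<subseteq> cdom c \<and> 0 < \<epsilon> \<and>
        (\<forall>q\<in>N. \<Gamma> 0 q = q \<and> integral_curve_on M X {-\<epsilon><..<\<epsilon>} (\<lambda>t. \<Gamma> t q) \<and>
           (\<forall>t\<in>{-\<epsilon><..<\<epsilon>}. \<Gamma> t q \<in> cdom c)) \<and>
        (\<forall>i<mdim M.
           quad D (Suc (mdim M))
             {z \<in> topspace (Euclidean_space (Suc (mdim M))).
                tuple (mdim M) z \<in> cmap c ` N \<and> z (mdim M) \<in> {-\<epsilon><..<\<epsilon>}}
             (\<lambda>z. cmap c (\<Gamma> (z (mdim M)) (cinv c (tuple (mdim M) z))) i)))"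

text \<open>
  The known data in a chart \<open>c\<close> of \<open>M\<close> and a chart \<open>d\<close> of \<open>\<Lambda>\<close>: the components of \<open>X\<close> and \<open>\<eta>\<close> and
  the coordinate expression of \<open>F\<close>.
\<close>

definition known_data ::
  "'a mfd \<Rightarrow> ('a \<Rightarrow> 'a tvec) \<Rightarrow> ('a \<Rightarrow> 'a tvec \<Rightarrow> real) \<Rightarrow> 'b mfd \<Rightarrow> ('a \<Rightarrow> 'b) \<Rightarrow>
   'a chart \<Rightarrow> 'b chart \<Rightarrow> (nat \<times> (nat \<Rightarrow> real) set \<times> ((nat \<Rightarrow> real) \<Rightarrow> real)) set" where
  "known_data M X \<eta> \<Lambda> F c d =
     {(mdim M, cmap c ` cdom c, \<lambda>x. X (cinv c x) (\<lambda>q. cmap c q i)) | i. i < mdim M} \<union>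
     {(mdim M, cmap c ` cdom c, \<lambda>x. \<eta> (cinv c x) (coord_vec M c i (cinv c x))) | i. i < mdim M} \<union>
     {(mdim M, cmap c ` {q \<in> cdom c. F q \<in> cdom d}, \<lambda>x. cmap d (F (cinv c x)) j) | j. j < mdim \<Lambda>}"

text \<open>
  The charts are fixed one pair at a time: transition maps between charts are arbitrary
  diffeomorphisms and must not count as known.
\<close>

definition integrable_by_quadratures ::
  "'a mfd \<Rightarrow> ('a \<Rightarrow> 'a tvec) \<Rightarrow> ('a \<Rightarrow> 'a tvec \<Rightarrow> real) \<Rightarrow> 'b mfd \<Rightarrow> ('a \<Rightarrow> 'b) \<Rightarrow> bool" where
  "integrable_by_quadratures M X \<eta> \<Lambda> F \<longleftrightarrow>
     (\<forall>p\<in>topspace (mtop M). \<forall>c\<in>charts_at M p. \<forall>d\<in>charts_at \<Lambda> (F p).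
        flow_by_quadratures_at (known_data M X \<eta> \<Lambda> F c d) M c X p)"

end

theory Submission
  imports Defs "HOL-Homology.Invariance_of_Domain"
begin

text \<open>
Everything is local, so fix a point and charts around it and its image. Write \<open>x\<^sub>i\<close> (\<open>i \<in> S\<close>) for the
components of \<open>F\<close>, used as part of a coordinate system, so that the fibres of \<open>F\<close> are the sets where
these coordinates are constant.

The field \<open>X\<close> satisfies \<open>d\<eta>(X, \<cdot>) = - dH\<close> with \<open>H = \<eta>(X)\<close>. It is Hamiltonian for some contact form
\<open>\<eta>'\<close> with the same kernel, so \<open>\<eta> = g \<eta>'\<close> and \<open>d\<eta>(X, \<cdot>) + dH\<close> is a multiple of \<open>\<eta>'\<close>; evaluating it
at the Reeb field \<open>\<xi>\<close> and using \<open>\<xi>(H) = 0\<close> shows that this multiple is zero (\<open>contact_relation\<close>).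

Since \<open>d\<eta>\<close> vanishes on the fibres, \<open>\<eta>\<close> is closed along each of them and has a fibrewise primitive
\<open>W\<close>, which one integration produces with the \<open>x\<^sub>i\<close> as parameters (\<open>fibre_primitive\<close>). Then
\<open>\<eta> - dW = (\<Sum>j\<in>S. \<theta>\<^sub>j dx\<^sub>j)\<close>. The field \<open>X\<close> is tangent to the fibres, hence \<open>H\<close> is constant on
them, and \<open>X(x\<^sub>j) = 0\<close>, \<open>X(W) = \<eta>(X) = H\<close>, \<open>X(\<theta>\<^sub>j) = - \<partial>H/\<partial>x\<^sub>j\<close> for \<open>j \<in> S\<close>. So \<open>X\<close> differentiates
each of the functions \<open>x\<^sub>j\<close>, \<open>W\<close>, \<open>\<theta>\<^sub>j\<close> to a function of the \<open>x\<^sub>j\<close> alone, i.e. to a constant of the motion.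

These functions separate tangent vectors: a vector on which \<open>dx\<^sub>j\<close>, \<open>dW\<close> and \<open>d\<theta>\<^sub>j\<close> all vanish is
tangent to the fibre, lies in the kernel of \<open>\<eta>\<close> and in the radical of \<open>d\<eta>\<close>, and is zero because
\<open>\<eta>\<close> is a contact form. Hence some of them, the \<open>x\<^sub>j\<close> included, are local coordinates \<open>z = \<Phi>(x)\<close>. In
these the integral curves are the straight lines \<open>z + t c(z)\<close>, and applying \<open>\<Phi>\<^sup>-\<^sup>1\<close> gives the flow
(\<open>straightening_in_adapted_coordinates\<close>, \<open>quad_flow_of_straightening\<close>).

Coordinate systems with prescribed members are built by exchanging one coordinate at a time
(\<open>straighten\<close>): if \<open>\<partial>\<^sub>i g \<noteq> 0\<close>, then \<open>g\<close> may replace the coordinate \<open>i\<close>, and the inverse of this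
exchange is the solution of a single equation. The same lemma is applied twice, to the components
of \<open>F\<close> and to the family \<open>W\<close>, \<open>\<theta>\<^sub>j\<close>.

On the manifold side it has to be shown that tangent vectors are given by their components
(\<open>tangent_components\<close>), that \<open>ext_deriv\<close> has the usual expression in every chart
(\<open>ext_deriv_in_chart\<close>), and that \<open>(d\<eta>)\<^sup>n \<and> \<eta> \<noteq> 0\<close> excludes common null vectors of \<open>\<eta>\<close> and \<open>d\<eta>\<close>
(\<open>contact_nondegenerate_coordinates\<close>).
\<close>


section \<open>Functions of class C k on open subsets of Euclidean space\<close>

abbreviation Euclid :: "nat \<Rightarrow> (nat \<Rightarrow> real) set" where
  "Euclid m \<equiv> topspace (Euclidean_space m)"

abbreviation eopen :: "nat \<Rightarrow> (nat \<Rightarrow> real) set \<Rightarrow> bool" where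
  "eopen m U \<equiv> openin (Euclidean_space m) U"

lemma in_Euclid: "x \<in> Euclid m \<longleftrightarrow> (\<forall>i\<ge>m. x i = 0)"
  by (simp add: topspace_Euclidean_space)

lemma Euclidean_space_top_of_set: "Euclidean_space m = top_of_set (Euclid m)"
  by (simp add: Euclidean_space_def euclidean_product_topology topspace_Euclidean_space)

lemma eopen_iff: "eopen m U \<longleftrightarrow> (\<exists>T. open T \<and> U = Euclid m \<inter> T)"
  by (subst Euclidean_space_top_of_set) (rule openin_open)

lemma eopen_subset: "eopen m U \<Longrightarrow> U \<subseteq> Euclid m"
  by (rule openin_subset)

lemma eopen_eventually:
  assumes "eopen m U" "x \<in> U"
  shows "\<forall>\<^sub>F z in nhds x. z \<in> Euclid m \<longrightarrow> z \<in> U"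
proof -
  obtain T where "open T" "U = Euclid m \<inter> T"
    using assms(1) unfolding eopen_iff by auto
  then show ?thesis
    using assms(2) by (auto simp: eventually_nhds)
qed

lemma continuous_map_eopen:
  assumes "U \<subseteq> Euclid m"
  shows "continuous_map (subtopology (Euclidean_space m) U) euclideanreal f \<longleftrightarrow> continuous_on U f"
proof -
  have "subtopology (Euclidean_space m) U = top_of_set U"
    using assms by (subst Euclidean_space_top_of_set) (simp add: subtopology_subtopology Int_absorb1)
  then show ?thesis by simp
qed

lemma continuous_map_into_Euclid:
  assumes "U \<subseteq> Euclid m" "\<And>x. x \<in> U \<Longrightarrow> G x \<in> Euclid k" "continuous_on U G"
  shows "continuous_map (subtopology (Euclidean_space m) U) (Euclidean_space k) G"
  using assms by (auto simp: cm_Euclidean_space_iff_continuous_on Int_absorb1)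

lemma eopen_preimage:
  assumes U: "eopen m U" and V: "eopen k V" and G: "continuous_on U G" "\<And>x. x \<in> U \<Longrightarrow> G x \<in> Euclid k"
  shows "eopen m {x \<in> U. G x \<in> V}"
proof -
  have "continuous_map (subtopology (Euclidean_space m) U) (Euclidean_space k) G"
    using continuous_map_into_Euclid eopen_subset[OF U] G by blast
  from openin_continuous_map_preimage[OF this V]
  have "openin (subtopology (Euclidean_space m) U) {x \<in> U. G x \<in> V}"
    using eopen_subset[OF U] by (simp add: Int_absorb1)
  then show ?thesis using U openin_trans_full by blast
qed

lemma eopen_preimage_Int_open:
  assumes "eopen m U" "continuous_on U g" "open T"
  shows "eopen m {x \<in> U. g x \<in> T}"
proof -
  have "openin (top_of_set U) (U \<inter> g -` T)"
    using assms(2,3) by (rule continuous_openin_preimage_gen)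
  moreover have "U \<inter> g -` T = {x \<in> U. g x \<in> T}" by auto
  moreover have "top_of_set U = subtopology (Euclidean_space m) U"
    by (metis Euclidean_space_top_of_set Int_absorb1 assms(1) eopen_subset subtopology_subtopology)
  ultimately show ?thesis using assms(1) openin_trans_full by metis
qed

lemma continuous_on_Euclid_components:
  assumes "\<And>x. x \<in> U \<Longrightarrow> G x \<in> Euclid k" "\<And>j. j < k \<Longrightarrow> continuous_on U (\<lambda>x. G x j)"
  shows "continuous_on U G"
proof (rule continuous_on_coordinatewise_then_product)
  fix j show "continuous_on U (\<lambda>x. G x j)"
  proof (cases "j < k")
    case False
    then have "\<And>x. x \<in> U \<Longrightarrow> G x j = 0" using assms(1) by (auto simp: in_Euclid)
    then show ?thesis using continuous_on_cong by (metis (mono_tags) continuous_on_const)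
  qed (use assms in auto)
qed

text \<open>
Cubes rather than balls: they stay invariant when any subset of the coordinates is contracted
towards the centre, which is how fibres are integrated over below.
\<close>

definition ebox :: "nat \<Rightarrow> (nat \<Rightarrow> real) \<Rightarrow> real \<Rightarrow> (nat \<Rightarrow> real) set" where
  "ebox m q e = {z \<in> Euclid m. \<forall>i<m. \<bar>z i - q i\<bar> < e}"

lemma eopen_ebox: "eopen m (ebox m q e)"
proof -
  have *: "\<And>k. eopen m {z \<in> Euclid m. \<forall>i<k. \<bar>z i - q i\<bar> < e}"
  proof -
    fix k show "eopen m {z \<in> Euclid m. \<forall>i<k. \<bar>z i - q i\<bar> < e}"
    proof (induction k)
      case (Suc k)
      have "eopen m {z \<in> {z \<in> Euclid m. \<forall>i<k. \<bar>z i - q i\<bar> < e}. (\<lambda>z. \<bar>z k - q k\<bar>) z \<in> {..<e}}"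
        by (rule eopen_preimage_Int_open[OF Suc])
          (auto intro!: continuous_intros continuous_on_product_then_coordinatewise[OF continuous_on_id])
      moreover have "\<dots> = {z \<in> Euclid m. \<forall>i<Suc k. \<bar>z i - q i\<bar> < e}"
        by (auto simp: less_Suc_eq)
      ultimately show ?case by simp
    qed simp
  qed
  show ?thesis unfolding ebox_def by (rule *)
qed

lemma eopen_contains_ebox:
  assumes "eopen m U" "q \<in> U"
  obtains e where "e > 0" "ebox m q e \<subseteq> U" "q \<in> ebox m q e"
proof -
  obtain T where T: "open T" "U = Euclid m \<inter> T"
    using assms(1) unfolding eopen_iff by auto
  then have "openin (product_topology (\<lambda>i. euclidean) UNIV) T" "q \<in> T"
    using assms by (auto simp: euclidean_product_topology)
  from product_topology_open_contains_basis[OF this]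
  obtain X where X: "q \<in> PiE UNIV X" "\<And>i. open (X i)" "PiE UNIV X \<subseteq> T"
    by (auto simp: )
  have "\<exists>d>0. \<forall>y. \<bar>y - q i\<bar> < d \<longrightarrow> y \<in> X i" for i
    using X(1) X(2)[of i] open_dist by (metis PiE_mem UNIV_I dist_real_def)
  then obtain d where d: "\<And>i. d i > 0" "\<And>i y. \<bar>y - q i\<bar> < d i \<Longrightarrow> y \<in> X i"
    by metis
  define e where "e = Min (insert 1 (d ` {..<m}))"
  have e: "e > 0" "\<And>i. i < m \<Longrightarrow> e \<le> d i" using d by (auto simp: e_def)
  have "ebox m q e \<subseteq> U"
  proof
    fix z assume z: "z \<in> ebox m q e"
    have "z i \<in> X i" for i
    proof (cases "i < m")
      case True then show ?thesis using z e(2)[OF True] d(2)[of "z i" i] by (force simp: ebox_def)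
    next
      case False
      then have "z i = q i" using z assms eopen_subset[OF assms(1)] by (auto simp: ebox_def in_Euclid subset_iff)
      then show ?thesis using d(2)[of "z i" i] d(1)[of i] by simp
    qed
    then have "z \<in> T" using X(3) by (auto simp: PiE_def)
    then show "z \<in> U" using z T by (auto simp: ebox_def)
  qed
  moreover have "q \<in> ebox m q e"
    using e assms eopen_subset[OF assms(1)] by (auto simp: ebox_def)
  ultimately show ?thesis using that e by blast
qed

text \<open>
The topology is that of pointwise convergence on all indices; on the model space only the first
\<open>m\<close> of them have to be controlled.
\<close>

lemma tendsto_Euclid_nhds:
  fixes g :: "'b \<Rightarrow> nat \<Rightarrow> real"
  assumes "\<And>i. i < m \<Longrightarrow> ((\<lambda>t. g t i) \<longlongrightarrow> x i) F" "\<forall>\<^sub>F t in F. g t \<in> Euclid m" "x \<in> Euclid m"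
  shows "(g \<longlongrightarrow> x) F"
proof (rule topological_tendstoI)
  fix S assume S: "open S" "x \<in> S"
  have "eopen m (Euclid m \<inter> S)" using S unfolding eopen_iff by auto
  then obtain e where e: "e > 0" "ebox m x e \<subseteq> Euclid m \<inter> S"
    using eopen_contains_ebox S assms(3) by blast
  have "\<forall>\<^sub>F t in F. \<forall>i\<in>{..<m}. \<bar>g t i - x i\<bar> < e"
    using assms(1) e(1) by (intro eventually_ball_finite) (auto simp: tendsto_iff dist_real_def)
  then show "\<forall>\<^sub>F t in F. g t \<in> S"
    using assms(2) by eventually_elim (use e in \<open>auto simp: ebox_def\<close>)
qed

lemma upd_in_Euclid: "x \<in> Euclid m \<Longrightarrow> i < m \<Longrightarrow> x(i := t) \<in> Euclid m"
  by (auto simp: in_Euclid)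

lemma continuous_on_upd: "continuous_on A (\<lambda>t. x(i := (t::real)))"
proof (rule continuous_on_coordinatewise_then_product)
  fix j show "continuous_on A (\<lambda>t. (x(i := t)) j)" by (cases "j = i") (auto intro: continuous_intros)
qed

lemma upd_tendsto: "((\<lambda>t. x(i := t)) \<longlongrightarrow> x) (nhds (x i :: real))"
proof -
  have "isCont (\<lambda>t. x(i := t)) (x i)"
    using continuous_on_upd[of UNIV x i] by (simp add: continuous_on_eq_continuous_at)
  then show ?thesis by (metis continuous_at fun_upd_triv tendsto_at_iff_tendsto_nhds)
qed

lemma upd_eventually:
  assumes "eopen m U" "x \<in> U" "i < m"
  shows "\<forall>\<^sub>F t in nhds (x i). x(i := t) \<in> U"
proof -
  have "\<forall>\<^sub>F t in nhds (x i). x(i := t) \<in> Euclid m \<longrightarrow> x(i := t) \<in> U"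
    using upd_tendsto[of x i] eopen_eventually[OF assms(1,2)] by (rule filterlim_iff[THEN iffD1, rule_format])
  then show ?thesis
    using upd_in_Euclid[of x m i] assms eopen_subset[OF assms(1)] by (auto elim!: eventually_mono)
qed

lemma has_partial_cong:
  assumes "eopen m U" "x \<in> U" "i < m" "\<And>y. y \<in> U \<Longrightarrow> f y = g y"
  shows "((\<lambda>t. f (x(i := t))) has_real_derivative D) (at (x i)) \<longleftrightarrow>
    ((\<lambda>t. g (x(i := t))) has_real_derivative D) (at (x i))"
  using upd_eventually[OF assms(1-3)] by (intro DERIV_cong_ev) (auto elim!: eventually_mono simp: assms(4))

lemma partial_deriv_cong:
  assumes "eopen m U" "x \<in> U" "i < m" "\<And>y. y \<in> U \<Longrightarrow> f y = g y"
  shows "partial_deriv i f x = partial_deriv i g x"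
  unfolding partial_deriv_def
  using upd_eventually[OF assms(1-3)] by (intro deriv_cong_ev) (auto elim!: eventually_mono simp: assms(4))

lemma partial_derivI:
  "((\<lambda>t. f (x(i := t))) has_real_derivative D) (at (x i)) \<Longrightarrow> partial_deriv i f x = D"
  unfolding partial_deriv_def by (rule DERIV_imp_deriv)

lemma C_k_on_cong:
  assumes "eopen m U" "\<And>x. x \<in> U \<Longrightarrow> f x = g x" "C_k_on r m U f"
  shows "C_k_on r m U g"
  using assms(2,3)
proof (induction r arbitrary: f g)
  case 0
  then show ?case using assms(1)
    by (auto simp: continuous_map_eopen eopen_subset cong: continuous_on_cong)
next
  case (Suc r)
  have "continuous_on U g" using Suc assms(1)
    by (auto simp: continuous_map_eopen eopen_subset cong: continuous_on_cong)
  moreover have "(\<lambda>t. g (x(i := t))) differentiable (at (x i))" if "i < m" "x \<in> U" for i x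
  proof -
    have "(\<lambda>t. f (x(i := t))) differentiable (at (x i))" using Suc.prems(2) that by auto
    then obtain D where D: "((\<lambda>t. f (x(i := t))) has_real_derivative D) (at (x i))"
      unfolding real_differentiable_def ..
    have "((\<lambda>t. f (x(i := t))) has_real_derivative D) (at (x i)) \<longleftrightarrow>
        ((\<lambda>t. g (x(i := t))) has_real_derivative D) (at (x i))"
      by (rule has_partial_cong[where f = f and g = g and D = D, OF assms(1) that(2,1)]) (rule Suc.prems(1))
    from iffD1[OF this D] show ?thesis unfolding real_differentiable_def ..
  qed
  moreover have "C_k_on r m U (partial_deriv i g)" if "i < m" for i
  proof (rule Suc.IH)
    show "partial_deriv i f x = partial_deriv i g x" if "x \<in> U" for x
      by (rule partial_deriv_cong[where f = f and g = g, OF assms(1) that \<open>i < m\<close>]) (rule Suc.prems(1))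
    show "C_k_on r m U (partial_deriv i f)" using Suc.prems(2) that by auto
  qed
  ultimately show ?case using assms(1) by (auto simp: continuous_map_eopen eopen_subset)
qed

lemma C_k_on_imp_continuous: "eopen m U \<Longrightarrow> C_k_on r m U f \<Longrightarrow> continuous_on U f"
  by (cases r) (auto simp: continuous_map_eopen eopen_subset)

lemma C_k_on_has_partial:
  assumes "C_k_on (Suc r) m U f" "i < m" "x \<in> U"
  shows "((\<lambda>t. f (x(i := t))) has_real_derivative partial_deriv i f x) (at (x i))"
  using assms by (auto simp: partial_deriv_def DERIV_deriv_iff_real_differentiable)

text \<open>
All closure properties below are instances of this: it suffices to guess the partial derivatives.
\<close>

lemma C_k_on_SucI:
  assumes "eopen m U" "continuous_on U f"
    "\<And>i x. i < m \<Longrightarrow> x \<in> U \<Longrightarrow> ((\<lambda>t. f (x(i := t))) has_real_derivative g i x) (at (x i))"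
    "\<And>i. i < m \<Longrightarrow> C_k_on r m U (g i)"
  shows "C_k_on (Suc r) m U f"
proof -
  have "C_k_on r m U (partial_deriv i f)" if "i < m" for i
    by (rule C_k_on_cong[OF assms(1) _ assms(4)[OF that]]) (use partial_derivI assms(3)[OF that] in metis)
  then show ?thesis using assms by (auto simp: continuous_map_eopen eopen_subset real_differentiable_def)
qed

lemma C_k_on_decrease: "eopen m U \<Longrightarrow> C_k_on (Suc r) m U f \<Longrightarrow> C_k_on r m U f"
proof (induction r arbitrary: f)
  case (Suc r)
  then have "\<And>i. i < m \<Longrightarrow> C_k_on r m U (partial_deriv i f)" by auto
  then show ?case using Suc.prems by auto
qed auto

lemma C_k_on_le: "eopen m U \<Longrightarrow> C_k_on s m U f \<Longrightarrow> r \<le> s \<Longrightarrow> C_k_on r m U f"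
  by (induction s) (auto simp: le_Suc_eq dest: C_k_on_decrease simp del: C_k_on.simps)

lemma C_k_on_subset:
  assumes "C_k_on r m U f" "eopen m V" "V \<subseteq> U" "U \<subseteq> Euclid m"
  shows "C_k_on r m V f"
  using assms(1)
proof (induction r arbitrary: f)
  case 0 then show ?case using assms by (auto simp: continuous_map_eopen eopen_subset intro: continuous_on_subset)
next
  case (Suc r)
  then show ?case using assms by (auto simp: continuous_map_eopen eopen_subset intro: continuous_on_subset)
qed

lemma C_k_on_const: "eopen m U \<Longrightarrow> C_k_on r m U (\<lambda>x. c)"
proof (induction r arbitrary: c)
  case (Suc r) then show ?case by (intro C_k_on_SucI[where g = "\<lambda>i x. 0"]) auto
qed (auto simp: continuous_map_eopen eopen_subset)

lemma continuous_on_coord: "continuous_on U (\<lambda>x. x i)"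
  by (rule continuous_on_product_then_coordinatewise[OF continuous_on_id])

lemma C_k_on_coord: "eopen m U \<Longrightarrow> C_k_on r m U (\<lambda>x. x i)"
proof (cases r)
  case (Suc s) assume "eopen m U" then show ?thesis unfolding Suc
    by (intro C_k_on_SucI[where g = "\<lambda>j x. if i = j then 1 else 0"])
      (auto intro!: continuous_on_coord C_k_on_const derivative_eq_intros)
qed (auto simp: continuous_map_eopen eopen_subset continuous_on_coord)

lemma C_k_on_add: "eopen m U \<Longrightarrow> C_k_on r m U f \<Longrightarrow> C_k_on r m U g \<Longrightarrow> C_k_on r m U (\<lambda>x. f x + g x)"
proof (induction r arbitrary: f g)
  case (Suc r)
  have c: "continuous_on U f" "continuous_on U g"
    using C_k_on_imp_continuous Suc.prems by blast+
  show ?case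
  proof (rule C_k_on_SucI[where g = "\<lambda>i x. partial_deriv i f x + partial_deriv i g x"])
    show "((\<lambda>t. f (x(i := t)) + g (x(i := t))) has_real_derivative
        partial_deriv i f x + partial_deriv i g x) (at (x i))" if "i < m" "x \<in> U" for i x
      by (intro DERIV_add C_k_on_has_partial[OF Suc.prems(2) that] C_k_on_has_partial[OF Suc.prems(3) that])
  qed (use Suc c in \<open>auto intro!: continuous_intros\<close>)
qed (auto simp: continuous_map_eopen eopen_subset intro: continuous_intros)

lemma C_k_on_mult: "eopen m U \<Longrightarrow> C_k_on r m U f \<Longrightarrow> C_k_on r m U g \<Longrightarrow> C_k_on r m U (\<lambda>x. f x * g x)"
proof (induction r arbitrary: f g)
  case (Suc r)
  have c: "continuous_on U f" "continuous_on U g"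
    using C_k_on_imp_continuous Suc.prems by blast+
  have d: "C_k_on r m U f" "C_k_on r m U g" using Suc.prems C_k_on_decrease by blast+
  show ?case
  proof (rule C_k_on_SucI[where g = "\<lambda>i x. partial_deriv i f x * g x + partial_deriv i g x * f x"])
    show "((\<lambda>t. f (x(i := t)) * g (x(i := t))) has_real_derivative
        partial_deriv i f x * g x + partial_deriv i g x * f x) (at (x i))" if "i < m" "x \<in> U" for i x
      by (rule DERIV_cong[OF DERIV_mult[OF C_k_on_has_partial[OF Suc.prems(2) that] C_k_on_has_partial[OF Suc.prems(3) that]]]) simp
  qed (use Suc c d in \<open>auto intro!: continuous_intros C_k_on_add\<close>)
qed (auto simp: continuous_map_eopen eopen_subset intro: continuous_intros)

lemma C_k_on_sum:
  "eopen m U \<Longrightarrow> (\<And>i. i \<in> I \<Longrightarrow> C_k_on r m U (f i)) \<Longrightarrow> C_k_on r m U (\<lambda>x. \<Sum>i\<in>I. f i x)"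
  by (induction I rule: infinite_finite_induct) (auto intro: C_k_on_const C_k_on_add)

lemma C_k_on_divide:
  assumes "eopen m U" "\<And>x. x \<in> U \<Longrightarrow> g x \<noteq> 0"
  shows "C_k_on r m U f \<Longrightarrow> C_k_on r m U g \<Longrightarrow> C_k_on r m U (\<lambda>x. f x / g x)"
proof (induction r arbitrary: f)
  case (Suc r)
  have c: "continuous_on U f" "continuous_on U g"
    using C_k_on_imp_continuous Suc.prems assms by blast+
  have d: "C_k_on r m U f" "C_k_on r m U g" using Suc.prems C_k_on_decrease assms by blast+
  have e: "C_k_on r m U (partial_deriv i f)" "C_k_on r m U (partial_deriv i g)" if "i < m" for i
    using Suc.prems that by auto
  have m1: "C_k_on r m U (\<lambda>x. (-1) * h x)" if "C_k_on r m U h" for h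
    using C_k_on_mult[OF assms(1) C_k_on_const[OF assms(1)] that] .
  show ?case
  proof (rule C_k_on_SucI[where g = "\<lambda>i x. (partial_deriv i f x + (-1) * (f x / g x * partial_deriv i g x)) / g x"])
    show "((\<lambda>t. f (x(i := t)) / g (x(i := t))) has_real_derivative
        (partial_deriv i f x + (-1) * (f x / g x * partial_deriv i g x)) / g x) (at (x i))" if "i < m" "x \<in> U" for i x
      by (rule DERIV_cong[OF DERIV_divide[OF C_k_on_has_partial[OF Suc.prems(1) that] C_k_on_has_partial[OF Suc.prems(2) that]]])
        (use assms(2)[OF that(2)] in \<open>simp_all add: field_simps\<close>)
    show "C_k_on r m U (\<lambda>x. (partial_deriv i f x + (-1) * (f x / g x * partial_deriv i g x)) / g x)" if "i < m" for i
      using that by (intro Suc.IH C_k_on_add m1 C_k_on_mult d e assms)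
  qed (use assms c in \<open>auto intro!: continuous_intros\<close>)
qed (use assms in \<open>auto simp: continuous_map_eopen eopen_subset intro: continuous_intros\<close>)


section \<open>The chain rule and mixed partial derivatives\<close>

text \<open>
The form of the mean value theorem that treats both orders of the end points alike.
\<close>

lemma mean_value_segment:
  fixes \<phi> :: "real \<Rightarrow> real"
  assumes "\<And>t. \<bar>t - a\<bar> \<le> \<bar>b - a\<bar> \<Longrightarrow> (\<phi> has_real_derivative \<phi>' t) (at t)"
  shows "\<exists>\<tau>. \<bar>\<tau> - a\<bar> \<le> \<bar>b - a\<bar> \<and> \<phi> b - \<phi> a = (b - a) * \<phi>' \<tau>"
proof (cases a b rule: linorder_cases)
  case less
  from MVT2[OF less, of \<phi> \<phi>'] assms less obtain z where "a < z" "z < b" "\<phi> b - \<phi> a = (b - a) * \<phi>' z" by auto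
  then show ?thesis by (intro exI[of _ z]) auto
next
  case greater
  from MVT2[OF greater, of \<phi> \<phi>'] assms greater obtain z where "b < z" "z < a" "\<phi> a - \<phi> b = (a - b) * \<phi>' z" by auto
  then show ?thesis by (intro exI[of _ z]) (auto simp: algebra_simps)
qed auto

text \<open>
Differentiability in the form of Caratheodory: the increment is a combination of the coordinate
increments whose coefficients depend on the end point and tend to the partial derivatives. The
coefficients come from the mean value theorem after passing from \<open>x\<close> to \<open>z\<close> one coordinate at a
time. Chain rule and implicit differentiation both follow by taking limits in this identity.
\<close>

lemma C1_increment:
  assumes U: "eopen m U" and f: "C_k_on (Suc 0) m U f" and x: "x \<in> U"
  obtains A e where "e > 0" "ebox m x e \<subseteq> U"
    "\<And>z. z \<in> ebox m x e \<Longrightarrow> f z - f x = (\<Sum>i<m. A i z * (z i - x i))"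
    "\<And>i. i < m \<Longrightarrow> (A i \<longlongrightarrow> partial_deriv i f x) (inf (nhds x) (principal (Euclid m)))"
proof -
  obtain e where e: "e > 0" "ebox m x e \<subseteq> U" "x \<in> ebox m x e"
    using eopen_contains_ebox[OF U x] by blast
  have xE: "x \<in> Euclid m" using x eopen_subset[OF U] by auto
  \<comment> \<open>The corners of the path from \<open>x\<close> to \<open>z\<close> that changes the coordinates in their order.\<close>
  define \<zeta> where "\<zeta> i z = (\<lambda>j. if j < i then z j else x j)" for i and z :: "nat \<Rightarrow> real"
  have \<zeta>: "(\<zeta> i z)(i := t) \<in> ebox m x e" if "z \<in> ebox m x e" "\<bar>t - x i\<bar> \<le> \<bar>z i - x i\<bar>" "i < m" for i z t
    using that xE e(1) by (force simp: ebox_def \<zeta>_def in_Euclid)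
  have "\<exists>\<tau>. \<bar>\<tau> - x i\<bar> \<le> \<bar>z i - x i\<bar> \<and>
      (z \<in> ebox m x e \<longrightarrow> f (\<zeta> (Suc i) z) - f (\<zeta> i z) = (z i - x i) * partial_deriv i f ((\<zeta> i z)(i := \<tau>)))"
    if "i < m" for i z
  proof (cases "z \<in> ebox m x e")
    case True
    have "((\<lambda>t. f ((\<zeta> i z)(i := t))) has_real_derivative partial_deriv i f ((\<zeta> i z)(i := t))) (at t)"
      if "\<bar>t - x i\<bar> \<le> \<bar>z i - x i\<bar>" for t
      using C_k_on_has_partial[OF f \<open>i < m\<close>, of "(\<zeta> i z)(i := t)"] \<zeta>[OF True that \<open>i < m\<close>] e(2) by auto
    from mean_value_segment[OF this] obtain \<tau> where \<tau>: "\<bar>\<tau> - x i\<bar> \<le> \<bar>z i - x i\<bar>"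
      "f ((\<zeta> i z)(i := z i)) - f ((\<zeta> i z)(i := x i)) = (z i - x i) * partial_deriv i f ((\<zeta> i z)(i := \<tau>))"
      by blast
    moreover have "(\<zeta> i z)(i := z i) = \<zeta> (Suc i) z" "(\<zeta> i z)(i := x i) = \<zeta> i z"
      by (auto simp: \<zeta>_def fun_eq_iff less_Suc_eq)
    ultimately show ?thesis by auto
  qed auto
  then obtain \<tau> where \<tau>: "\<And>i z. i < m \<Longrightarrow> \<bar>\<tau> i z - x i\<bar> \<le> \<bar>z i - x i\<bar>"
    "\<And>i z. i < m \<Longrightarrow> z \<in> ebox m x e \<Longrightarrow>
       f (\<zeta> (Suc i) z) - f (\<zeta> i z) = (z i - x i) * partial_deriv i f ((\<zeta> i z)(i := \<tau> i z))"
    by metis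
  define A where "A i z = partial_deriv i f ((\<zeta> i z)(i := \<tau> i z))" for i z
  have "f z - f x = (\<Sum>i<m. A i z * (z i - x i))" if z: "z \<in> ebox m x e" for z
  proof -
    have "\<zeta> m z = z" "\<zeta> 0 z = x"
      using z xE by (auto simp: \<zeta>_def fun_eq_iff ebox_def in_Euclid)
    then have "f z - f x = (\<Sum>i<m. f (\<zeta> (Suc i) z) - f (\<zeta> i z))"
      by (subst sum_lessThan_telescope) simp
    also have "\<dots> = (\<Sum>i<m. A i z * (z i - x i))"
      by (rule sum.cong) (auto simp: A_def \<tau>(2)[OF _ z])
    finally show ?thesis .
  qed
  moreover have "(A i \<longlongrightarrow> partial_deriv i f x) (inf (nhds x) (principal (Euclid m)))" if i: "i < m" for i
  proof -
    let ?F = "inf (nhds x) (principal (Euclid m))"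
    have cx: "((\<lambda>z. z j) \<longlongrightarrow> x j) ?F" for j
    proof -
      have "isCont (\<lambda>z. z j) x"
        using continuous_on_coord[of UNIV j] continuous_on_eq_continuous_at[OF open_UNIV] by blast
      then have "((\<lambda>z. z j) \<longlongrightarrow> x j) (nhds x)"
        using tendsto_at_iff_tendsto_nhds[of "\<lambda>z. z j" x] by (simp add: isCont_def)
      then show ?thesis by (rule filterlim_mono) auto
    qed
    have FE: "\<forall>\<^sub>F z in ?F. z \<in> Euclid m" by (simp add: eventually_inf_principal)
    have "((\<lambda>z. (\<zeta> i z)(i := \<tau> i z)) \<longlongrightarrow> x) ?F"
    proof (rule tendsto_Euclid_nhds[OF _ _ xE])
      fix j
      show "((\<lambda>z. ((\<zeta> i z)(i := \<tau> i z)) j) \<longlongrightarrow> x j) ?F"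
      proof (rule Lim_transform_bound[where g = "\<lambda>z. z j - x j", THEN LIM_zero_cancel])
        show "\<forall>\<^sub>F z in ?F. norm (((\<zeta> i z)(i := \<tau> i z)) j - x j) \<le> norm (z j - x j)"
          using \<tau>(1)[OF i] by (intro always_eventually) (auto simp: \<zeta>_def)
        show "((\<lambda>z. z j - x j) \<longlongrightarrow> 0) ?F" by (rule LIM_zero[OF cx])
      qed
    next
      show "\<forall>\<^sub>F z in ?F. (\<zeta> i z)(i := \<tau> i z) \<in> Euclid m"
        using FE by eventually_elim (use i xE in \<open>auto simp: \<zeta>_def in_Euclid\<close>)
    qed
    moreover have "\<forall>\<^sub>F z in ?F. (\<zeta> i z)(i := \<tau> i z) \<in> U"
    proof -
      have "\<forall>\<^sub>F z in ?F. (\<zeta> i z)(i := \<tau> i z) \<in> Euclid m \<longrightarrow> (\<zeta> i z)(i := \<tau> i z) \<in> U"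
        by (rule eventually_compose_filterlim[OF eopen_eventually[OF U x] calculation])
      then show ?thesis using FE by eventually_elim (use i xE in \<open>auto simp: \<zeta>_def in_Euclid\<close>)
    qed
    moreover have "continuous_on U (partial_deriv i f)"
      using f i U by (auto simp: continuous_map_eopen eopen_subset)
    ultimately show ?thesis unfolding A_def
      using continuous_on_tendsto_compose[OF _ _ x] by blast
  qed
  ultimately show ?thesis using that e by blast
qed

lemma filterlim_Euclid_nhds:
  fixes \<gamma> :: "'b \<Rightarrow> nat \<Rightarrow> real"
  assumes "\<And>i. i < m \<Longrightarrow> ((\<lambda>t. \<gamma> t i) \<longlongrightarrow> x i) F" "\<forall>\<^sub>F t in F. \<gamma> t \<in> Euclid m" "x \<in> Euclid m"
  shows "filterlim \<gamma> (inf (nhds x) (principal (Euclid m))) F"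
  using tendsto_Euclid_nhds[OF assms] assms(2) by (auto simp: filterlim_inf filterlim_principal)

lemma eventually_ebox:
  assumes "e > 0" "x \<in> Euclid m"
  shows "\<forall>\<^sub>F z in inf (nhds x) (principal (Euclid m)). z \<in> ebox m x e"
  unfolding eventually_inf_principal
  by (rule eopen_eventually[OF eopen_ebox]) (use assms in \<open>auto simp: ebox_def\<close>)

lemma chain_rule_curve:
  assumes U: "eopen m U" and f: "C_k_on (Suc 0) m U f" and x: "\<gamma> t0 \<in> U"
    and D: "\<And>i. i < m \<Longrightarrow> ((\<lambda>t. \<gamma> t i) has_real_derivative D i) (at t0)"
    and E: "\<forall>\<^sub>F t in at t0. \<gamma> t \<in> Euclid m"
  shows "((\<lambda>t. f (\<gamma> t)) has_real_derivative (\<Sum>i<m. partial_deriv i f (\<gamma> t0) * D i)) (at t0)"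
proof -
  obtain A e where A: "e > 0" "ebox m (\<gamma> t0) e \<subseteq> U"
    "\<And>z. z \<in> ebox m (\<gamma> t0) e \<Longrightarrow> f z - f (\<gamma> t0) = (\<Sum>i<m. A i z * (z i - \<gamma> t0 i))"
    "\<And>i. i < m \<Longrightarrow> (A i \<longlongrightarrow> partial_deriv i f (\<gamma> t0)) (inf (nhds (\<gamma> t0)) (principal (Euclid m)))"
    by (rule C1_increment[OF U f x]) (rule that; assumption)
  have xE: "\<gamma> t0 \<in> Euclid m" using x eopen_subset[OF U] by auto
  have lim: "filterlim \<gamma> (inf (nhds (\<gamma> t0)) (principal (Euclid m))) (at t0)"
    using DERIV_isCont[OF D] by (intro filterlim_Euclid_nhds E xE) (auto simp: isCont_def)
  have "((\<lambda>t. \<Sum>i<m. A i (\<gamma> t) * ((\<gamma> t i - \<gamma> t0 i) / (t - t0))) \<longlongrightarrow>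
      (\<Sum>i<m. partial_deriv i f (\<gamma> t0) * D i)) (at t0)"
  proof (intro tendsto_sum tendsto_mult)
    fix i assume "i \<in> {..<m}"
    then show "((\<lambda>t. A i (\<gamma> t)) \<longlongrightarrow> partial_deriv i f (\<gamma> t0)) (at t0)"
      using filterlim_compose[OF A(4) lim] by auto
    show "((\<lambda>t. (\<gamma> t i - \<gamma> t0 i) / (t - t0)) \<longlongrightarrow> D i) (at t0)"
      using D[of i] \<open>i \<in> {..<m}\<close> by (simp add: has_field_derivative_iff)
  qed
  then have "((\<lambda>t. (f (\<gamma> t) - f (\<gamma> t0)) / (t - t0)) \<longlongrightarrow> (\<Sum>i<m. partial_deriv i f (\<gamma> t0) * D i)) (at t0)"
  proof (rule Lim_transform_eventually)
    have "\<forall>\<^sub>F t in at t0. \<gamma> t \<in> ebox m (\<gamma> t0) e"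
      by (rule eventually_compose_filterlim[OF eventually_ebox[OF A(1) xE] lim])
    then show "\<forall>\<^sub>F t in at t0. (\<Sum>i<m. A i (\<gamma> t) * ((\<gamma> t i - \<gamma> t0 i) / (t - t0))) = (f (\<gamma> t) - f (\<gamma> t0)) / (t - t0)"
      by eventually_elim (simp add: A(3) sum_divide_distrib)
  qed
  then show ?thesis by (simp add: has_field_derivative_iff)
qed

lemma has_partial_compose:
  assumes U: "eopen m U" and V: "eopen k V" and f: "C_k_on (Suc 0) k V f"
    and G: "\<And>x. x \<in> U \<Longrightarrow> G x \<in> V" "\<And>j. j < k \<Longrightarrow> C_k_on (Suc 0) m U (\<lambda>x. G x j)"
    and x: "x \<in> U" and i: "i < m"
  shows "((\<lambda>t. f (G (x(i := t)))) has_real_derivative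
    (\<Sum>j<k. partial_deriv j f (G x) * partial_deriv i (\<lambda>x. G x j) x)) (at (x i))"
proof -
  have "((\<lambda>t. f (G (x(i := t)))) has_real_derivative
    (\<Sum>j<k. partial_deriv j f (G (x(i := x i))) * partial_deriv i (\<lambda>x. G x j) x)) (at (x i))"
  proof (rule chain_rule_curve[OF V f])
    show "((\<lambda>t. G (x(i := t)) j) has_real_derivative partial_deriv i (\<lambda>x. G x j) x) (at (x i))" if "j < k" for j
      by (rule C_k_on_has_partial[OF G(2)[OF that] i x])
    have "\<forall>\<^sub>F t in at (x i). x(i := t) \<in> U"
      using upd_eventually[OF U x i] by (auto simp: eventually_at_filter elim: eventually_mono)
    then show "\<forall>\<^sub>F t in at (x i). G (x(i := t)) \<in> Euclid k"
      by eventually_elim (use G(1) eopen_subset[OF V] in auto)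
  qed (use G(1) x in auto)
  then show ?thesis by simp
qed

text \<open>
The derivative of the composite is a sum of products of composites of class one lower, so the
induction has to keep \<open>f\<close> general.
\<close>

lemma C_k_on_compose:
  assumes U: "eopen m U" and V: "eopen k V" and G: "\<And>x. x \<in> U \<Longrightarrow> G x \<in> V"
  shows "C_k_on r k V f \<Longrightarrow> (\<And>j. j < k \<Longrightarrow> C_k_on r m U (\<lambda>x. G x j)) \<Longrightarrow> C_k_on r m U (\<lambda>x. f (G x))"
proof (induction r arbitrary: f)
  case 0
  have "continuous_on U G"
  proof (rule continuous_on_Euclid_components)
    show "continuous_on U (\<lambda>x. G x j)" if "j < k" for j
      by (rule C_k_on_imp_continuous[OF U 0(2)[OF that]])
  qed (use G eopen_subset[OF V] in auto)
  moreover have "continuous_on V f" by (rule C_k_on_imp_continuous[OF V 0(1)])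
  ultimately have "continuous_on U (\<lambda>x. f (G x))"
    using continuous_on_compose2 G by (metis image_subset_iff)
  then show ?case using U by (auto simp: continuous_map_eopen eopen_subset)
next
  case (Suc r)
  have le: "C_k_on (Suc 0) k V f" "\<And>j. j < k \<Longrightarrow> C_k_on (Suc 0) m U (\<lambda>x. G x j)"
    using C_k_on_le[OF V Suc.prems(1)] C_k_on_le[OF U Suc.prems(2)] by (simp_all del: C_k_on.simps)
  have low: "C_k_on r k V f" "\<And>j. j < k \<Longrightarrow> C_k_on r m U (\<lambda>x. G x j)"
    using C_k_on_decrease[OF V Suc.prems(1)] C_k_on_decrease[OF U Suc.prems(2)] by auto
  show ?case
  proof (rule C_k_on_SucI[OF U])
    show "continuous_on U (\<lambda>x. f (G x))" using Suc.IH[OF low] C_k_on_imp_continuous[OF U] by blast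
    show "((\<lambda>t. f (G (x(i := t)))) has_real_derivative
      (\<Sum>j<k. partial_deriv j f (G x) * partial_deriv i (\<lambda>x. G x j) x)) (at (x i))" if "i < m" "x \<in> U" for i x
      by (rule has_partial_compose[OF U V le(1) G le(2) that(2,1)])
    show "C_k_on r m U (\<lambda>x. \<Sum>j<k. partial_deriv j f (G x) * partial_deriv i (\<lambda>x. G x j) x)" if "i < m" for i
    proof (intro C_k_on_sum[OF U] C_k_on_mult[OF U])
      fix j assume "j \<in> {..<k}"
      then have "C_k_on r k V (partial_deriv j f)" "C_k_on r m U (partial_deriv i (\<lambda>x. G x j))"
        using Suc.prems that by auto
      then show "C_k_on r m U (\<lambda>x. partial_deriv j f (G x))" "C_k_on r m U (partial_deriv i (\<lambda>x. G x j))"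
        using Suc.IH low(2) by auto
    qed
  qed
qed

lemma C_infinity_onD: "C_infinity_on m U f \<Longrightarrow> C_k_on r m U f"
  by (simp add: C_infinity_on_def)

lemma C_infinity_on_continuous: "eopen m U \<Longrightarrow> C_infinity_on m U f \<Longrightarrow> continuous_on U f"
  using C_infinity_onD C_k_on_imp_continuous by blast

lemma C_infinity_on_has_partial:
  "C_infinity_on m U f \<Longrightarrow> i < m \<Longrightarrow> x \<in> U \<Longrightarrow>
    ((\<lambda>t. f (x(i := t))) has_real_derivative partial_deriv i f x) (at (x i))"
  by (rule C_k_on_has_partial[OF C_infinity_onD])

lemma C_infinity_on_partial: "C_infinity_on m U f \<Longrightarrow> i < m \<Longrightarrow> C_infinity_on m U (partial_deriv i f)"
  unfolding C_infinity_on_def by (metis C_k_on.simps(2))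

lemma C_infinity_on_cong:
  "eopen m U \<Longrightarrow> (\<And>x. x \<in> U \<Longrightarrow> f x = g x) \<Longrightarrow> C_infinity_on m U f \<Longrightarrow> C_infinity_on m U g"
  unfolding C_infinity_on_def using C_k_on_cong by blast

lemma C_infinity_on_subset: "C_infinity_on m U f \<Longrightarrow> eopen m V \<Longrightarrow> V \<subseteq> U \<Longrightarrow> eopen m U \<Longrightarrow> C_infinity_on m V f"
  unfolding C_infinity_on_def using C_k_on_subset eopen_subset by blast

lemma C_infinity_on_const: "eopen m U \<Longrightarrow> C_infinity_on m U (\<lambda>x. c)"
  and C_infinity_on_coord: "eopen m U \<Longrightarrow> C_infinity_on m U (\<lambda>x. x i)"
  and C_infinity_on_add: "eopen m U \<Longrightarrow> C_infinity_on m U f \<Longrightarrow> C_infinity_on m U g \<Longrightarrow> C_infinity_on m U (\<lambda>x. f x + g x)"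
  and C_infinity_on_mult: "eopen m U \<Longrightarrow> C_infinity_on m U f \<Longrightarrow> C_infinity_on m U g \<Longrightarrow> C_infinity_on m U (\<lambda>x. f x * g x)"
  and C_infinity_on_sum: "eopen m U \<Longrightarrow> (\<And>i. i \<in> I \<Longrightarrow> C_infinity_on m U (h i)) \<Longrightarrow> C_infinity_on m U (\<lambda>x. \<Sum>i\<in>I. h i x)"
  unfolding C_infinity_on_def
  by (blast intro: C_k_on_const C_k_on_coord C_k_on_add C_k_on_mult C_k_on_sum)+

lemma C_infinity_on_diff:
  assumes "eopen m U" "C_infinity_on m U f" "C_infinity_on m U g"
  shows "C_infinity_on m U (\<lambda>x. f x - g x)"
proof -
  have "C_infinity_on m U (\<lambda>x. f x + (-1) * g x)"
    using assms by (intro C_infinity_on_add C_infinity_on_mult C_infinity_on_const)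
  then show ?thesis by simp
qed

lemma C_infinity_on_compose:
  assumes "eopen m U" "eopen k V" "C_infinity_on k V f" "\<And>x. x \<in> U \<Longrightarrow> G x \<in> V"
    "\<And>j. j < k \<Longrightarrow> C_infinity_on m U (\<lambda>x. G x j)"
  shows "C_infinity_on m U (\<lambda>x. f (G x))"
  unfolding C_infinity_on_def
  by (intro allI) (rule C_k_on_compose[OF assms(1,2,4) C_infinity_onD[OF assms(3)] C_infinity_onD[OF assms(5)]])

lemma partial_deriv_compose:
  assumes U: "eopen m U" and V: "eopen k V" and f: "C_infinity_on k V f"
    and G: "\<And>x. x \<in> U \<Longrightarrow> G x \<in> V" "\<And>j. j < k \<Longrightarrow> C_infinity_on m U (\<lambda>x. G x j)"
    and x: "x \<in> U" and i: "i < m"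
  shows "partial_deriv i (\<lambda>x. f (G x)) x = (\<Sum>j<k. partial_deriv j f (G x) * partial_deriv i (\<lambda>x. G x j) x)"
  by (rule partial_derivI, rule has_partial_compose[OF U V C_infinity_onD[OF f] G(1) C_infinity_onD[OF G(2)] x i])

lemma partial_deriv_add:
  assumes "C_infinity_on m U f" "C_infinity_on m U g" "i < m" "x \<in> U"
  shows "partial_deriv i (\<lambda>x. f x + g x) x = partial_deriv i f x + partial_deriv i g x"
  by (intro partial_derivI DERIV_add C_infinity_on_has_partial[OF assms(1)] C_infinity_on_has_partial[OF assms(2)] assms)

lemma partial_deriv_diff:
  assumes "C_infinity_on m U f" "C_infinity_on m U g" "i < m" "x \<in> U"
  shows "partial_deriv i (\<lambda>x. f x - g x) x = partial_deriv i f x - partial_deriv i g x"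
  by (intro partial_derivI DERIV_diff C_infinity_on_has_partial[OF assms(1)] C_infinity_on_has_partial[OF assms(2)] assms)

lemma partial_deriv_mult:
  assumes "C_infinity_on m U f" "C_infinity_on m U g" "i < m" "x \<in> U"
  shows "partial_deriv i (\<lambda>x. f x * g x) x = partial_deriv i f x * g x + f x * partial_deriv i g x"
  by (rule partial_derivI, rule DERIV_cong[OF DERIV_mult[OF C_infinity_on_has_partial[OF assms(1)] C_infinity_on_has_partial[OF assms(2)]]])
    (use assms in \<open>simp_all add: mult.commute\<close>)

lemma partial_deriv_sum:
  assumes "\<And>j. j \<in> J \<Longrightarrow> C_infinity_on m U (f j)" "i < m" "x \<in> U"
  shows "partial_deriv i (\<lambda>x. \<Sum>j\<in>J. f j x) x = (\<Sum>j\<in>J. partial_deriv i (f j) x)"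
  by (intro partial_derivI DERIV_sum C_infinity_on_has_partial[where m = m and U = U] assms)

lemma partial_deriv_const: "partial_deriv i (\<lambda>x. c) x = 0"
  by (rule partial_derivI) auto

lemma partial_deriv_coord: "partial_deriv i (\<lambda>x. x j) x = (if i = j then 1 else 0)"
  by (rule partial_derivI) (auto intro!: derivative_eq_intros)

text \<open>
The second difference is symmetric in \<open>i\<close> and \<open>j\<close>, while the right-hand side is not. Letting \<open>h\<close>
tend to 0 therefore identifies the two mixed derivatives.
\<close>

lemma mixed_difference:
  assumes U: "eopen m U" and f: "C_k_on (Suc (Suc 0)) m U f" and ij: "i < m" "j < m" "i \<noteq> j"
    and e: "ebox m x e \<subseteq> U" "x \<in> Euclid m" and h: "0 < h" "h < e"
  shows "\<exists>y\<in>ebox m x e. f (x(i := x i + h, j := x j + h)) - f (x(j := x j + h)) - f (x(i := x i + h)) + f x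
    = h * h * partial_deriv j (partial_deriv i f) y"
proof -
  have bx: "x(i := s, j := t) \<in> ebox m x e" if "\<bar>s - x i\<bar> \<le> h" "\<bar>t - x j\<bar> \<le> h" for s t
    using that h e(2) ij by (auto simp: ebox_def in_Euclid)
  have f1: "C_k_on (Suc 0) m U f" using C_k_on_decrease[OF U f] .
  have f2: "C_k_on (Suc 0) m U (partial_deriv i f)" using f ij by auto
  have d1: "((\<lambda>s. f (x(i := s, j := t))) has_real_derivative partial_deriv i f (x(i := s, j := t))) (at s)"
    if "\<bar>s - x i\<bar> \<le> h" "\<bar>t - x j\<bar> \<le> h" for s t
    using C_k_on_has_partial[OF f1 ij(1), of "x(i := s, j := t)"] bx[OF that] e(1) ij
    by (auto simp: fun_upd_twist)
  have d2: "((\<lambda>t. partial_deriv i f (x(i := s, j := t))) has_real_derivative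
      partial_deriv j (partial_deriv i f) (x(i := s, j := t))) (at t)"
    if "\<bar>s - x i\<bar> \<le> h" "\<bar>t - x j\<bar> \<le> h" for s t
    using C_k_on_has_partial[OF f2 ij(2), of "x(i := s, j := t)"] bx[OF that] e(1) by auto
  have "\<exists>\<sigma>. \<bar>\<sigma> - x i\<bar> \<le> \<bar>(x i + h) - x i\<bar> \<and>
      (f (x(i := x i + h, j := x j + h)) - f (x(i := x i + h, j := x j))) - (f (x(i := x i, j := x j + h)) - f (x(i := x i, j := x j)))
      = ((x i + h) - x i) * (partial_deriv i f (x(i := \<sigma>, j := x j + h)) - partial_deriv i f (x(i := \<sigma>, j := x j)))"
    using h by (intro mean_value_segment[where \<phi> = "\<lambda>s. f (x(i := s, j := x j + h)) - f (x(i := s, j := x j))"] DERIV_diff d1) auto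
  then obtain \<sigma> where \<sigma>: "\<bar>\<sigma> - x i\<bar> \<le> h"
      "(f (x(i := x i + h, j := x j + h)) - f (x(i := x i + h, j := x j))) - (f (x(i := x i, j := x j + h)) - f (x(i := x i, j := x j)))
      = h * (partial_deriv i f (x(i := \<sigma>, j := x j + h)) - partial_deriv i f (x(i := \<sigma>, j := x j)))"
    using h by auto
  have "\<exists>\<tau>. \<bar>\<tau> - x j\<bar> \<le> \<bar>(x j + h) - x j\<bar> \<and>
      partial_deriv i f (x(i := \<sigma>, j := x j + h)) - partial_deriv i f (x(i := \<sigma>, j := x j))
      = ((x j + h) - x j) * partial_deriv j (partial_deriv i f) (x(i := \<sigma>, j := \<tau>))"
    using h \<sigma>(1) by (intro mean_value_segment[where \<phi> = "\<lambda>t. partial_deriv i f (x(i := \<sigma>, j := t))"] d2) auto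
  then obtain \<tau> where \<tau>: "\<bar>\<tau> - x j\<bar> \<le> h"
      "partial_deriv i f (x(i := \<sigma>, j := x j + h)) - partial_deriv i f (x(i := \<sigma>, j := x j))
      = h * partial_deriv j (partial_deriv i f) (x(i := \<sigma>, j := \<tau>))"
    using h by auto
  show ?thesis
    using \<sigma>(2) ij(3) unfolding \<tau>(2)
    by (intro bexI[OF _ bx[OF \<sigma>(1) \<tau>(1)]]) (simp add: algebra_simps fun_upd_idem)
qed

lemma mixed_partials_commute:
  assumes U: "eopen m U" and f: "C_infinity_on m U f" and ij: "i < m" "j < m" and x: "x \<in> U"
  shows "partial_deriv j (partial_deriv i f) x = partial_deriv i (partial_deriv j f) x"
proof (cases "i = j")
  case False
  let ?a = "partial_deriv j (partial_deriv i f)" and ?b = "partial_deriv i (partial_deriv j f)"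
  have ab: "continuous_on U ?a" "continuous_on U ?b"
    using C_infinity_on_continuous[OF U] C_infinity_on_partial f ij by blast+
  have xE: "x \<in> Euclid m" using x eopen_subset[OF U] by auto
  show ?thesis
  proof (rule ccontr)
    assume ne: "?a x \<noteq> ?b x"
    define d where "d = \<bar>?a x - ?b x\<bar> / 2"
    have d: "d > 0" using ne by (simp add: d_def)
    have 1: "eopen m {y \<in> U. ?a y \<in> ball (?a x) d}"
      by (rule eopen_preimage_Int_open[OF U ab(1)]) simp
    have "eopen m {y \<in> {y \<in> U. ?a y \<in> ball (?a x) d}. ?b y \<in> ball (?b x) d}"
      by (rule eopen_preimage_Int_open[OF 1 continuous_on_subset[OF ab(2)]]) auto
    moreover have "x \<in> {y \<in> {y \<in> U. ?a y \<in> ball (?a x) d}. ?b y \<in> ball (?b x) d}" using x d by auto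
    ultimately obtain e where e: "e > 0" "ebox m x e \<subseteq> {y \<in> {y \<in> U. ?a y \<in> ball (?a x) d}. ?b y \<in> ball (?b x) d}"
      using eopen_contains_ebox by blast
    have eU: "ebox m x e \<subseteq> U" using e(2) by auto
    have h: "0 < e/2" "e/2 < e" using e(1) by auto
    have f2: "C_k_on (Suc (Suc 0)) m U f" using f by (rule C_infinity_onD)
    obtain y where y: "y \<in> ebox m x e"
      "f (x(i := x i + e/2, j := x j + e/2)) - f (x(j := x j + e/2)) - f (x(i := x i + e/2)) + f x = e/2 * (e/2) * ?a y"
      using mixed_difference[OF U f2 ij False eU xE h] by blast
    obtain z where z: "z \<in> ebox m x e"
      "f (x(j := x j + e/2, i := x i + e/2)) - f (x(i := x i + e/2)) - f (x(j := x j + e/2)) + f x = e/2 * (e/2) * ?b z"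
      using mixed_difference[OF U f2 ij(2,1) False[symmetric] eU xE h] by blast
    have "e/2 * (e/2) * ?a y = e/2 * (e/2) * ?b z"
      using y(2) z(2) unfolding fun_upd_twist[OF False, of x "x i + e/2" "x j + e/2"] by linarith
    then have "?a y = ?b z" using e(1) by simp
    moreover have "\<bar>?a y - ?a x\<bar> < d" "\<bar>?b z - ?b x\<bar> < d"
      using e(2) y(1) z(1) by (auto simp: dist_real_def abs_minus_commute)
    moreover have "\<bar>?a x - ?b x\<bar> \<le> \<bar>?a y - ?a x\<bar> + \<bar>?b z - ?b x\<bar>" unfolding \<open>?a y = ?b z\<close> by arith
    ultimately show False unfolding d_def by argo
  qed
qed auto


section \<open>Integration along rays\<close>

text \<open>
The contraction towards \<open>c\<close> of the coordinates outside \<open>S\<close>. For \<open>S = {}\<close> it moves along the ray to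
\<open>c\<close>; if \<open>S\<close> indexes the base coordinates of a fibration, it moves inside the fibre.
\<close>

definition radial :: "nat set \<Rightarrow> (nat \<Rightarrow> real) \<Rightarrow> real \<Rightarrow> (nat \<Rightarrow> real) \<Rightarrow> nat \<Rightarrow> real" where
  "radial S c s x = (\<lambda>j. if j \<in> S then x j else c j + s * (x j - c j))"

text \<open>
Every derivative in a direction outside \<open>S\<close> brings out a factor \<open>s\<close>. With the weights \<open>s ^ q\<close> the
family of these integrals is closed under differentiation, and its smoothness is a plain induction.
\<close>

definition radial_integral ::
  "nat set \<Rightarrow> (nat \<Rightarrow> real) \<Rightarrow> nat \<Rightarrow> ((nat \<Rightarrow> real) \<Rightarrow> real) \<Rightarrow> (nat \<Rightarrow> real) \<Rightarrow> real" where
  "radial_integral S c q f x = integral {0..1} (\<lambda>s. s ^ q * f (radial S c s x))"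

lemma radial_upd:
  "radial S c s (x(j := t)) = (radial S c s x)(j := if j \<in> S then t else c j + s * (t - c j))"
  by (auto simp: radial_def fun_eq_iff)

lemma radial_1: "radial S c 1 x = x"
  by (auto simp: radial_def fun_eq_iff)

lemma radial_in_Euclid: "x \<in> Euclid m \<Longrightarrow> c \<in> Euclid m \<Longrightarrow> radial S c s x \<in> Euclid m"
  by (auto simp: radial_def in_Euclid)

lemma radial_in_ebox:
  assumes "c \<in> Euclid m" "x \<in> ebox m c e" "0 \<le> s" "s \<le> 1"
  shows "radial S c s x \<in> ebox m c e"
proof -
  have "\<bar>s * (x i - c i)\<bar> \<le> \<bar>x i - c i\<bar>" for i
    using assms(3,4) by (simp add: abs_mult mult_left_le_one_le)
  then have "\<bar>radial S c s x i - c i\<bar> < e" if "i < m" for i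
    using assms(2) that by (auto simp: radial_def ebox_def intro: le_less_trans)
  then show ?thesis using radial_in_Euclid assms by (auto simp: ebox_def)
qed

lemma continuous_on_radial:
  assumes "continuous_on A g" "continuous_on A h"
  shows "continuous_on A (\<lambda>z. radial S c (g z) (h z))"
proof (rule continuous_on_coordinatewise_then_product)
  fix j show "continuous_on A (\<lambda>z. radial S c (g z) (h z) j)"
    using assms(1) continuous_on_product_then_coordinatewise[OF assms(2), of j]
    by (cases "j \<in> S") (simp_all add: radial_def continuous_intros)
qed

lemma continuous_on_radial_compose:
  assumes "continuous_on U f" "\<And>x s. x \<in> U \<Longrightarrow> 0 \<le> s \<Longrightarrow> s \<le> 1 \<Longrightarrow> radial S c s x \<in> U"
  shows "continuous_on (U \<times> {0..1}) (\<lambda>(x, s). s ^ q * f (radial S c s x))"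
proof -
  have "continuous_on (U \<times> {0..1}) (\<lambda>z. radial S c (snd z) (fst z))"
    by (intro continuous_on_radial continuous_intros)
  then have "continuous_on (U \<times> {0..1}) (\<lambda>z. f (radial S c (snd z) (fst z)))"
    by (rule continuous_on_compose2[OF assms(1)]) (use assms(2) in auto)
  then show ?thesis by (auto simp: case_prod_unfold intro!: continuous_intros)
qed

lemma radial_integrable:
  assumes "continuous_on U f" "\<And>x s. x \<in> U \<Longrightarrow> 0 \<le> s \<Longrightarrow> s \<le> 1 \<Longrightarrow> radial S c s x \<in> U" "x \<in> U"
  shows "(\<lambda>s. s ^ q * f (radial S c s x)) integrable_on {0..1}"
proof (rule integrable_continuous_interval)
  have "continuous_on {0..1} ((\<lambda>(x, s). s ^ q * f (radial S c s x)) \<circ> (\<lambda>s. (x, s)))"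
    by (rule continuous_on_compose[OF _ continuous_on_subset[OF continuous_on_radial_compose[OF assms(1,2)]]])
      (use assms(3) in \<open>auto intro!: continuous_intros\<close>)
  then show "continuous_on {0..1} (\<lambda>s. s ^ q * f (radial S c s x))" by (simp add: o_def)
qed

lemma continuous_on_radial_integral:
  assumes "continuous_on U f" "\<And>x s. x \<in> U \<Longrightarrow> 0 \<le> s \<Longrightarrow> s \<le> 1 \<Longrightarrow> radial S c s x \<in> U"
  shows "continuous_on U (radial_integral S c q f)"
  using integral_continuous_on_param[of U 0 1 "\<lambda>x s. s ^ q * f (radial S c s x)"]
    continuous_on_radial_compose[OF assms, of q]
  by (simp add: radial_integral_def[abs_def])

lemma has_partial_radial_integral:
  assumes U: "eopen m U" and f: "C_k_on (Suc 0) m U f"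
    and st: "\<And>x s. x \<in> U \<Longrightarrow> 0 \<le> s \<Longrightarrow> s \<le> 1 \<Longrightarrow> radial S c s x \<in> U"
    and j: "j < m" and x: "x \<in> U"
  shows "((\<lambda>t. radial_integral S c q f (x(j := t))) has_real_derivative
    radial_integral S c (if j \<in> S then q else Suc q) (partial_deriv j f) x) (at (x j))"
proof -
  let ?k = "\<lambda>s::real. if j \<in> S then 1 else s"
  obtain d where d: "d > 0" "ebox m x d \<subseteq> U" "x \<in> ebox m x d"
    using eopen_contains_ebox[OF U x] by blast
  let ?T = "{x j - d <..< x j + d}"
  have TU: "x(j := t) \<in> U" if "t \<in> ?T" for t
  proof -
    have "x(j := t) \<in> ebox m x d"
      using that d(1,3) j by (auto simp: ebox_def in_Euclid)
    then show ?thesis using d(2) by blast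
  qed
  have cf: "continuous_on U f" "continuous_on U (partial_deriv j f)"
    using C_k_on_imp_continuous[OF U f] f j by (auto simp: continuous_map_eopen eopen_subset[OF U])
  have "((\<lambda>t. integral (cbox 0 1) (\<lambda>s. s ^ q * f (radial S c s (x(j := t))))) has_field_derivative
      integral (cbox 0 1) (\<lambda>s. s ^ q * (?k s * partial_deriv j f (radial S c s (x(j := x j)))))) (at (x j) within ?T)"
  proof (rule leibniz_rule_field_derivative[where fx = "\<lambda>t s. s ^ q * (?k s * partial_deriv j f (radial S c s (x(j := t))))"])
    fix t s :: real assume t: "t \<in> ?T" and s: "s \<in> cbox 0 1"
    let ?y = "radial S c s (x(j := t))"
    have y: "?y \<in> U" using st[OF TU[OF t]] s by auto
    have yj: "?y j = (if j \<in> S then t else c j + s * (t - c j))" by (simp add: radial_upd)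
    have "((\<lambda>u. f (?y(j := u))) has_real_derivative partial_deriv j f ?y) (at (if j \<in> S then t else c j + s * (t - c j)))"
      using C_k_on_has_partial[OF f j y] yj by simp
    moreover have "((\<lambda>t. if j \<in> S then t else c j + s * (t - c j)) has_real_derivative ?k s) (at t)"
      by (auto intro!: derivative_eq_intros)
    ultimately have "((\<lambda>t. f (?y(j := if j \<in> S then t else c j + s * (t - c j)))) has_real_derivative
        partial_deriv j f ?y * ?k s) (at t)"
      by (rule DERIV_chain2)
    then have "((\<lambda>t. f (radial S c s (x(j := t)))) has_real_derivative ?k s * partial_deriv j f ?y) (at t)"
      by (simp add: radial_upd mult.commute)
    then have "((\<lambda>t. s ^ q * f (radial S c s (x(j := t)))) has_real_derivative s ^ q * (?k s * partial_deriv j f ?y)) (at t)"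
      by (rule DERIV_cmult)
    then show "((\<lambda>t. s ^ q * f (radial S c s (x(j := t)))) has_real_derivative s ^ q * (?k s * partial_deriv j f ?y)) (at t within ?T)"
      by (rule has_field_derivative_at_within)
  next
    fix t assume "t \<in> ?T"
    then show "(\<lambda>s. s ^ q * f (radial S c s (x(j := t)))) integrable_on cbox 0 1"
      using radial_integrable[OF cf(1) st TU] by simp
  next
    have "continuous_on (?T \<times> {0..1}) (\<lambda>z. radial S c (snd z) (x(j := fst z)))"
      by (intro continuous_on_radial continuous_on_snd continuous_on_id
          continuous_on_compose2[OF continuous_on_upd[of UNIV x j]] continuous_on_fst) auto
    then have "continuous_on (?T \<times> {0..1}) (\<lambda>z. partial_deriv j f (radial S c (snd z) (x(j := fst z))))"
      by (rule continuous_on_compose2[OF cf(2)]) (use st TU in auto)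
    then have "continuous_on (?T \<times> {0..1}) (\<lambda>z. snd z ^ q * (?k (snd z) * partial_deriv j f (radial S c (snd z) (x(j := fst z)))))"
      by (cases "j \<in> S") (auto intro!: continuous_intros)
    then show "continuous_on (?T \<times> cbox 0 1) (\<lambda>(t, s). s ^ q * (?k s * partial_deriv j f (radial S c s (x(j := t)))))"
      by (simp add: case_prod_unfold)
  qed (use d in auto)
  moreover have "(\<lambda>s. s ^ q * (?k s * partial_deriv j f (radial S c s (x(j := x j))))) =
      (\<lambda>s. s ^ (if j \<in> S then q else Suc q) * partial_deriv j f (radial S c s x))"
    by (auto simp: fun_eq_iff)
  moreover have "at (x j) within ?T = at (x j)" using d by (intro at_within_open) auto
  ultimately show ?thesis by (simp add: radial_integral_def)
qed

lemma C_k_on_radial_integral: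
  assumes U: "eopen m U"
    and st: "\<And>x s. x \<in> U \<Longrightarrow> 0 \<le> s \<Longrightarrow> s \<le> 1 \<Longrightarrow> radial S c s x \<in> U"
  shows "C_k_on r m U f \<Longrightarrow> C_k_on r m U (radial_integral S c q f)"
proof (induction r arbitrary: q f)
  case 0
  then show ?case using U continuous_on_radial_integral[OF _ st]
    by (auto simp: continuous_map_eopen eopen_subset)
next
  case (Suc r)
  have f1: "C_k_on (Suc 0) m U f" using C_k_on_le[OF U Suc.prems, of "Suc 0"] by (simp del: C_k_on.simps)
  show ?case
  proof (rule C_k_on_SucI[OF U])
    show "continuous_on U (radial_integral S c q f)"
      by (rule continuous_on_radial_integral[OF C_k_on_imp_continuous[OF U Suc.prems] st])
    show "((\<lambda>t. radial_integral S c q f (x(j := t))) has_real_derivative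
      radial_integral S c (if j \<in> S then q else Suc q) (partial_deriv j f) x) (at (x j))" if "j < m" "x \<in> U" for j x
      by (rule has_partial_radial_integral[OF U f1 st that])
    show "C_k_on r m U (radial_integral S c (if j \<in> S then q else Suc q) (partial_deriv j f))" if "j < m" for j
      using Suc that by auto
  qed
qed

lemma C_infinity_on_radial_integral:
  assumes "eopen m U" "C_infinity_on m U f"
    "\<And>x s. x \<in> U \<Longrightarrow> 0 \<le> s \<Longrightarrow> s \<le> 1 \<Longrightarrow> radial S c s x \<in> U"
  shows "C_infinity_on m U (radial_integral S c q f)"
  unfolding C_infinity_on_def
  by (intro allI) (rule C_k_on_radial_integral[OF assms(1,3) C_infinity_onD[OF assms(2)]])

lemma has_derivative_along_radial:
  assumes U: "eopen m U" and f: "C_infinity_on m U f" and c: "c \<in> Euclid m"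
    and x: "x \<in> Euclid m" "radial S c s x \<in> U"
  shows "((\<lambda>s. f (radial S c s x)) has_real_derivative
    (\<Sum>i\<in>{..<m} - S. partial_deriv i f (radial S c s x) * (x i - c i))) (at s)"
proof -
  have "((\<lambda>s. f (radial S c s x)) has_real_derivative
    (\<Sum>i<m. partial_deriv i f (radial S c s x) * (if i \<in> S then 0 else x i - c i))) (at s)"
  proof (rule chain_rule_curve[where \<gamma> = "\<lambda>s. radial S c s x", OF U C_infinity_onD[OF f] x(2)])
    show "((\<lambda>s. radial S c s x i) has_real_derivative (if i \<in> S then 0 else x i - c i)) (at s)" for i
      by (cases "i \<in> S") (auto simp: radial_def intro!: derivative_eq_intros)
    show "\<forall>\<^sub>F t in at s. radial S c t x \<in> Euclid m"
      using radial_in_Euclid[OF x(1) c] by simp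
  qed
  moreover have "(\<Sum>i<m. partial_deriv i f (radial S c s x) * (if i \<in> S then 0 else x i - c i)) =
      (\<Sum>i\<in>{..<m} - S. partial_deriv i f (radial S c s x) * (x i - c i))"
    by (rule sum.mono_neutral_cong_right) auto
  ultimately show ?thesis by simp
qed

text \<open>
Integrate the derivative of \<open>f\<close> along the ray from the centre. The remainder factors are smooth,
which is what makes derivations computable.
\<close>

lemma Hadamard_expansion:
  assumes U: "eopen m U" and f: "C_infinity_on m U f" and c: "c \<in> Euclid m"
    and st: "\<And>x s. x \<in> U \<Longrightarrow> 0 \<le> s \<Longrightarrow> s \<le> 1 \<Longrightarrow> radial {} c s x \<in> U"
    and x: "x \<in> U"
  shows "f x = f c + (\<Sum>i<m. (x i - c i) * radial_integral {} c 0 (partial_deriv i f) x)"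
proof -
  have xE: "x \<in> Euclid m" using x eopen_subset[OF U] by auto
  have I1: "((\<lambda>s. \<Sum>i<m. partial_deriv i f (radial {} c s x) * (x i - c i)) has_integral
      f (radial {} c 1 x) - f (radial {} c 0 x)) {0..1}"
    by (intro fundamental_theorem_of_calculus)
      (auto simp flip: has_real_derivative_iff_has_vector_derivative
        intro!: has_field_derivative_at_within has_derivative_along_radial[OF U f c xE, where S = "{}", simplified] st x)
  have r0: "radial {} c 0 x = c" by (simp add: radial_def)
  have I2: "((\<lambda>s. \<Sum>i<m. partial_deriv i f (radial {} c s x) * (x i - c i)) has_integral
      (\<Sum>i<m. (x i - c i) * radial_integral {} c 0 (partial_deriv i f) x)) {0..1}"
  proof (rule has_integral_sum)
    fix i assume "i \<in> {..<m}"
    then have "continuous_on U (partial_deriv i f)"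
      using C_infinity_on_continuous[OF U] C_infinity_on_partial[OF f] by auto
    from integrable_integral[OF radial_integrable[OF this st x, where q = 0]]
    have "((\<lambda>s. partial_deriv i f (radial {} c s x)) has_integral radial_integral {} c 0 (partial_deriv i f) x) {0..1}"
      by (simp add: radial_integral_def)
    from has_integral_mult_left[OF this, of "x i - c i"]
    show "((\<lambda>s. partial_deriv i f (radial {} c s x) * (x i - c i)) has_integral
        (x i - c i) * radial_integral {} c 0 (partial_deriv i f) x) {0..1}"
      by (simp add: mult.commute)
  qed simp
  show ?thesis using has_integral_unique[OF I1 I2] by (simp add: r0 radial_1)
qed

lemma radial_integral_at_centre: "radial_integral {} c 0 f c = f c"
proof -
  have "radial {} c s c = c" for s by (simp add: radial_def)
  then show ?thesis by (simp add: radial_integral_def)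
qed

text \<open>
The homotopy operator of the Poincare lemma, with the coordinates in \<open>S\<close> as parameters.
\<close>

definition fibre_primitive :: "nat \<Rightarrow> nat set \<Rightarrow> (nat \<Rightarrow> real) \<Rightarrow> (nat \<Rightarrow> (nat \<Rightarrow> real) \<Rightarrow> real) \<Rightarrow> (nat \<Rightarrow> real) \<Rightarrow> real" where
  "fibre_primitive m S c b x = (\<Sum>i\<in>{..<m} - S. (x i - c i) * radial_integral S c 0 (b i) x)"

lemma C_infinity_on_fibre_primitive:
  assumes U: "eopen m U" and b: "\<And>i. i \<in> {..<m} - S \<Longrightarrow> C_infinity_on m U (b i)"
    and st: "\<And>x s. x \<in> U \<Longrightarrow> 0 \<le> s \<Longrightarrow> s \<le> 1 \<Longrightarrow> radial S c s x \<in> U"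
  shows "C_infinity_on m U (fibre_primitive m S c b)"
  unfolding fibre_primitive_def[abs_def]
  by (intro C_infinity_on_sum C_infinity_on_mult C_infinity_on_diff C_infinity_on_coord C_infinity_on_const
      C_infinity_on_radial_integral U b st)

text \<open>
By closedness along the fibre, the derivative is the integral over \<open>[0, 1]\<close> of the derivative of
\<open>s b\<^sub>j(radial S c s x)\<close> with respect to \<open>s\<close>.
\<close>

lemma partial_deriv_fibre_primitive:
  assumes U: "eopen m U" and c: "c \<in> Euclid m" and b: "\<And>i. i \<in> {..<m} - S \<Longrightarrow> C_infinity_on m U (b i)"
    and st: "\<And>x s. x \<in> U \<Longrightarrow> 0 \<le> s \<Longrightarrow> s \<le> 1 \<Longrightarrow> radial S c s x \<in> U"
    and closed: "\<And>i j x. i \<in> {..<m} - S \<Longrightarrow> j \<in> {..<m} - S \<Longrightarrow> x \<in> U \<Longrightarrow> partial_deriv i (b j) x = partial_deriv j (b i) x"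
    and j: "j \<in> {..<m} - S" and x: "x \<in> U"
  shows "partial_deriv j (fibre_primitive m S c b) x = b j x"
proof -
  have xE: "x \<in> Euclid m" using x eopen_subset[OF U] by auto
  have jm: "j < m" using j by auto
  let ?R = "\<lambda>q f. radial_integral S c q f x"
  have p: "partial_deriv j (\<lambda>x. (x i - c i) * radial_integral S c 0 (b i) x) x =
      (if i = j then ?R 0 (b j) else 0) + (x i - c i) * ?R 1 (partial_deriv i (b j))"
    if i: "i \<in> {..<m} - S" for i
  proof -
    have "partial_deriv j (\<lambda>x. (x i - c i) * radial_integral S c 0 (b i) x) x =
        partial_deriv j (\<lambda>x. x i - c i) x * ?R 0 (b i) + (x i - c i) * partial_deriv j (radial_integral S c 0 (b i)) x"
      by (rule partial_deriv_mult[where m = m and U = U])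
        (auto intro!: C_infinity_on_diff C_infinity_on_coord C_infinity_on_const C_infinity_on_radial_integral U b st i jm x)
    moreover have "partial_deriv j (\<lambda>x. x i - c i) x = (if i = j then 1 else 0)"
      by (rule partial_derivI) (auto intro!: derivative_eq_intros)
    moreover have "partial_deriv j (radial_integral S c 0 (b i)) x = ?R (Suc 0) (partial_deriv j (b i))"
      using partial_derivI[OF has_partial_radial_integral[OF U C_infinity_onD[OF b[OF i]] st jm x]] j by simp
    moreover have "?R (Suc 0) (partial_deriv j (b i)) = ?R 1 (partial_deriv i (b j))"
      unfolding radial_integral_def by (rule integral_cong) (use st[OF x] closed[OF i j] in auto)
    ultimately show ?thesis by auto
  qed
  have "partial_deriv j (fibre_primitive m S c b) x =
      (\<Sum>i\<in>{..<m} - S. partial_deriv j (\<lambda>x. (x i - c i) * radial_integral S c 0 (b i) x) x)"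
    unfolding fibre_primitive_def[abs_def]
    by (rule partial_deriv_sum[where m = m and U = U])
      (auto intro!: C_infinity_on_mult C_infinity_on_diff C_infinity_on_coord C_infinity_on_const C_infinity_on_radial_integral U b st jm x)
  also have "\<dots> = (\<Sum>i\<in>{..<m} - S. (if i = j then ?R 0 (b j) else 0) + (x i - c i) * ?R 1 (partial_deriv i (b j)))"
    by (rule sum.cong) (auto simp: p)
  also have "\<dots> = ?R 0 (b j) + (\<Sum>i\<in>{..<m} - S. (x i - c i) * ?R 1 (partial_deriv i (b j)))"
    using j by (simp add: sum.distrib sum.delta)
  finally have 1: "partial_deriv j (fibre_primitive m S c b) x = ?R 0 (b j) + (\<Sum>i\<in>{..<m} - S. (x i - c i) * ?R 1 (partial_deriv i (b j)))" .
  let ?g = "\<lambda>s. b j (radial S c s x) + s * (\<Sum>i\<in>{..<m} - S. partial_deriv i (b j) (radial S c s x) * (x i - c i))"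
  have I1: "(?g has_integral 1 * b j (radial S c 1 x) - 0 * b j (radial S c 0 x)) {0..1}"
  proof (rule fundamental_theorem_of_calculus[where f = "\<lambda>s. s * b j (radial S c s x)"])
    fix s :: real assume s: "s \<in> {0..1}"
    have "((\<lambda>s. s * b j (radial S c s x)) has_real_derivative ?g s) (at s)"
      using DERIV_mult[OF DERIV_ident has_derivative_along_radial[OF U b[OF j] c xE st[OF x]], of s] s
      by (simp add: mult.commute)
    then show "((\<lambda>s. s * b j (radial S c s x)) has_vector_derivative ?g s) (at s within {0..1})"
      by (simp add: has_field_derivative_at_within flip: has_real_derivative_iff_has_vector_derivative)
  qed simp
  have I2: "(?g has_integral ?R 0 (b j) + (\<Sum>i\<in>{..<m} - S. (x i - c i) * ?R 1 (partial_deriv i (b j)))) {0..1}"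
    unfolding sum_distrib_left
  proof (intro has_integral_add has_integral_sum)
    show "((\<lambda>s. b j (radial S c s x)) has_integral ?R 0 (b j)) {0..1}"
      using integrable_integral[OF radial_integrable[OF C_infinity_on_continuous[OF U b[OF j]] st x, where q = 0]]
      by (simp add: radial_integral_def)
    fix i assume i: "i \<in> {..<m} - S"
    then have "continuous_on U (partial_deriv i (b j))"
      using C_infinity_on_continuous[OF U] C_infinity_on_partial[OF b[OF j]] by auto
    from integrable_integral[OF radial_integrable[OF this st x, where q = 1]]
    have "((\<lambda>s. s * partial_deriv i (b j) (radial S c s x)) has_integral ?R 1 (partial_deriv i (b j))) {0..1}"
      by (simp add: radial_integral_def)
    from has_integral_mult_left[OF this, of "x i - c i"]
    show "((\<lambda>s. s * (partial_deriv i (b j) (radial S c s x) * (x i - c i))) has_integral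
        (x i - c i) * ?R 1 (partial_deriv i (b j))) {0..1}"
      by (simp add: mult_ac)
  qed simp
  show ?thesis using 1 has_integral_unique[OF I1 I2] by (simp add: radial_1)
qed


section \<open>Exchanging one coordinate for a function\<close>

text \<open>
The inverse function theorem for a map that alters only the coordinate \<open>i\<close>. On a cube where
\<open>\<partial>\<^sub>i g\<close> has constant sign, \<open>g\<close> is monotone in that coordinate, so the map is injective, and by
invariance of domain it is a homeomorphism onto an open set. The partial derivatives of the inverse
are quotients of derivatives of \<open>g\<close> composed with the inverse, so it gains one order of
differentiability at a time.
\<close>

lemma replace_coordinate:
  assumes U: "eopen m U" and g: "C_infinity_on m U g" and i: "i < m" and p: "p \<in> U"
    and nz: "partial_deriv i g p \<noteq> 0"
  obtains U' V \<Psi> where "eopen m U'" "p \<in> U'" "U' \<subseteq> U" "\<And>x. x \<in> U' \<Longrightarrow> partial_deriv i g x \<noteq> 0" "eopen m V"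
    "\<And>x. x \<in> U' \<Longrightarrow> x(i := g x) \<in> V" "\<And>x. x \<in> U' \<Longrightarrow> \<Psi> (x(i := g x)) = x"
    "\<And>y. y \<in> V \<Longrightarrow> \<Psi> y \<in> U'" "\<And>y. y \<in> V \<Longrightarrow> (\<Psi> y)(i := g (\<Psi> y)) = y"
    "\<And>l. l < m \<Longrightarrow> C_infinity_on m V (\<lambda>y. \<Psi> y l)"
proof -
  let ?\<Phi> = "\<lambda>x. x(i := g x)"
  have gi: "C_infinity_on m U (partial_deriv i g)" using C_infinity_on_partial[OF g i] .
  have "open {y. y * partial_deriv i g p > 0}"
    by (intro open_Collect_less continuous_intros)
  from eopen_preimage_Int_open[OF U C_infinity_on_continuous[OF U gi] this]
  have "eopen m {x \<in> U. partial_deriv i g x \<in> {y. y * partial_deriv i g p > 0}}" .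
  moreover have "p \<in> {x \<in> U. partial_deriv i g x \<in> {y. y * partial_deriv i g p > 0}}"
    using p nz by (simp add: zero_less_mult_iff) linarith
  ultimately obtain e where e: "e > 0" "ebox m p e \<subseteq> {x \<in> U. partial_deriv i g x \<in> {y. y * partial_deriv i g p > 0}}"
      "p \<in> ebox m p e"
    by (rule eopen_contains_ebox)
  define B where "B = ebox m p e"
  have BU: "B \<subseteq> U" and Bo: "eopen m B" and pB: "p \<in> B" and BE: "B \<subseteq> Euclid m"
    using e eopen_ebox by (auto simp: B_def ebox_def)
  have Bnz: "partial_deriv i g x \<noteq> 0" if "x \<in> B" for x using that e(2) by (auto simp: B_def)
  have gB: "C_infinity_on m B g" using C_infinity_on_subset[OF g Bo BU U] .
  \<comment> \<open>On the cube the derivative has no zero, so by the mean value theorem \<open>g\<close> is injective in coordinate \<open>i\<close>.\<close>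
  have neq: "g x \<noteq> g x'" if x: "x \<in> B" "x' \<in> B" "x' = x(i := x' i)" "x i < x' i" for x x'
  proof -
    have "((\<lambda>t. g (x(i := t))) has_real_derivative partial_deriv i g (x(i := t))) (at t)" "x(i := t) \<in> B"
      if "x i \<le> t" "t \<le> x' i" for t
    proof -
      have "\<bar>t - p i\<bar> < e" using that \<open>x \<in> B\<close> \<open>x' \<in> B\<close> i by (auto simp: B_def ebox_def abs_less_iff)
      then show xt: "x(i := t) \<in> B" using \<open>x \<in> B\<close> i by (auto simp: B_def ebox_def in_Euclid)
      then show "((\<lambda>t. g (x(i := t))) has_real_derivative partial_deriv i g (x(i := t))) (at t)"
        using C_infinity_on_has_partial[OF gB i xt] by simp
    qed
    then obtain z where z: "x i < z" "z < x' i" "g (x(i := x' i)) - g (x(i := x i)) = (x' i - x i) * partial_deriv i g (x(i := z))"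
        "x(i := z) \<in> B"
      using MVT2[OF x(4), of "\<lambda>t. g (x(i := t))" "\<lambda>t. partial_deriv i g (x(i := t))"] by force
    then show ?thesis using Bnz[OF z(4)] x(3,4) by (metis diff_self fun_upd_triv mult_eq_0_iff right_minus_eq less_irrefl)
  qed
  have inj: "inj_on ?\<Phi> B"
  proof (rule inj_onI)
    fix x x' assume a: "x \<in> B" "x' \<in> B" "?\<Phi> x = ?\<Phi> x'"
    then have off: "x' = x(i := x' i)" "x = x'(i := x i)" and "g x = g x'"
      by (metis fun_upd_triv fun_upd_upd) (metis a(3) fun_upd_triv fun_upd_upd, metis a(3) fun_upd_same)
    then have "\<not> x i < x' i" "\<not> x' i < x i" using neq a by metis+
    then show "x = x'" using off by (metis fun_upd_triv linorder_less_linear)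
  qed
  have cont: "continuous_on B ?\<Phi>"
  proof (rule continuous_on_coordinatewise_then_product)
    fix j show "continuous_on B (\<lambda>x. ?\<Phi> x j)"
      using C_infinity_on_continuous[OF Bo gB] continuous_on_coord by (cases "j = i") auto
  qed
  have E: "?\<Phi> x \<in> Euclid m" if "x \<in> B" for x using that BE i by (auto simp: in_Euclid)
  have img: "eopen m (?\<Phi> ` W)" if "eopen m W" "W \<subseteq> B" for W
    by (rule invariance_of_domain_Euclidean_space[OF that(1)])
      (use that E continuous_on_subset[OF cont] inj_on_subset[OF inj] eopen_subset[OF that(1)] in \<open>auto intro!: continuous_map_into_Euclid\<close>)
  define V where "V = ?\<Phi> ` B"
  define \<Psi> where "\<Psi> = inv_into B ?\<Phi>"
  have V: "eopen m V" unfolding V_def using img[OF Bo] by auto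
  have \<Psi>B: "\<Psi> y \<in> B" and \<Phi>\<Psi>: "?\<Phi> (\<Psi> y) = y" if "y \<in> V" for y
    using that inv_into_into[of y ?\<Phi> B] f_inv_into_f[of y ?\<Phi> B] unfolding V_def \<Psi>_def by auto
  have \<Psi>\<Phi>: "\<Psi> (?\<Phi> x) = x" if "x \<in> B" for x unfolding \<Psi>_def using inv_into_f_f[OF inj that] .
  have c\<Psi>: "continuous_on V \<Psi>"
    unfolding continuous_openin_preimage_eq
  proof (intro allI impI)
    fix T :: "(nat \<Rightarrow> real) set" assume "open T"
    then have "eopen m (?\<Phi> ` (B \<inter> T))"
      using Bo by (intro img) (auto simp: eopen_iff intro: open_Int)
    moreover have "V \<inter> \<Psi> -` T = ?\<Phi> ` (B \<inter> T)"
      using \<Psi>B \<Phi>\<Psi> \<Psi>\<Phi> unfolding V_def by (auto simp: image_iff)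
    ultimately obtain W where "open W" "V \<inter> \<Psi> -` T = Euclid m \<inter> W"
      unfolding eopen_iff by auto
    then show "openin (top_of_set V) (V \<inter> \<Psi> -` T)"
      using eopen_subset[OF V] unfolding openin_open by (intro exI[of _ W]) auto
  qed
  have \<Psi>off: "\<Psi> y k = y k" if "y \<in> V" "k \<noteq> i" for y k
    using \<Phi>\<Psi>[OF that(1)] that(2) by (metis fun_upd_other)
  have g\<Psi>: "g (\<Psi> y) = y i" if "y \<in> V" for y using \<Phi>\<Psi>[OF that] by (metis fun_upd_same)
  \<comment> \<open>The derivative of \<open>\<Psi> y i\<close>, read off by differentiating \<open>g (\<Psi> y) = y i\<close> with respect to \<open>y l\<close>.\<close>
  let ?D = "\<lambda>l y. ((if l = i then 1 else 0) - (if l = i then 0 else 1) * partial_deriv l g (\<Psi> y)) / partial_deriv i g (\<Psi> y)"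
  have der: "((\<lambda>t. \<Psi> (y(l := t)) i) has_real_derivative ?D l y) (at (y l))" if l: "l < m" and y: "y \<in> V" for l y
  proof -
    let ?x = "\<Psi> y" and ?\<gamma> = "\<lambda>t. \<Psi> (y(l := t))"
    obtain A d where A: "d > 0" "ebox m ?x d \<subseteq> B"
      "\<And>z. z \<in> ebox m ?x d \<Longrightarrow> g z - g ?x = (\<Sum>k<m. A k z * (z k - ?x k))"
      "\<And>k. k < m \<Longrightarrow> (A k \<longlongrightarrow> partial_deriv k g ?x) (inf (nhds ?x) (principal (Euclid m)))"
      by (rule C1_increment[OF Bo C_infinity_onD[OF gB] \<Psi>B[OF y]]) (rule that; assumption)
    have evV: "\<forall>\<^sub>F t in at (y l). y(l := t) \<in> V"
      using upd_eventually[OF V y l] by (auto simp: eventually_at_filter elim: eventually_mono)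
    have xE: "?x \<in> Euclid m" using \<Psi>B[OF y] BE by auto
    have evE: "\<forall>\<^sub>F t in at (y l). ?\<gamma> t \<in> Euclid m" using evV by eventually_elim (use \<Psi>B BE in auto)
    have "((\<lambda>t. y(l := t)) \<longlongrightarrow> y) (at (y l))"
      using upd_tendsto[of y l] by (rule filterlim_mono) (auto simp: at_within_def)
    then have "(?\<gamma> \<longlongrightarrow> ?x) (at (y l))"
      using continuous_on_tendsto_compose[OF c\<Psi> _ y evV] by simp
    then have lim: "filterlim ?\<gamma> (inf (nhds ?x) (principal (Euclid m))) (at (y l))"
      using evE by (simp add: filterlim_inf filterlim_principal)
    have limA: "((\<lambda>t. A k (?\<gamma> t)) \<longlongrightarrow> partial_deriv k g ?x) (at (y l))" if "k < m" for k
      using filterlim_compose[OF A(4)[OF that] lim] .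
    have nz': "partial_deriv i g ?x \<noteq> 0" using Bnz \<Psi>B[OF y] by auto
    have "((\<lambda>t. ((if l = i then 1 else 0) - (if l = i then 0 else 1) * A l (?\<gamma> t)) / A i (?\<gamma> t)) \<longlongrightarrow> ?D l y) (at (y l))"
      by (intro tendsto_divide tendsto_diff tendsto_mult tendsto_const limA l i nz')
    then have "((\<lambda>t. (?\<gamma> t i - ?\<gamma> (y l) i) / (t - y l)) \<longlongrightarrow> ?D l y) (at (y l))"
    proof (rule Lim_transform_eventually)
      have "\<forall>\<^sub>F t in at (y l). ?\<gamma> t \<in> ebox m ?x d"
        by (rule eventually_compose_filterlim[OF eventually_ebox[OF A(1) xE] lim])
      moreover have "\<forall>\<^sub>F t in at (y l). A i (?\<gamma> t) \<noteq> 0"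
        using tendsto_imp_eventually_ne[OF limA[OF i] nz'] .
      moreover have "\<forall>\<^sub>F t in at (y l). t \<noteq> y l" by (simp add: eventually_at_filter)
      ultimately show "\<forall>\<^sub>F t in at (y l). ((if l = i then 1 else 0) - (if l = i then 0 else 1) * A l (?\<gamma> t)) / A i (?\<gamma> t)
          = (?\<gamma> t i - ?\<gamma> (y l) i) / (t - y l)"
        using evV
      proof eventually_elim
        fix t assume t: "?\<gamma> t \<in> ebox m ?x d" "A i (?\<gamma> t) \<noteq> 0" "t \<noteq> y l" "y(l := t) \<in> V"
        have "(y(l := t)) i - y i = g (?\<gamma> t) - g ?x" using g\<Psi> t(4) y by simp
        also have "\<dots> = (\<Sum>k<m. A k (?\<gamma> t) * (?\<gamma> t k - ?x k))" by (rule A(3)[OF t(1)])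
        also have "\<dots> = A i (?\<gamma> t) * (?\<gamma> t i - ?x i) + (\<Sum>k\<in>{..<m} - {i}. A k (?\<gamma> t) * (?\<gamma> t k - ?x k))"
          using i by (subst sum.remove[of _ i]) auto
        also have "(\<Sum>k\<in>{..<m} - {i}. A k (?\<gamma> t) * (?\<gamma> t k - ?x k)) =
            (\<Sum>k\<in>{..<m} - {i}. if k = l then A l (?\<gamma> t) * (t - y l) else 0)"
          by (rule sum.cong) (use \<Psi>off t(4) y in auto)
        also have "\<dots> = (if l = i then 0 else 1) * A l (?\<gamma> t) * (t - y l)"
          using l by (simp add: sum.delta)
        finally have "(y(l := t)) i - y i = A i (?\<gamma> t) * (?\<gamma> t i - ?x i) + (if l = i then 0 else 1) * A l (?\<gamma> t) * (t - y l)" .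
        moreover have "(y(l := t)) i - y i = (if l = i then t - y l else 0)" by auto
        ultimately have "(if l = i then t - y l else 0) = A i (?\<gamma> t) * (?\<gamma> t i - ?x i) + (if l = i then 0 else 1) * A l (?\<gamma> t) * (t - y l)"
          by (simp only:)
        then show "((if l = i then 1 else 0) - (if l = i then 0 else 1) * A l (?\<gamma> t)) / A i (?\<gamma> t)
          = (?\<gamma> t i - ?\<gamma> (y l) i) / (t - y l)"
          using t(2,3) by (cases "l = i") (auto simp: field_simps)
      qed
    qed
    then show ?thesis by (simp add: has_field_derivative_iff)
  qed
  have off: "C_k_on r m V (\<lambda>y. \<Psi> y k)" if "k \<noteq> i" for r k
    by (rule C_k_on_cong[OF V _ C_k_on_coord[OF V, of r k]]) (use \<Psi>off that in auto)
  have ci: "continuous_on V (\<lambda>y. \<Psi> y i)" by (rule continuous_on_product_then_coordinatewise[OF c\<Psi>])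
  have smi: "C_k_on r m V (\<lambda>y. \<Psi> y i)" for r
  proof (induction r)
    case 0 then show ?case using ci V by (simp add: continuous_map_eopen eopen_subset)
  next
    case (Suc r)
    have comp: "C_k_on r m V (\<lambda>y. partial_deriv l g (\<Psi> y))" if "l < m" for l
    proof (rule C_k_on_compose[OF V Bo \<Psi>B])
      show "C_k_on r m B (partial_deriv l g)" using C_infinity_onD[OF C_infinity_on_partial[OF gB that]] .
      show "C_k_on r m V (\<lambda>y. \<Psi> y k)" for k using Suc off by (cases "k = i") auto
    qed
    have diff: "C_k_on r m V (\<lambda>y. c - d * partial_deriv l g (\<Psi> y))" if "l < m" for l c d
      using C_k_on_add[OF V C_k_on_const[OF V, of r c] C_k_on_mult[OF V C_k_on_const[OF V, of r "-d"] comp[OF that]]]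
      by simp
    show ?case
      by (rule C_k_on_SucI[where g = ?D, OF V ci der C_k_on_divide[OF V _ diff comp]]) (use i Bnz \<Psi>B in auto)
  qed
  show ?thesis
    by (rule that[of B V \<Psi>])
      (use Bo pB BU Bnz V \<Psi>\<Phi> \<Psi>B \<Phi>\<Psi> smi off in \<open>auto simp: V_def C_infinity_on_def\<close>, metis)
qed

section \<open>Changes of coordinates by quadratures\<close>

text \<open>
Smoothness is not part of \<^const>\<open>quad\<close>, whose members may be known functions of any kind, but
every differentiation rule needs it. The two properties are therefore carried along together.
\<close>

definition quad_smooth ::
  "(nat \<times> (nat \<Rightarrow> real) set \<times> ((nat \<Rightarrow> real) \<Rightarrow> real)) set \<Rightarrow> nat \<Rightarrow> (nat \<Rightarrow> real) set \<Rightarrow> ((nat \<Rightarrow> real) \<Rightarrow> real) \<Rightarrow> bool"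
where
  "quad_smooth D m U f \<longleftrightarrow> eopen m U \<and> quad D m U f \<and> C_infinity_on m U f"

lemma quad_smooth_eopen: "quad_smooth D m U f \<Longrightarrow> eopen m U"
  and quad_smooth_quad: "quad_smooth D m U f \<Longrightarrow> quad D m U f"
  and quad_smooth_smooth: "quad_smooth D m U f \<Longrightarrow> C_infinity_on m U f"
  by (auto simp: quad_smooth_def)

lemma quad_smooth_cong:
  "quad_smooth D m U f \<Longrightarrow> (\<And>x. x \<in> U \<Longrightarrow> f x = g x) \<Longrightarrow> quad_smooth D m U g"
  unfolding quad_smooth_def using C_infinity_on_cong[of m U f g] quad.restriction[of D m U f U g] by auto

lemma quad_smooth_subset: "quad_smooth D m U f \<Longrightarrow> eopen m V \<Longrightarrow> V \<subseteq> U \<Longrightarrow> quad_smooth D m V f"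
  unfolding quad_smooth_def using C_infinity_on_subset[of m U f V] quad.restriction[of D m U f V f] by auto

lemma quad_smooth_const: "eopen m U \<Longrightarrow> quad_smooth D m U (\<lambda>x. c)"
  by (simp add: quad_smooth_def quad.const C_infinity_on_const)

lemma quad_smooth_coord: "eopen m U \<Longrightarrow> i < m \<Longrightarrow> quad_smooth D m U (\<lambda>x. x i)"
  by (simp add: quad_smooth_def quad.coord C_infinity_on_coord)

lemma quad_smooth_add: "quad_smooth D m U f \<Longrightarrow> quad_smooth D m U g \<Longrightarrow> quad_smooth D m U (\<lambda>x. f x + g x)"
  by (simp add: quad_smooth_def quad.add C_infinity_on_add)

lemma quad_smooth_mult: "quad_smooth D m U f \<Longrightarrow> quad_smooth D m U g \<Longrightarrow> quad_smooth D m U (\<lambda>x. f x * g x)"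
  by (simp add: quad_smooth_def quad.mult C_infinity_on_mult)

lemma quad_smooth_diff:
  assumes "quad_smooth D m U f" "quad_smooth D m U g" shows "quad_smooth D m U (\<lambda>x. f x - g x)"
  using quad_smooth_add[OF assms(1) quad_smooth_mult[OF quad_smooth_const[OF quad_smooth_eopen[OF assms(1)], of D "-1"] assms(2)]]
  by simp

lemma quad_smooth_sum:
  "eopen m U \<Longrightarrow> (\<And>i. i \<in> I \<Longrightarrow> quad_smooth D m U (f i)) \<Longrightarrow> quad_smooth D m U (\<lambda>x. \<Sum>i\<in>I. f i x)"
  by (induction I rule: infinite_finite_induct) (auto intro: quad_smooth_const quad_smooth_add)

lemma quad_smooth_partial: "quad_smooth D m U f \<Longrightarrow> i < m \<Longrightarrow> quad_smooth D m U (partial_deriv i f)"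
  by (simp add: quad_smooth_def quad.derivative C_infinity_on_partial)

lemma quad_smooth_compose:
  assumes U: "eopen m U" and f: "quad_smooth D k V f" and G: "\<And>x. x \<in> U \<Longrightarrow> G x \<in> V"
    "\<And>j. j < k \<Longrightarrow> quad_smooth D m U (\<lambda>x. G x j)"
  shows "quad_smooth D m U (\<lambda>x. f (G x))"
proof -
  have V: "eopen k V" using f by (simp add: quad_smooth_def)
  have t: "tuple k (\<lambda>j. G x j) = G x" if "x \<in> U" for x
    using G(1)[OF that] eopen_subset[OF V] by (auto simp: tuple_def fun_eq_iff in_Euclid subset_iff)
  have "quad D m U (\<lambda>x. f (tuple k (\<lambda>j. G x j)))"
    by (rule quad.composition[OF quad_smooth_quad[OF f] U quad_smooth_quad[OF G(2)]]) (use t G(1) in auto)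
  then have "quad D m U (\<lambda>x. f (G x))" by (rule quad.restriction[OF _ U]) (use t in auto)
  moreover have "C_infinity_on m U (\<lambda>x. f (G x))"
    by (rule C_infinity_on_compose[OF U V quad_smooth_smooth[OF f] G(1) quad_smooth_smooth[OF G(2)]])
  ultimately show ?thesis using U by (simp add: quad_smooth_def)
qed

text \<open>
Both directions have to be computable from the known functions: the data are expressed in the new
coordinates by means of \<open>\<Psi>\<close>, and a solution found there is read in the old ones by means of both.
\<close>

definition coord_change ::
  "(nat \<times> (nat \<Rightarrow> real) set \<times> ((nat \<Rightarrow> real) \<Rightarrow> real)) set \<Rightarrow> nat \<Rightarrow>
   (nat \<Rightarrow> real) set \<Rightarrow> (nat \<Rightarrow> real) set \<Rightarrow>
   ((nat \<Rightarrow> real) \<Rightarrow> nat \<Rightarrow> real) \<Rightarrow> ((nat \<Rightarrow> real) \<Rightarrow> nat \<Rightarrow> real) \<Rightarrow> bool"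
where
  "coord_change D m U V \<Phi> \<Psi> \<longleftrightarrow> eopen m U \<and> eopen m V \<and>
     (\<forall>x\<in>U. \<Phi> x \<in> V \<and> \<Psi> (\<Phi> x) = x) \<and> (\<forall>y\<in>V. \<Psi> y \<in> U \<and> \<Phi> (\<Psi> y) = y) \<and>
     (\<forall>i<m. quad_smooth D m U (\<lambda>x. \<Phi> x i) \<and> quad_smooth D m V (\<lambda>y. \<Psi> y i))"

lemma coord_changeD:
  assumes "coord_change D m U V \<Phi> \<Psi>"
  shows "eopen m U" "eopen m V" "\<And>x. x \<in> U \<Longrightarrow> \<Phi> x \<in> V" "\<And>x. x \<in> U \<Longrightarrow> \<Psi> (\<Phi> x) = x"
    "\<And>y. y \<in> V \<Longrightarrow> \<Psi> y \<in> U" "\<And>y. y \<in> V \<Longrightarrow> \<Phi> (\<Psi> y) = y"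
    "\<And>i. i < m \<Longrightarrow> quad_smooth D m U (\<lambda>x. \<Phi> x i)" "\<And>i. i < m \<Longrightarrow> quad_smooth D m V (\<lambda>y. \<Psi> y i)"
    "\<And>i. i < m \<Longrightarrow> C_infinity_on m U (\<lambda>x. \<Phi> x i)" "\<And>i. i < m \<Longrightarrow> C_infinity_on m V (\<lambda>y. \<Psi> y i)"
  using assms by (auto simp: coord_change_def quad_smooth_def)

lemma coord_change_sym: "coord_change D m U V \<Phi> \<Psi> \<Longrightarrow> coord_change D m V U \<Psi> \<Phi>"
  by (auto simp: coord_change_def)

lemma coord_change_continuous:
  assumes "coord_change D m U V \<Phi> \<Psi>" shows "continuous_on U \<Phi>"
proof (rule continuous_on_Euclid_components)
  show "\<Phi> x \<in> Euclid m" if "x \<in> U" for x using coord_changeD(2,3)[OF assms] that eopen_subset by blast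
  show "continuous_on U (\<lambda>x. \<Phi> x j)" if "j < m" for j
    by (rule C_infinity_on_continuous[OF coord_changeD(1)[OF assms] coord_changeD(9)[OF assms that]])
qed

lemma coord_change_compose:
  assumes 1: "coord_change D m U1 V1 \<Phi>1 \<Psi>1" and 2: "coord_change D m U2 V2 \<Phi>2 \<Psi>2" and sub: "U2 \<subseteq> V1"
  shows "coord_change D m {x \<in> U1. \<Phi>1 x \<in> U2} V2 (\<lambda>x. \<Phi>2 (\<Phi>1 x)) (\<lambda>y. \<Psi>1 (\<Psi>2 y))"
proof -
  have E1: "\<Phi>1 x \<in> Euclid m" if "x \<in> U1" for x using coord_changeD(2,3)[OF 1] that eopen_subset by blast
  have o: "eopen m {x \<in> U1. \<Phi>1 x \<in> U2}"
    by (rule eopen_preimage[OF coord_changeD(1)[OF 1] coord_changeD(1)[OF 2] coord_change_continuous[OF 1] E1])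
  have a: "quad_smooth D m {x \<in> U1. \<Phi>1 x \<in> U2} (\<lambda>x. \<Phi>2 (\<Phi>1 x) i)" if "i < m" for i
    by (rule quad_smooth_compose[OF o coord_changeD(7)[OF 2 that] _ quad_smooth_subset[OF coord_changeD(7)[OF 1] o]]) auto
  have b: "quad_smooth D m V2 (\<lambda>y. \<Psi>1 (\<Psi>2 y) i)" if "i < m" for i
    by (rule quad_smooth_compose[OF coord_changeD(2)[OF 2] coord_changeD(8)[OF 1 that] _ coord_changeD(8)[OF 2]])
      (use sub coord_changeD(5)[OF 2] in auto)
  show ?thesis
    unfolding coord_change_def
    using o a b coord_changeD[OF 1] coord_changeD[OF 2] sub by (auto simp: subset_iff)
qed

lemma coord_change_id: "eopen m U \<Longrightarrow> coord_change D m U U (\<lambda>x. x) (\<lambda>x. x)"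
  by (auto simp: coord_change_def quad_smooth_coord)

lemma coord_change_jacobian:
  assumes c: "coord_change D m U V \<Phi> \<Psi>" and x: "x \<in> U" and il: "i < m" "l < m"
  shows "(\<Sum>k<m. partial_deriv k (\<lambda>y. \<Psi> y i) (\<Phi> x) * partial_deriv l (\<lambda>x. \<Phi> x k) x) = (if l = i then 1 else 0)"
proof -
  note d = coord_changeD[OF c]
  have "partial_deriv l (\<lambda>x. \<Psi> (\<Phi> x) i) x = partial_deriv l (\<lambda>x. x i) x"
    by (rule partial_deriv_cong[OF d(1) x il(2)]) (use d in auto)
  then show ?thesis
    using partial_deriv_compose[OF d(1,2) d(10)[OF il(1)] d(3) d(9) x il(2)] by (simp add: partial_deriv_coord)
qed

text \<open>
The inverse of exchanging a coordinate solves the equations \<open>x\<^sub>j = y\<^sub>j\<close> for \<open>j \<noteq> i\<close> and \<open>g x = y\<^sub>i\<close>, so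
it is an instance of \<open>inversion\<close>.
\<close>

lemma coord_change_replace:
  assumes U: "eopen m U" and g: "quad_smooth D m U g" and i: "i < m" and p: "p \<in> U"
    and nz: "partial_deriv i g p \<noteq> 0"
  obtains U' V \<Psi> where "p \<in> U'" "U' \<subseteq> U" "coord_change D m U' V (\<lambda>x. x(i := g x)) \<Psi>"
proof -
  obtain U' V \<Psi> where *: "eopen m U'" "p \<in> U'" "U' \<subseteq> U" "\<And>x. x \<in> U' \<Longrightarrow> partial_deriv i g x \<noteq> 0" "eopen m V"
    "\<And>x. x \<in> U' \<Longrightarrow> x(i := g x) \<in> V" "\<And>x. x \<in> U' \<Longrightarrow> \<Psi> (x(i := g x)) = x"
    "\<And>y. y \<in> V \<Longrightarrow> \<Psi> y \<in> U'" "\<And>y. y \<in> V \<Longrightarrow> (\<Psi> y)(i := g (\<Psi> y)) = y"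
    "\<And>l. l < m \<Longrightarrow> C_infinity_on m V (\<lambda>y. \<Psi> y l)"
    by (rule replace_coordinate[OF U quad_smooth_smooth[OF g] i p nz]) (rule that; assumption)
  have g': "quad_smooth D m U' g" using quad_smooth_subset[OF g *(1,3)] .
  let ?f = "\<lambda>j x. (x(i := g x)) j"
  have qf: "quad_smooth D m U' (?f j)" if "j < m" for j
    using g' quad_smooth_coord[OF *(1) that] by (cases "j = i") auto
  have U'E: "U' \<subseteq> Euclid m" using eopen_subset[OF *(1)] .
  have tup: "tuple m (\<lambda>j. ?f j x) = x(i := g x)" if "x \<in> U'" for x
    using that U'E i by (auto simp: tuple_def fun_eq_iff in_Euclid subset_iff)
  have pd: "partial_deriv l (?f j) x = (if j = i then partial_deriv l g x else if l = j then 1 else 0)" for l j x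
    by (cases "j = i") (auto simp: partial_deriv_coord)
  have "quad D m V (\<lambda>y. \<Psi> y l)" if "l < m" for l
  proof (rule quad.inversion[of m D m U' ?f m V "\<lambda>j y. y j" \<Psi> l])
    show "quad D m U' (?f j)" if "j < m" for j using qf[OF that] by (simp add: quad_smooth_def)
    show "inj_on (\<lambda>x. tuple m (\<lambda>j. ?f j x)) U'"
      by (rule inj_onI) (metis tup *(7))
    show "\<forall>l<m. a l = 0" if x: "x \<in> U'" and a: "\<And>j. j < m \<Longrightarrow> (\<Sum>l<m. a l * partial_deriv l (?f j) x) = 0" for x a
    proof -
      have aj: "a j = 0" if "j < m" "j \<noteq> i" for j
        using a[OF that(1)] that unfolding pd by (simp add: if_distrib sum.delta cong: if_cong)
      have "a i * partial_deriv i g x = 0"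
        using a[OF i] i aj unfolding pd by (subst (asm) sum.remove[of _ i]) auto
      then show ?thesis using aj *(4)[OF x] by auto
    qed
    show "continuous_map (subtopology (Euclidean_space m) V) (Euclidean_space m) \<Psi>"
    proof (rule continuous_map_into_Euclid[OF eopen_subset[OF *(5)]])
      show E: "\<Psi> y \<in> Euclid m" if "y \<in> V" for y using *(8)[OF that] U'E by auto
      show "continuous_on V \<Psi>"
        by (rule continuous_on_Euclid_components[OF E C_infinity_on_continuous[OF *(5,10)]])
    qed
    show "?f j (\<Psi> y) = y j" if "y \<in> V" for y j using *(9)[OF that] by metis
  qed (use * that quad.coord in auto)
  then have "coord_change D m U' V (\<lambda>x. x(i := g x)) \<Psi>"
    unfolding coord_change_def using * qf by (auto simp: quad_smooth_def)
  then show ?thesis using that * by blast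
qed

text \<open>
Members of the family \<open>g\<close> are made coordinates greedily, keeping those coordinates in \<open>S\<close> that are
already fixed. The process stops when every member has, at the point, a differential depending only
on the coordinates in \<open>S'\<close>. So a family with independent differentials is used up entirely, and a
family whose differentials together with those in \<open>S\<close> separate vectors exhausts all coordinates.
\<close>

lemma straighten:
  fixes g :: "'j \<Rightarrow> (nat \<Rightarrow> real) \<Rightarrow> real"
  assumes "eopen m U" "p \<in> U" "S \<subseteq> {..<m}" "\<forall>j\<in>J. quad_smooth D m U (g j)"
  shows "\<exists>U' V \<Phi> \<Psi> S'. coord_change D m U' V \<Phi> \<Psi> \<and> U' \<subseteq> U \<and> p \<in> U' \<and> S \<subseteq> S' \<and> S' \<subseteq> {..<m} \<and>
    (\<forall>i\<in>S. \<forall>x\<in>U'. \<Phi> x i = x i) \<and> (\<forall>i\<in>S' - S. \<exists>j\<in>J. \<forall>x\<in>U'. \<Phi> x i = g j x) \<and>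
    (\<forall>i\<in>{..<m} - S'. \<forall>j\<in>J. partial_deriv i (\<lambda>y. g j (\<Psi> y)) (\<Phi> p) = 0)"
  using assms
proof (induction "card ({..<m} - S)" arbitrary: U p S g rule: less_induct)
  case less
  show ?case
  proof (cases "\<exists>i\<in>{..<m} - S. \<exists>j\<in>J. partial_deriv i (g j) p \<noteq> 0")
    case False
    then show ?thesis
      using less.prems coord_change_id[of m U D]
      by (intro exI[of _ U] exI[of _ "\<lambda>x. x"] exI[of _ S]) auto
  next
    case True
    then obtain i j where ij: "i < m" "i \<notin> S" "j \<in> J" "partial_deriv i (g j) p \<noteq> 0" by auto
    obtain U1 V1 \<Psi>1 where 1: "p \<in> U1" "U1 \<subseteq> U" "coord_change D m U1 V1 (\<lambda>x. x(i := g j x)) \<Psi>1"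
      using coord_change_replace[OF less.prems(1) less.prems(4)[rule_format, OF ij(3)] ij(1) less.prems(2) ij(4)] by metis
    let ?\<Phi>1 = "\<lambda>x. x(i := g j x)"
    note d1 = coord_changeD[OF 1(3)]
    have g1: "\<forall>k\<in>J. quad_smooth D m V1 (\<lambda>y. g k (\<Psi>1 y))"
    proof
      fix k assume "k \<in> J"
      show "quad_smooth D m V1 (\<lambda>y. g k (\<Psi>1 y))"
        by (rule quad_smooth_compose[OF d1(2) less.prems(4)[rule_format, OF \<open>k \<in> J\<close>] _ d1(8)]) (use d1(5) 1(2) in auto)
    qed
    have 3: "card ({..<m} - insert i S) < card ({..<m} - S)"
      using ij by (intro psubset_card_mono) auto
    have 4: "?\<Phi>1 p \<in> V1" "insert i S \<subseteq> {..<m}" using d1(3) 1 ij less.prems by auto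
    from less.hyps[OF 3 d1(2) 4 g1]
    obtain U2 V2 \<Phi>2 \<Psi>2 S' where 2: "coord_change D m U2 V2 \<Phi>2 \<Psi>2" "U2 \<subseteq> V1" "?\<Phi>1 p \<in> U2"
        "insert i S \<subseteq> S'" "S' \<subseteq> {..<m}" "\<forall>k\<in>insert i S. \<forall>x\<in>U2. \<Phi>2 x k = x k"
        "\<forall>k\<in>S' - insert i S. \<exists>l\<in>J. \<forall>x\<in>U2. \<Phi>2 x k = g l (\<Psi>1 x)"
        "\<forall>k\<in>{..<m} - S'. \<forall>l\<in>J. partial_deriv k (\<lambda>y. g l (\<Psi>1 (\<Psi>2 y))) (\<Phi>2 (?\<Phi>1 p)) = 0"
      by (elim exE conjE) (rule that; assumption)
    let ?U = "{x \<in> U1. ?\<Phi>1 x \<in> U2}"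
    have "coord_change D m ?U V2 (\<lambda>x. \<Phi>2 (?\<Phi>1 x)) (\<lambda>y. \<Psi>1 (\<Psi>2 y))"
      by (rule coord_change_compose[OF 1(3) 2(1,2)])
    moreover have "\<exists>l\<in>J. \<forall>x\<in>?U. \<Phi>2 (?\<Phi>1 x) k = g l x" if k: "k \<in> S' - S" for k
    proof (cases "k = i")
      case True
      then show ?thesis using 2(6) ij(3) by (intro bexI[of _ j]) auto
    next
      case False
      then obtain l where l: "l \<in> J" "\<forall>x\<in>U2. \<Phi>2 x k = g l (\<Psi>1 x)" using 2(7) k by auto
      then show ?thesis using d1(4) by (intro bexI[of _ l]) auto
    qed
    moreover have "\<forall>k\<in>S. \<forall>x\<in>?U. \<Phi>2 (?\<Phi>1 x) k = x k" using 2(6) ij(2) by auto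
    ultimately show ?thesis
      using 1 2(3,4,5,8)
      by (intro exI[of _ ?U] exI[of _ V2] exI[of _ "\<lambda>x. \<Phi>2 (?\<Phi>1 x)"] exI[of _ "\<lambda>y. \<Psi>1 (\<Psi>2 y)"] exI[of _ S']) auto
  qed
qed


section \<open>Forms and vector fields in coordinates\<close>

text \<open>
The components of the exterior derivative \<open>d\<eta>\<close>.
\<close>

definition d_form :: "(nat \<Rightarrow> (nat \<Rightarrow> real) \<Rightarrow> real) \<Rightarrow> nat \<Rightarrow> nat \<Rightarrow> (nat \<Rightarrow> real) \<Rightarrow> real" where
  "d_form \<eta> i j x = partial_deriv i (\<eta> j) x - partial_deriv j (\<eta> i) x"

definition pull_back :: "nat \<Rightarrow> ((nat \<Rightarrow> real) \<Rightarrow> nat \<Rightarrow> real) \<Rightarrow> (nat \<Rightarrow> (nat \<Rightarrow> real) \<Rightarrow> real) \<Rightarrow> nat \<Rightarrow> (nat \<Rightarrow> real) \<Rightarrow> real" where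
  "pull_back k G \<eta> i x = (\<Sum>l<k. \<eta> l (G x) * partial_deriv i (\<lambda>x. G x l) x)"

text \<open>
Exterior differentiation commutes with pull-back because the second derivatives of \<open>G\<close> are symmetric
and cancel.
\<close>

lemma d_form_pull_back:
  assumes U: "eopen m U" and V: "eopen k V" and G: "\<And>x. x \<in> U \<Longrightarrow> G x \<in> V"
    "\<And>l. l < k \<Longrightarrow> C_infinity_on m U (\<lambda>x. G x l)"
    and \<eta>: "\<And>l. l < k \<Longrightarrow> C_infinity_on k V (\<eta> l)" and ij: "i < m" "j < m" and x: "x \<in> U"
  shows "d_form (pull_back k G \<eta>) i j x =
    (\<Sum>l<k. \<Sum>r<k. d_form \<eta> l r (G x) * partial_deriv i (\<lambda>x. G x l) x * partial_deriv j (\<lambda>x. G x r) x)"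
proof -
  let ?J = "\<lambda>i l. partial_deriv i (\<lambda>x. G x l)"
  have p: "partial_deriv a (pull_back k G \<eta> b) x =
      (\<Sum>r<k. (\<Sum>l<k. partial_deriv l (\<eta> r) (G x) * ?J a l x) * ?J b r x + \<eta> r (G x) * partial_deriv a (?J b r) x)"
    if ab: "a < m" "b < m" for a b
  proof -
    have c: "C_infinity_on m U (\<lambda>x. \<eta> r (G x))" if "r < k" for r
      by (rule C_infinity_on_compose[OF U V \<eta>[OF that] G])
    have d: "C_infinity_on m U (?J b r)" if "r < k" for r
      by (rule C_infinity_on_partial[OF G(2)[OF that] ab(2)])
    have "partial_deriv a (pull_back k G \<eta> b) x = (\<Sum>r<k. partial_deriv a (\<lambda>x. \<eta> r (G x) * ?J b r x) x)"
      unfolding pull_back_def[abs_def]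
      by (rule partial_deriv_sum[OF C_infinity_on_mult[OF U c d] ab(1) x]) auto
    also have "\<dots> = (\<Sum>r<k. partial_deriv a (\<lambda>x. \<eta> r (G x)) x * ?J b r x + \<eta> r (G x) * partial_deriv a (?J b r) x)"
      by (rule sum.cong[OF refl], rule partial_deriv_mult[OF c d ab(1) x]) auto
    also have "\<dots> = (\<Sum>r<k. (\<Sum>l<k. partial_deriv l (\<eta> r) (G x) * ?J a l x) * ?J b r x + \<eta> r (G x) * partial_deriv a (?J b r) x)"
      using partial_deriv_compose[OF U V \<eta> G x ab(1)] by simp
    finally show ?thesis .
  qed
  have comm: "partial_deriv i (?J j r) x = partial_deriv j (?J i r) x" if "r < k" for r
    by (rule mixed_partials_commute[OF U G(2)[OF that] ij(2,1) x])
  have "d_form (pull_back k G \<eta>) i j x =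
      (\<Sum>r<k. \<Sum>l<k. partial_deriv l (\<eta> r) (G x) * ?J i l x * ?J j r x) -
      (\<Sum>r<k. \<Sum>l<k. partial_deriv l (\<eta> r) (G x) * ?J j l x * ?J i r x)"
    unfolding d_form_def p[OF ij] p[OF ij(2,1)] sum.distrib using comm by (simp add: sum_distrib_right)
  also have "(\<Sum>r<k. \<Sum>l<k. partial_deriv l (\<eta> r) (G x) * ?J i l x * ?J j r x) =
      (\<Sum>l<k. \<Sum>r<k. partial_deriv l (\<eta> r) (G x) * ?J i l x * ?J j r x)"
    by (rule sum.swap)
  also have "\<dots> - (\<Sum>r<k. \<Sum>l<k. partial_deriv l (\<eta> r) (G x) * ?J j l x * ?J i r x) =
      (\<Sum>l<k. \<Sum>r<k. d_form \<eta> l r (G x) * ?J i l x * ?J j r x)"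
    by (simp add: d_form_def algebra_simps flip: sum_subtractf)
  finally show ?thesis .
qed

definition dir_deriv :: "nat \<Rightarrow> (nat \<Rightarrow> (nat \<Rightarrow> real) \<Rightarrow> real) \<Rightarrow> ((nat \<Rightarrow> real) \<Rightarrow> real) \<Rightarrow> (nat \<Rightarrow> real) \<Rightarrow> real" where
  "dir_deriv m X f x = (\<Sum>l<m. X l x * partial_deriv l f x)"

lemma dir_deriv_cong:
  assumes "eopen m U" "\<And>y. y \<in> U \<Longrightarrow> f y = g y" "x \<in> U"
  shows "dir_deriv m X f x = dir_deriv m X g x"
  unfolding dir_deriv_def using partial_deriv_cong[of m U x _ f g] assms by (intro sum.cong) auto

text \<open>
In the coordinates \<open>\<Phi>\<close>, the components of \<open>X\<close> are functions of the coordinates in \<open>S\<close> only, and those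
with index in \<open>S\<close> vanish. Hence all components are constant along integral curves.
\<close>

definition straightens ::
  "nat \<Rightarrow> (nat \<Rightarrow> real) set \<Rightarrow> nat set \<Rightarrow> (nat \<Rightarrow> (nat \<Rightarrow> real) \<Rightarrow> real) \<Rightarrow>
   ((nat \<Rightarrow> real) \<Rightarrow> nat \<Rightarrow> real) \<Rightarrow> bool"
where
  "straightens m U S X \<Phi> \<longleftrightarrow>
     (\<forall>x\<in>U. \<forall>i\<in>S. dir_deriv m X (\<lambda>x. \<Phi> x i) x = 0) \<and>
     (\<forall>x\<in>U. \<forall>x'\<in>U. (\<forall>i\<in>S. \<Phi> x i = \<Phi> x' i) \<longrightarrow>
        (\<forall>i<m. dir_deriv m X (\<lambda>x. \<Phi> x i) x = dir_deriv m X (\<lambda>x. \<Phi> x i) x'))"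

text \<open>
The coordinate version of \<^const>\<open>flow_by_quadratures_at\<close>; \<open>u x t\<close> is the point reached from \<open>x\<close>
at time \<open>t\<close>.
\<close>

definition quad_flow ::
  "(nat \<times> (nat \<Rightarrow> real) set \<times> ((nat \<Rightarrow> real) \<Rightarrow> real)) set \<Rightarrow> nat \<Rightarrow>
   (nat \<Rightarrow> real) set \<Rightarrow> (nat \<Rightarrow> (nat \<Rightarrow> real) \<Rightarrow> real) \<Rightarrow> (nat \<Rightarrow> real) \<Rightarrow> bool"
where
  "quad_flow D m U X p \<longleftrightarrow> (\<exists>e u. 0 < e \<and> ebox m p e \<subseteq> U \<and> p \<in> ebox m p e \<and>
     (\<forall>x\<in>ebox m p e. u x 0 = x \<and> (\<forall>t. \<bar>t\<bar> < e \<longrightarrow> u x t \<in> U \<and>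
        (\<forall>l<m. ((\<lambda>s. u x s l) has_real_derivative X l (u x t)) (at t)))) \<and>
     (\<forall>l<m. quad D (Suc m) {z \<in> Euclid (Suc m). tuple m z \<in> ebox m p e \<and> \<bar>z m\<bar> < e}
        (\<lambda>z. u (tuple m z) (z m) l)))"

lemma tuple_in_Euclid: "tuple m z \<in> Euclid m"
  by (auto simp: tuple_def in_Euclid)

lemma eopen_tuple_preimage:
  assumes "eopen m U"
  shows "eopen (Suc m) {z \<in> Euclid (Suc m). tuple m z \<in> U}"
proof -
  have "continuous_on (Euclid (Suc m)) (tuple m)"
    by (rule continuous_on_Euclid_components[OF tuple_in_Euclid]) (simp add: tuple_def continuous_on_coord)
  from eopen_preimage[OF _ assms this tuple_in_Euclid] show ?thesis by auto
qed

lemma quad_smooth_tuple: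
  assumes f: "quad_smooth D m U f"
  shows "quad_smooth D (Suc m) {z \<in> Euclid (Suc m). tuple m z \<in> U} (\<lambda>z. f (tuple m z))"
proof (rule quad_smooth_compose[OF _ f])
  show o: "eopen (Suc m) {z \<in> Euclid (Suc m). tuple m z \<in> U}"
    by (rule eopen_tuple_preimage[OF quad_smooth_eopen[OF f]])
  show "quad_smooth D (Suc m) {z \<in> Euclid (Suc m). tuple m z \<in> U} (\<lambda>x. tuple m x j)" if "j < m" for j
    using that quad_smooth_coord[OF o] by (simp add: tuple_def)
qed auto

text \<open>
The curve \<open>\<Psi> (\<Phi> x + t c(x))\<close>, where \<open>c\<close> are the components of \<open>X\<close> in the coordinates \<open>\<Phi>\<close>, is an
integral curve: the line keeps the coordinates in \<open>S\<close> fixed, and with them the value of \<open>c\<close>.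
\<close>

lemma quad_flow_of_straightening:
  assumes c: "coord_change D m U V \<Phi> \<Psi>" and p: "p \<in> U"
    and X: "\<And>i. i < m \<Longrightarrow> quad_smooth D m U (X i)" and st: "straightens m U S X \<Phi>" "S \<subseteq> {..<m}"
  shows "quad_flow D m U X p"
proof -
  note d = coord_changeD[OF c]
  define c where "c i = dir_deriv m X (\<lambda>x. \<Phi> x i)" for i
  have qc: "quad_smooth D m U (c i)" if "i < m" for i
    unfolding c_def dir_deriv_def[abs_def]
    by (intro quad_smooth_sum quad_smooth_mult quad_smooth_partial d X that) auto
  \<comment> \<open>The straight line through \<open>\<Phi> x\<close>; indices from \<open>m\<close> on are 0 so that it lies in the model space.\<close>
  define L where "L x t = (\<lambda>i. if i < m then \<Phi> x i + t * c i x else 0)" for x t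
  define u where "u x t = \<Psi> (L x t)" for x t
  have LE: "L x t \<in> Euclid m" for x t by (auto simp: L_def in_Euclid)
  have UE: "U \<subseteq> Euclid m" and VE: "V \<subseteq> Euclid m" using d(1,2) eopen_subset by auto
  let ?A = "{z \<in> Euclid (Suc m). tuple m z \<in> U}"
  have T0: "eopen (Suc m) ?A" by (rule eopen_tuple_preimage[OF d(1)])
  have qL: "quad_smooth D (Suc m) ?A (\<lambda>z. L (tuple m z) (z m) i)" if "i < m" for i
    using that quad_smooth_add[OF quad_smooth_tuple[OF d(7)[OF that]]
        quad_smooth_mult[OF quad_smooth_coord[OF T0, of m] quad_smooth_tuple[OF qc[OF that]]]]
    by (simp add: L_def)
  let ?T = "{z \<in> ?A. L (tuple m z) (z m) \<in> V}"
  have T: "eopen (Suc m) ?T"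
  proof (rule eopen_preimage[where G = "\<lambda>z. L (tuple m z) (z m)" and U = ?A, OF T0 d(2) _ LE])
    show "continuous_on ?A (\<lambda>z. L (tuple m z) (z m))"
      by (rule continuous_on_Euclid_components[OF LE C_infinity_on_continuous[OF T0 quad_smooth_smooth[OF qL]]])
  qed
  have tp: "tuple m x = x" if "x \<in> Euclid m" for x
    using that by (auto simp: tuple_def in_Euclid fun_eq_iff)
  have L0: "L x 0 = \<Phi> x" if "x \<in> U" for x
    using d(3)[OF that] VE by (auto simp: L_def fun_eq_iff in_Euclid subset_iff)
  have pE: "p \<in> Euclid m" using p UE by auto
  then have pm: "p m = 0" "p \<in> Euclid (Suc m)" by (auto simp: in_Euclid)
  \<comment> \<open>A point of the model space is also the pair of itself and time 0, as its entry \<open>m\<close> is 0.\<close>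
  have "p \<in> ?T" using p pm tp[OF pE] L0[OF p] d(3)[OF p] by simp
  then obtain e where e: "e > 0" "ebox (Suc m) p e \<subseteq> ?T"
    using eopen_contains_ebox[OF T] by blast
  have box: "z \<in> ?T" if "z \<in> Euclid (Suc m)" "tuple m z \<in> ebox m p e" "\<bar>z m\<bar> < e" for z
  proof -
    have "z \<in> ebox (Suc m) p e" using that pm by (auto simp: ebox_def tuple_def less_Suc_eq)
    then show ?thesis using e by auto
  qed
  have xt: "x \<in> U" "L x t \<in> V" if "x \<in> ebox m p e" "\<bar>t\<bar> < e" for x t
  proof -
    have xE: "x \<in> Euclid m" using that by (auto simp: ebox_def)
    have "tuple m (x(m := t)) = x" using xE by (auto simp: tuple_def in_Euclid fun_eq_iff)
    then have "x(m := t) \<in> ?T" using that xE by (intro box) (auto simp: in_Euclid)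
    then show "x \<in> U" "L x t \<in> V" using \<open>tuple m (x(m := t)) = x\<close> by auto
  qed
  have der: "((\<lambda>s. u x s l) has_real_derivative X l (u x t)) (at t)"
    if x: "x \<in> ebox m p e" "\<bar>t\<bar> < e" and l: "l < m" for x t l
  proof -
    let ?x = "u x t"
    have x': "?x \<in> U" "\<Phi> ?x = L x t" using d(5,6) xt[OF x] by (auto simp: u_def)
    have "c i ?x = c i x" if "i < m" for i
    proof -
      have "\<Phi> ?x s = \<Phi> x s" if "s \<in> S" for s
        using st that xt(1)[OF x] unfolding x'(2) straightens_def c_def L_def by auto
      then show ?thesis using st(1) x'(1) xt(1)[OF x] \<open>i < m\<close> unfolding straightens_def c_def by blast
    qed
    then have cx: "c i x = (\<Sum>k<m. X k ?x * partial_deriv k (\<lambda>x. \<Phi> x i) ?x)" if "i < m" for i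
      using that by (simp add: c_def dir_deriv_def)
    have "((\<lambda>s. \<Psi> (L x s) l) has_real_derivative (\<Sum>i<m. partial_deriv i (\<lambda>y. \<Psi> y l) (L x t) * c i x)) (at t)"
    proof (rule chain_rule_curve[where \<gamma> = "L x", OF d(2) C_infinity_onD[OF d(10)[OF l]] xt(2)[OF x]])
      show "((\<lambda>s. L x s i) has_real_derivative c i x) (at t)" if "i < m" for i
        using that by (auto simp: L_def intro!: derivative_eq_intros)
    qed (simp add: LE)
    moreover have "(\<Sum>i<m. partial_deriv i (\<lambda>y. \<Psi> y l) (L x t) * c i x) = X l ?x"
    proof -
      have "(\<Sum>i<m. partial_deriv i (\<lambda>y. \<Psi> y l) (L x t) * c i x) =
          (\<Sum>i<m. \<Sum>k<m. partial_deriv i (\<lambda>y. \<Psi> y l) (\<Phi> ?x) * (X k ?x * partial_deriv k (\<lambda>x. \<Phi> x i) ?x))"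
        unfolding x'(2) by (rule sum.cong) (auto simp: cx sum_distrib_left)
      also have "\<dots> = (\<Sum>k<m. X k ?x * (\<Sum>i<m. partial_deriv i (\<lambda>y. \<Psi> y l) (\<Phi> ?x) * partial_deriv k (\<lambda>x. \<Phi> x i) ?x))"
        unfolding sum_distrib_left by (subst sum.swap) (simp add: mult_ac)
      also have "\<dots> = (\<Sum>k<m. X k ?x * (if k = l then 1 else 0))"
        using coord_change_jacobian[OF assms(1) x'(1) l] by simp
      also have "\<dots> = X l ?x" using l by (simp add: if_distrib sum.delta cong: if_cong)
      finally show ?thesis .
    qed
    ultimately show ?thesis by (simp add: u_def)
  qed
  let ?Z = "{z \<in> Euclid (Suc m). tuple m z \<in> ebox m p e \<and> \<bar>z m\<bar> < e}"
  have Z: "eopen (Suc m) ?Z"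
  proof -
    have "?Z = ebox (Suc m) p e" using pm tuple_in_Euclid by (auto simp: ebox_def tuple_def less_Suc_eq in_Euclid)
    then show ?thesis by (simp add: eopen_ebox)
  qed
  have "quad_smooth D (Suc m) ?Z (\<lambda>z. \<Psi> (L (tuple m z) (z m)) l)" if "l < m" for l
  proof (rule quad_smooth_compose[OF Z d(8)[OF that]])
    show "L (tuple m z) (z m) \<in> V" if "z \<in> ?Z" for z using box that by auto
    show "quad_smooth D (Suc m) ?Z (\<lambda>z. L (tuple m z) (z m) j)" if "j < m" for j
      by (rule quad_smooth_subset[OF qL[OF that] Z]) (use box in auto)
  qed
  then have q: "quad D (Suc m) ?Z (\<lambda>z. u (tuple m z) (z m) l)" if "l < m" for l
    using that by (simp add: quad_smooth_def u_def)
  have pB: "p \<in> ebox m p e" using pE e(1) by (auto simp: ebox_def)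
  have u0: "u x 0 = x" if "x \<in> ebox m p e" for x
    using L0 d(4) xt[OF that, of 0] e(1) by (simp add: u_def)
  have uU: "u x t \<in> U" if "x \<in> ebox m p e" "\<bar>t\<bar> < e" for x t
    using d(5) xt[OF that] by (simp add: u_def)
  have "ebox m p e \<subseteq> U" using xt(1)[of _ 0] e(1) by auto
  then show ?thesis
    unfolding quad_flow_def
    by (intro exI[of _ e] exI[of _ u] conjI ballI allI impI e(1) pB u0 uU der q)
qed

lemma quad_flow_superset:
  assumes "quad_flow D m U X p" "U \<subseteq> U'"
  shows "quad_flow D m U' X p"
proof -
  obtain e u where *: "0 < e" "ebox m p e \<subseteq> U" "p \<in> ebox m p e"
    "\<forall>x\<in>ebox m p e. u x 0 = x \<and> (\<forall>t. \<bar>t\<bar> < e \<longrightarrow> u x t \<in> U \<and>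
        (\<forall>l<m. ((\<lambda>s. u x s l) has_real_derivative X l (u x t)) (at t)))"
    "\<forall>l<m. quad D (Suc m) {z \<in> Euclid (Suc m). tuple m z \<in> ebox m p e \<and> \<bar>z m\<bar> < e}
        (\<lambda>z. u (tuple m z) (z m) l)"
    using assms(1) unfolding quad_flow_def by (elim exE conjE) (rule that; assumption)
  have "\<forall>x\<in>ebox m p e. u x 0 = x \<and> (\<forall>t. \<bar>t\<bar> < e \<longrightarrow> u x t \<in> U' \<and>
        (\<forall>l<m. ((\<lambda>s. u x s l) has_real_derivative X l (u x t)) (at t)))"
    using *(4) assms(2) by blast
  then show ?thesis
    unfolding quad_flow_def
    by (intro exI[of _ e] exI[of _ u] conjI *(1,3,5) subset_trans[OF *(2) assms(2)])
qed

text \<open>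
The rule \<open>integral\<close> integrates over one coordinate. So the contraction parameter \<open>s\<close> is added as a
coordinate with index \<open>m\<close>: by the chain rule \<open>W (radial S q s x)\<close> is a primitive with respect to
\<open>s\<close>, vanishing at \<open>s = 0\<close>, of a known function, and \<open>s = 1\<close> gives \<open>W\<close> itself.
\<close>

lemma quad_smooth_fibre_primitive:
  assumes q: "q \<in> Euclid m" and B: "B = ebox m q e"
    and b: "\<And>i. i \<in> {..<m} - S \<Longrightarrow> quad_smooth D m B (b i)"
    and closed: "\<And>i j x. i \<in> {..<m} - S \<Longrightarrow> j \<in> {..<m} - S \<Longrightarrow> x \<in> B \<Longrightarrow> partial_deriv i (b j) x = partial_deriv j (b i) x"
  shows "quad_smooth D m B (fibre_primitive m S q b)"
proof -
  let ?W = "fibre_primitive m S q b"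
  have Bo: "eopen m B" unfolding B by (rule eopen_ebox)
  have BE: "B \<subseteq> Euclid m" by (rule eopen_subset[OF Bo])
  have st: "radial S q s x \<in> B" if "x \<in> B" "0 \<le> s" "s \<le> 1" for x s
    using radial_in_ebox[OF q] that unfolding B by blast
  have W: "C_infinity_on m B ?W"
    by (rule C_infinity_on_fibre_primitive[OF Bo quad_smooth_smooth[OF b] st])
  have dW: "partial_deriv j ?W x = b j x" if "j \<in> {..<m} - S" "x \<in> B" for j x
    by (rule partial_deriv_fibre_primitive[OF Bo q quad_smooth_smooth[OF b] st closed that])
  let ?A = "{z \<in> Euclid (Suc m). tuple m z \<in> B}"
  let ?R = "\<lambda>z. radial S q (z m) (tuple m z)"
  let ?T = "{z \<in> ?A. ?R z \<in> B}"
  have T0: "eopen (Suc m) ?A" by (rule eopen_tuple_preimage[OF Bo])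
  have RE: "?R z \<in> Euclid m" for z by (rule radial_in_Euclid[OF tuple_in_Euclid q])
  have qR: "quad_smooth D (Suc m) ?A (\<lambda>z. ?R z i)" if "i < m" for i
    using that by (cases "i \<in> S") (auto simp: radial_def tuple_def
        intro!: quad_smooth_add quad_smooth_mult quad_smooth_diff quad_smooth_const quad_smooth_coord T0[unfolded tuple_def])
  have T: "eopen (Suc m) ?T"
    by (rule eopen_preimage[where G = ?R and U = ?A, OF T0 Bo
          continuous_on_Euclid_components[OF RE C_infinity_on_continuous[OF T0 quad_smooth_smooth[OF qR]]] RE])
  let ?\<phi> = "\<lambda>z. \<Sum>i\<in>{..<m} - S. b i (?R z) * (z i - q i)"
  have "quad_smooth D (Suc m) ?T (\<lambda>z. b i (?R z))" if "i \<in> {..<m} - S" for i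
    by (rule quad_smooth_compose[OF T b[OF that] _ quad_smooth_subset[OF qR T]]) auto
  then have \<phi>: "quad_smooth D (Suc m) ?T ?\<phi>"
    by (intro quad_smooth_sum quad_smooth_mult quad_smooth_diff quad_smooth_const quad_smooth_coord T) auto
  have F: "quad D (Suc m) ?T (\<lambda>z. ?W (?R z))"
  proof (rule quad.integral[OF quad_smooth_quad[OF \<phi>], where i = m and c = 0])
    fix z t assume z: "z \<in> ?T" and t: "t \<in> closed_segment 0 (z m)"
    have tz: "tuple m (z(m := t)) = tuple m z" by (auto simp: tuple_def)
    obtain v where v: "0 \<le> v" "v \<le> 1" "t = v * z m"
      using t by (auto simp: in_segment)
    have "radial S q t (tuple m z) = radial S q v (?R z)"
      unfolding v(3) by (auto simp: radial_def fun_eq_iff)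
    then have "radial S q t (tuple m z) \<in> B" using st[OF _ v(1,2)] z by auto
    then show "z(m := t) \<in> ?T" using z tz by (auto simp: in_Euclid)
  next
    fix z assume z: "z \<in> ?T"
    have tz: "tuple m (z(m := t)) = tuple m z" for t by (auto simp: tuple_def)
    have "((\<lambda>s. ?W (radial S q s (tuple m z))) has_real_derivative
        (\<Sum>i\<in>{..<m} - S. partial_deriv i ?W (?R z) * (tuple m z i - q i))) (at (z m))"
      by (rule has_derivative_along_radial[OF Bo W q tuple_in_Euclid]) (use z in auto)
    moreover have "(\<Sum>i\<in>{..<m} - S. partial_deriv i ?W (?R z) * (tuple m z i - q i)) = ?\<phi> z"
      by (rule sum.cong) (use z dW in \<open>auto simp: tuple_def\<close>)
    ultimately show "((\<lambda>t. ?W (radial S q ((z(m := t)) m) (tuple m (z(m := t))))) has_real_derivative ?\<phi> z) (at (z m))"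
      by (simp add: tz)
  next
    fix z :: "nat \<Rightarrow> real" assume "z m = 0"
    then show "?W (?R z) = 0" by (auto simp: fibre_primitive_def radial_def)
  qed simp
  have "C_infinity_on (Suc m) ?T (\<lambda>z. ?W (?R z))"
    by (rule C_infinity_on_compose[OF T Bo W _ quad_smooth_smooth[OF quad_smooth_subset[OF qR T]]]) auto
  then have FS: "quad_smooth D (Suc m) ?T (\<lambda>z. ?W (?R z))"
    unfolding quad_smooth_def using T F by blast
  have t1: "tuple m (x(m := 1)) = x" if "x \<in> B" for x
    using that BE by (auto simp: tuple_def fun_eq_iff in_Euclid subset_iff)
  have "quad_smooth D m B (\<lambda>x. ?W (?R (x(m := 1))))"
  proof (rule quad_smooth_compose[OF Bo FS])
    show "x(m := 1) \<in> ?T" if "x \<in> B" for x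
      using that BE t1[OF that] by (auto simp: radial_1 in_Euclid subset_iff)
    show "quad_smooth D m B (\<lambda>x. (x(m := 1)) j)" if "j < Suc m" for j
      using that by (cases "j = m") (auto intro: quad_smooth_const quad_smooth_coord Bo)
  qed
  then show ?thesis by (rule quad_smooth_cong) (simp add: t1 radial_1)
qed

text \<open>
Both points can be moved inside the cube to the same point of their common fibre, along which
\<open>g\<close> does not change.
\<close>

lemma fibre_constant:
  assumes q: "q \<in> Euclid m" and B: "B = ebox m q e" and g: "C_infinity_on m B g"
    and z: "\<And>j x. j \<in> {..<m} - S \<Longrightarrow> x \<in> B \<Longrightarrow> partial_deriv j g x = 0"
    and x: "x \<in> B" "x' \<in> B" "\<And>s. s \<in> S \<Longrightarrow> x s = x' s"
  shows "g x = g x'"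
proof -
  have Bo: "eopen m B" unfolding B by (rule eopen_ebox)
  have "g y = g (radial S q 0 y)" if y: "y \<in> B" for y
  proof -
    have yE: "y \<in> Euclid m" using y eopen_subset[OF Bo] by auto
    have D0: "((\<lambda>s. g (radial S q s y)) has_real_derivative 0) (at s)" if "0 \<le> s" "s \<le> 1" for s
    proof -
      have r: "radial S q s y \<in> B" using radial_in_ebox[OF q, of y e s] y that unfolding B by auto
      have "(\<Sum>i\<in>{..<m} - S. partial_deriv i g (radial S q s y) * (y i - q i)) = 0"
        using z r by (intro sum.neutral) auto
      then show ?thesis using has_derivative_along_radial[OF Bo g q yE r] by simp
    qed
    have "g (radial S q 1 y) = g (radial S q 0 y)"
    proof (intro DERIV_isconst_end[of 0 1 "\<lambda>s. g (radial S q s y)"])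
      show "continuous_on {0..1} (\<lambda>s. g (radial S q s y))"
        by (rule DERIV_continuous_on[where D = "\<lambda>_. 0"], rule has_field_derivative_at_within)
          (use D0 in auto)
    qed (use D0 in auto)
    then show ?thesis by (simp add: radial_1)
  qed
  moreover have "radial S q 0 x = radial S q 0 x'"
    using x(3) by (auto simp: radial_def fun_eq_iff)
  ultimately show ?thesis using x by metis
qed


section \<open>Isotropic first integrals in Euclidean space\<close>

definition hamiltonian :: "nat \<Rightarrow> (nat \<Rightarrow> (nat \<Rightarrow> real) \<Rightarrow> real) \<Rightarrow> (nat \<Rightarrow> (nat \<Rightarrow> real) \<Rightarrow> real) \<Rightarrow> (nat \<Rightarrow> real) \<Rightarrow> real" where
  "hamiltonian m \<eta> X x = (\<Sum>i<m. \<eta> i x * X i x)"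

lemma C_infinity_on_hamiltonian:
  "eopen m U \<Longrightarrow> (\<And>i. i < m \<Longrightarrow> C_infinity_on m U (X i)) \<Longrightarrow> (\<And>i. i < m \<Longrightarrow> C_infinity_on m U (\<eta> i)) \<Longrightarrow>
    C_infinity_on m U (hamiltonian m \<eta> X)"
  unfolding hamiltonian_def[abs_def] by (intro C_infinity_on_sum C_infinity_on_mult) auto

text \<open>
The core of the argument, in coordinates in which the fibres are given by constant \<open>x\<^sub>i\<close>, \<open>i \<in> S\<close>.
The family that completes these to a straightening consists of the fibrewise primitive \<open>W\<close> (index
\<open>None\<close>) and the coefficients \<open>\<theta>\<^sub>j\<close> of \<open>\<eta> - dW\<close> (index \<open>Some j\<close>).
\<close>

lemma straightening_in_adapted_coordinates:
  assumes U: "eopen m U" and q: "q \<in> U" and S: "S \<subseteq> {..<m}"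
    and X: "\<And>i. i < m \<Longrightarrow> quad_smooth D m U (X i)"
    and \<eta>: "\<And>i. i < m \<Longrightarrow> quad_smooth D m U (\<eta> i)"
    and tangent: "\<And>i x. i \<in> S \<Longrightarrow> x \<in> U \<Longrightarrow> X i x = 0"
    and isotropic: "\<And>i j x. i \<in> {..<m} - S \<Longrightarrow> j \<in> {..<m} - S \<Longrightarrow> x \<in> U \<Longrightarrow> d_form \<eta> i j x = 0"
    and contact: "\<And>j x. j < m \<Longrightarrow> x \<in> U \<Longrightarrow>
      (\<Sum>i<m. X i x * d_form \<eta> i j x) = - partial_deriv j (hamiltonian m \<eta> X) x"
    and nondegenerate: "\<And>v. (\<Sum>i<m. v i * \<eta> i q) = 0 \<Longrightarrow> (\<And>j. j < m \<Longrightarrow> (\<Sum>i<m. v i * d_form \<eta> i j q) = 0) \<Longrightarrow>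
      (\<And>i. i < m \<Longrightarrow> v i = 0)"
  obtains U' V \<Phi> \<Psi> where "coord_change D m U' V \<Phi> \<Psi>" "U' \<subseteq> U" "q \<in> U'" "straightens m U' S X \<Phi>"
proof -
  let ?H = "hamiltonian m \<eta> X"
  have qE: "q \<in> Euclid m" using q eopen_subset[OF U] by auto
  obtain e where e: "e > 0" "ebox m q e \<subseteq> U" "q \<in> ebox m q e"
    using U q by (rule eopen_contains_ebox)
  define B where "B = ebox m q e"
  have BU: "B \<subseteq> U" and qB: "q \<in> B" and Bo: "eopen m B" using e eopen_ebox by (auto simp: B_def)
  have \<eta>B: "quad_smooth D m B (\<eta> i)" if "i < m" for i using quad_smooth_subset[OF \<eta>[OF that] Bo BU] .
  have HU: "C_infinity_on m U ?H"
    by (rule C_infinity_on_hamiltonian[OF U quad_smooth_smooth[OF X] quad_smooth_smooth[OF \<eta>]])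
  have HB: "C_infinity_on m B ?H" by (rule C_infinity_on_subset[OF HU Bo BU U])

  define W where "W = fibre_primitive m S q \<eta>"
  have closed: "partial_deriv i (\<eta> j) x = partial_deriv j (\<eta> i) x"
    if "i \<in> {..<m} - S" "j \<in> {..<m} - S" "x \<in> B" for i j x
    using isotropic[OF that(1,2), of x] that(3) BU by (auto simp: d_form_def)
  have W: "quad_smooth D m B W"
    unfolding W_def by (rule quad_smooth_fibre_primitive[OF qE B_def \<eta>B closed]) auto
  have dW: "partial_deriv j W x = \<eta> j x" if "j \<in> {..<m} - S" "x \<in> B" for j x
    unfolding W_def
    by (rule partial_deriv_fibre_primitive[OF Bo qE quad_smooth_smooth[OF \<eta>B] _ closed that])
      (use radial_in_ebox[OF qE, folded B_def] in \<open>auto simp: B_def\<close>)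
  define \<theta> where "\<theta> j = (\<lambda>x. \<eta> j x - partial_deriv j W x)" for j
  have \<theta>: "quad_smooth D m B (\<theta> j)" if "j < m" for j
    unfolding \<theta>_def by (rule quad_smooth_diff[OF \<eta>B[OF that] quad_smooth_partial[OF W that]])
  \<comment> \<open>Along the fibres \<open>\<partial>\<^sub>l W = \<eta>\<^sub>l\<close>, and the second derivatives of \<open>W\<close> commute.\<close>
  have d\<theta>: "partial_deriv l (\<theta> j) x = d_form \<eta> l j x" if l: "l \<in> {..<m} - S" and j: "j < m" and x: "x \<in> B" for l j x
  proof -
    have lm: "l < m" using l by auto
    have "partial_deriv l (\<theta> j) x = partial_deriv l (\<eta> j) x - partial_deriv l (partial_deriv j W) x"
      unfolding \<theta>_def
      by (rule partial_deriv_diff[OF quad_smooth_smooth[OF \<eta>B[OF j]] quad_smooth_smooth[OF quad_smooth_partial[OF W j]] lm x])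
    also have "partial_deriv l (partial_deriv j W) x = partial_deriv j (partial_deriv l W) x"
      by (rule mixed_partials_commute[OF Bo quad_smooth_smooth[OF W] j lm x])
    also have "\<dots> = partial_deriv j (\<eta> l) x"
      by (rule partial_deriv_cong[OF Bo x j]) (rule dW[OF l])
    finally show ?thesis by (simp add: d_form_def)
  qed

  define g where "g a = (case a of None \<Rightarrow> W | Some j \<Rightarrow> \<theta> j)" for a
  have g: "\<forall>a\<in>insert None (Some ` S). quad_smooth D m B (g a)"
    using W \<theta> S by (auto simp: g_def)
  from straighten[OF Bo qB S g]
  obtain U' V \<Phi> \<Psi> S' where c: "coord_change D m U' V \<Phi> \<Psi>" and U'B: "U' \<subseteq> B" and qU': "q \<in> U'" and SS': "S \<subseteq> S'" "S' \<subseteq> {..<m}"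
    and \<Phi>S: "\<forall>i\<in>S. \<forall>x\<in>U'. \<Phi> x i = x i"
    and \<Phi>S': "\<forall>i\<in>S' - S. \<exists>a\<in>insert None (Some ` S). \<forall>x\<in>U'. \<Phi> x i = g a x"
    and zero: "\<forall>i\<in>{..<m} - S'. \<forall>a\<in>insert None (Some ` S). partial_deriv i (\<lambda>y. g a (\<Psi> y)) (\<Phi> q) = 0"
    by (elim exE conjE) (rule that; assumption)
  note d = coord_changeD[OF c]
  have \<Phi>qV: "\<Phi> q \<in> V" "\<Psi> (\<Phi> q) = q" using d qU' by auto
  have \<Psi>B: "\<Psi> y \<in> B" if "y \<in> V" for y using d(5)[OF that] U'B by auto

  \<comment> \<open>A left-over coordinate direction \<open>w\<close> would be annihilated by \<open>dx\<^sub>s\<close>, \<open>dW\<close> and \<open>d\<theta>\<^sub>j\<close>.\<close>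
  have "S' = {..<m}"
  proof (rule ccontr)
    assume "S' \<noteq> {..<m}"
    then obtain i where i: "i < m" "i \<notin> S'" using SS'(2) by auto
    define w where "w l = partial_deriv i (\<lambda>y. \<Psi> y l) (\<Phi> q)" for l
    have chain: "(\<Sum>l<m. partial_deriv l h q * w l) = partial_deriv i (\<lambda>y. h (\<Psi> y)) (\<Phi> q)"
      if "quad_smooth D m B h" for h
      using partial_deriv_compose[OF d(2) Bo quad_smooth_smooth[OF that] \<Psi>B d(10) \<Phi>qV(1) i(1)]
      by (simp add: w_def \<Phi>qV(2))
    have wS: "w s = 0" if s: "s \<in> S" for s
    proof -
      have "partial_deriv i (\<lambda>y. \<Psi> y s) (\<Phi> q) = partial_deriv i (\<lambda>y. y s) (\<Phi> q)"
        by (rule partial_deriv_cong[OF d(2) \<Phi>qV(1) i(1)]) (use \<Phi>S s d(5,6) in metis)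
      then show ?thesis using i s SS' by (auto simp: w_def partial_deriv_coord)
    qed
    have "(\<Sum>l<m. w l * \<eta> l q) = (\<Sum>l<m. partial_deriv l W q * w l)"
      by (rule sum.cong) (use wS dW qB in \<open>force simp: mult.commute\<close>)+
    also have "\<dots> = 0" using chain[OF W] zero i by (auto simp: g_def)
    finally have w\<eta>: "(\<Sum>l<m. w l * \<eta> l q) = 0" .
    have wd: "(\<Sum>l<m. w l * d_form \<eta> l j q) = 0" if j: "j < m" for j
    proof (cases "j \<in> S")
      case True
      have "(\<Sum>l<m. w l * d_form \<eta> l j q) = (\<Sum>l<m. partial_deriv l (\<theta> j) q * w l)"
        by (rule sum.cong) (use wS d\<theta> qB j in \<open>force simp: mult.commute\<close>)+
      also have "\<dots> = 0" using chain[OF \<theta>[OF j]] zero i True by (auto simp: g_def)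
      finally show ?thesis .
    next
      case False
      then show ?thesis using wS isotropic[of _ j q] j q by (intro sum.neutral) auto
    qed
    have w0: "w l = 0" if "l < m" for l by (rule nondegenerate[OF w\<eta> wd that])
    have "(\<Sum>k<m. partial_deriv k (\<lambda>x. \<Phi> x i) (\<Psi> (\<Phi> q)) * partial_deriv i (\<lambda>y. \<Psi> y k) (\<Phi> q)) = 1"
      using coord_change_jacobian[OF coord_change_sym[OF c] \<Phi>qV(1) i(1,1)] by simp
    then show False using w0 by (simp add: w_def)
  qed

  \<comment> \<open>\<open>X\<close> is tangent to the fibres, which are isotropic, so \<open>dH = - d\<eta>(X, \<cdot>)\<close> vanishes on them.\<close>
  have HdS: "partial_deriv j ?H x = 0" if j: "j \<in> {..<m} - S" and x: "x \<in> B" for j x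
  proof -
    have xU: "x \<in> U" using x BU by auto
    have "X i x * d_form \<eta> i j x = 0" if "i < m" for i
      by (cases "i \<in> S") (use tangent[OF _ xU] isotropic[OF _ j xU] that in auto)
    then have "(\<Sum>i<m. X i x * d_form \<eta> i j x) = 0" by (intro sum.neutral) auto
    then show ?thesis using contact[of j x] j x BU by auto
  qed
  have Hconst: "?H x = ?H x'" "k < m \<Longrightarrow> partial_deriv k ?H x = partial_deriv k ?H x'"
    if "x \<in> B" "x' \<in> B" "\<And>s. s \<in> S \<Longrightarrow> x s = x' s" for x x' k
  proof -
    show "?H x = ?H x'" by (rule fibre_constant[OF qE B_def HB HdS that])
    assume k: "k < m"
    show "partial_deriv k ?H x = partial_deriv k ?H x'"
    proof (rule fibre_constant[OF qE B_def C_infinity_on_partial[OF HB k] _ that])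
      fix j x assume j: "j \<in> {..<m} - S" and x: "x \<in> B"
      then have jm: "j < m" by auto
      have "partial_deriv j (partial_deriv k ?H) x = partial_deriv k (partial_deriv j ?H) x"
        by (rule mixed_partials_commute[OF Bo HB k jm x])
      also have "\<dots> = partial_deriv k (\<lambda>x. 0) x"
        by (rule partial_deriv_cong[OF Bo x k]) (rule HdS[OF j])
      finally show "partial_deriv j (partial_deriv k ?H) x = 0" by (simp add: partial_deriv_const)
    qed
  qed
  have XS: "dir_deriv m X (\<lambda>x. \<Phi> x i) x = 0" if "i \<in> S" "x \<in> U'" for i x
  proof -
    have "dir_deriv m X (\<lambda>x. \<Phi> x i) x = dir_deriv m X (\<lambda>x. x i) x"
      by (rule dir_deriv_cong[OF d(1) _ that(2)]) (use \<Phi>S that in auto)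
    also have "\<dots> = X i x"
      using that S by (auto simp: dir_deriv_def partial_deriv_coord if_distrib sum.delta cong: if_cong)
    also have "\<dots> = 0" using tangent that U'B BU by auto
    finally show ?thesis .
  qed
  have XW: "dir_deriv m X W x = ?H x" if "x \<in> B" for x
    unfolding dir_deriv_def hamiltonian_def
    by (rule sum.cong) (use tangent dW that BU in \<open>force simp: mult.commute\<close>)+
  have X\<theta>: "dir_deriv m X (\<theta> j) x = - partial_deriv j ?H x" if "j < m" "x \<in> B" for j x
  proof -
    have "dir_deriv m X (\<theta> j) x = (\<Sum>i<m. X i x * d_form \<eta> i j x)"
      unfolding dir_deriv_def by (rule sum.cong) (use tangent d\<theta> that BU in force)+
    then show ?thesis using contact that BU by auto
  qed
  have "dir_deriv m X (\<lambda>x. \<Phi> x i) x = dir_deriv m X (\<lambda>x. \<Phi> x i) x'"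
    if xx: "x \<in> U'" "x' \<in> U'" "\<forall>s\<in>S. \<Phi> x s = \<Phi> x' s" and i: "i < m" for x x' i
  proof (cases "i \<in> S")
    case True
    then show ?thesis using XS xx by simp
  next
    case False
    then obtain a where a: "a \<in> insert None (Some ` S)" "\<And>x. x \<in> U' \<Longrightarrow> \<Phi> x i = g a x"
      using \<Phi>S' i \<open>S' = {..<m}\<close> by (metis DiffI lessThan_iff)
    have *: "dir_deriv m X (\<lambda>x. \<Phi> x i) z = dir_deriv m X (g a) z" if "z \<in> U'" for z
      by (rule dir_deriv_cong[OF d(1) a(2) that])
    have xB: "x \<in> B" "x' \<in> B" "\<And>s. s \<in> S \<Longrightarrow> x s = x' s"
      using xx U'B \<Phi>S by auto
    show ?thesis
    proof (cases a)
      case None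
      then show ?thesis using *[OF xx(1)] *[OF xx(2)] XW Hconst(1)[OF xB] xB by (simp add: g_def)
    next
      case (Some j)
      then have "j < m" using a(1) S by auto
      then show ?thesis using *[OF xx(1)] *[OF xx(2)] X\<theta> Hconst(2)[OF xB] xB Some by (simp add: g_def)
    qed
  qed
  then have "straightens m U' S X \<Phi>" using XS unfolding straightens_def by blast
  then show ?thesis using that[OF c _ qU'] U'B BU by blast
qed

text \<open>
Straightening the family \<open>f\<close> reduces to coordinates adapted to the fibres. All hypotheses are
tensorial and are transported by the Jacobian matrices \<open>J\<close> of \<open>\<Phi>\<close> and \<open>K\<close> of \<open>\<Psi>\<close>, which are
inverse to each other.
\<close>

theorem quad_flow_of_isotropic_integrals:
  assumes U: "eopen m U" and p: "p \<in> U"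
    and X: "\<And>i. i < m \<Longrightarrow> quad_smooth D m U (X i)"
    and \<eta>: "\<And>i. i < m \<Longrightarrow> quad_smooth D m U (\<eta> i)"
    and f: "\<And>j. j < k \<Longrightarrow> quad_smooth D m U (f j)"
    and submersion: "\<And>j. j < k \<Longrightarrow> \<exists>v. \<forall>l<k. (\<Sum>i<m. v i * partial_deriv i (f l) p) = (if l = j then 1 else 0)"
    and tangent: "\<And>j x. j < k \<Longrightarrow> x \<in> U \<Longrightarrow> dir_deriv m X (f j) x = 0"
    and isotropic: "\<And>v w x. x \<in> U \<Longrightarrow> (\<And>j. j < k \<Longrightarrow> (\<Sum>i<m. v i * partial_deriv i (f j) x) = 0) \<Longrightarrow>
      (\<And>j. j < k \<Longrightarrow> (\<Sum>i<m. w i * partial_deriv i (f j) x) = 0) \<Longrightarrow>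
      (\<Sum>i<m. \<Sum>j<m. d_form \<eta> i j x * v i * w j) = 0"
    and contact: "\<And>j x. j < m \<Longrightarrow> x \<in> U \<Longrightarrow>
      (\<Sum>i<m. X i x * d_form \<eta> i j x) = - partial_deriv j (hamiltonian m \<eta> X) x"
    and nondegenerate: "\<And>v. (\<Sum>i<m. v i * \<eta> i p) = 0 \<Longrightarrow> (\<And>j. j < m \<Longrightarrow> (\<Sum>i<m. v i * d_form \<eta> i j p) = 0) \<Longrightarrow>
      (\<And>i. i < m \<Longrightarrow> v i = 0)"
  shows "quad_flow D m U X p"
proof -
  have fJ: "\<forall>j\<in>{..<k}. quad_smooth D m U (f j)" using f by auto
  from straighten[OF U p empty_subsetI fJ]
  obtain U1 V1 \<Phi> \<Psi> S where c: "coord_change D m U1 V1 \<Phi> \<Psi>" and U1U: "U1 \<subseteq> U" and pU1: "p \<in> U1" and S: "S \<subseteq> {..<m}"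
    and \<Phi>S: "\<forall>i\<in>S - {}. \<exists>j\<in>{..<k}. \<forall>x\<in>U1. \<Phi> x i = f j x"
    and zero: "\<forall>i\<in>{..<m} - S. \<forall>j\<in>{..<k}. partial_deriv i (\<lambda>y. f j (\<Psi> y)) (\<Phi> p) = 0"
    by (elim exE conjE) (rule that; assumption)
  note d = coord_changeD[OF c]
  have \<Psi>U: "\<Psi> y \<in> U" if "y \<in> V1" for y using d(5)[OF that] U1U by auto
  have \<Phi>pV: "\<Phi> p \<in> V1" "\<Psi> (\<Phi> p) = p" using d pU1 by auto
  let ?J = "\<lambda>i l. partial_deriv i (\<lambda>x. \<Phi> x l)" and ?K = "\<lambda>i l. partial_deriv i (\<lambda>y. \<Psi> y l)"
  have KJ: "(\<Sum>i<m. ?K i l y * ?J r i (\<Psi> y)) = (if r = l then 1 else 0)" if "y \<in> V1" "l < m" "r < m" for y l r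
    using coord_change_jacobian[OF c d(5)[OF that(1)] that(2,3)] d(6)[OF that(1)] by simp
  have JK: "(\<Sum>i<m. ?J i l (\<Psi> y) * ?K r i y) = (if r = l then 1 else 0)" if "y \<in> V1" "l < m" "r < m" for y l r
    using coord_change_jacobian[OF coord_change_sym[OF c] that] by simp

  \<comment> \<open>Every \<open>f j\<close> has become a coordinate: otherwise its differential would depend on those that have.\<close>
  have fS: "\<exists>i\<in>S. \<forall>x\<in>U1. \<Phi> x i = f j x" if j: "j < k" for j
  proof -
    obtain v where v: "\<And>l. l < k \<Longrightarrow> (\<Sum>i<m. v i * partial_deriv i (f l) p) = (if l = j then 1 else 0)"
      using submersion[OF j] by blast
    define v' where "v' i = (\<Sum>l<m. v l * ?J l i p)" for i
    have fq: "quad_smooth D m V1 (\<lambda>y. f j (\<Psi> y))"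
      by (rule quad_smooth_compose[OF d(2) f[OF j] \<Psi>U d(8)])
    have pf: "partial_deriv l (f j) p = (\<Sum>i<m. partial_deriv i (\<lambda>y. f j (\<Psi> y)) (\<Phi> p) * ?J l i p)" if "l < m" for l
    proof -
      have "partial_deriv l (f j) p = partial_deriv l (\<lambda>x. f j (\<Psi> (\<Phi> x))) p"
        by (rule partial_deriv_cong[OF d(1) pU1 that]) (use d(4) in auto)
      also have "\<dots> = (\<Sum>i<m. partial_deriv i (\<lambda>y. f j (\<Psi> y)) (\<Phi> p) * ?J l i p)"
        by (rule partial_deriv_compose[OF d(1,2) quad_smooth_smooth[OF fq] d(3) d(9) pU1 that])
      finally show ?thesis .
    qed
    have "1 = (\<Sum>l<m. v l * partial_deriv l (f j) p)" using v[OF j] by simp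
    also have "\<dots> = (\<Sum>l<m. \<Sum>i<m. v l * (partial_deriv i (\<lambda>y. f j (\<Psi> y)) (\<Phi> p) * ?J l i p))"
      by (rule sum.cong) (auto simp: pf sum_distrib_left)
    also have "\<dots> = (\<Sum>i<m. partial_deriv i (\<lambda>y. f j (\<Psi> y)) (\<Phi> p) * v' i)"
      unfolding v'_def sum_distrib_left by (subst sum.swap) (simp add: mult_ac)
    finally have "\<exists>i<m. partial_deriv i (\<lambda>y. f j (\<Psi> y)) (\<Phi> p) * v' i \<noteq> 0"
      by (metis (no_types, lifting) lessThan_iff sum.neutral zero_neq_one)
    then obtain i where i: "i < m" "partial_deriv i (\<lambda>y. f j (\<Psi> y)) (\<Phi> p) \<noteq> 0" "v' i \<noteq> 0" by auto
    have iS: "i \<in> S" using zero i j by auto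
    then obtain l where l: "l < k" "\<forall>x\<in>U1. \<Phi> x i = f l x" using \<Phi>S by auto
    have "v' i = (\<Sum>r<m. v r * partial_deriv r (f l) p)"
      unfolding v'_def
      by (rule sum.cong[OF refl]) (use partial_deriv_cong[OF d(1) pU1, of _ "\<lambda>x. \<Phi> x i" "f l"] l(2) in auto)
    then have "l = j" using v[OF l(1)] i(3) by (auto split: if_splits)
    then show ?thesis using iS l by blast
  qed

  define X' where "X' i y = dir_deriv m X (\<lambda>x. \<Phi> x i) (\<Psi> y)" for i y
  define \<eta>' where "\<eta>' = pull_back m \<Psi> \<eta>"
  have qX': "quad_smooth D m V1 (X' i)" if "i < m" for i
    unfolding X'_def
  proof (rule quad_smooth_compose[OF d(2) _ d(5) d(8)])
    show "quad_smooth D m U1 (dir_deriv m X (\<lambda>x. \<Phi> x i))"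
      unfolding dir_deriv_def[abs_def]
      by (intro quad_smooth_sum quad_smooth_mult quad_smooth_partial d quad_smooth_subset[OF X] U1U that) auto
  qed
  have q\<eta>': "quad_smooth D m V1 (\<eta>' i)" if "i < m" for i
    unfolding \<eta>'_def pull_back_def[abs_def]
    by (intro quad_smooth_sum quad_smooth_mult quad_smooth_partial quad_smooth_compose[OF d(2) \<eta>] d \<Psi>U that) auto
  have d\<eta>': "d_form \<eta>' i j y = (\<Sum>l<m. \<Sum>r<m. d_form \<eta> l r (\<Psi> y) * ?K i l y * ?K j r y)"
    if "y \<in> V1" "i < m" "j < m" for i j y
    unfolding \<eta>'_def by (rule d_form_pull_back[OF d(2) U \<Psi>U d(10) quad_smooth_smooth[OF \<eta>] that(2,3,1)])
  \<comment> \<open>A vector \<open>v\<close> in the new coordinates is the vector \<open>D\<Psi> v\<close> in the old ones.\<close>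
  have contract: "(\<Sum>i<m. v i * d_form \<eta>' i j y) =
      (\<Sum>r<m. (\<Sum>l<m. (\<Sum>i<m. ?K i l y * v i) * d_form \<eta> l r (\<Psi> y)) * ?K j r y)"
    if y: "y \<in> V1" and j: "j < m" for v j y
  proof -
    have "(\<Sum>i<m. v i * d_form \<eta>' i j y) =
        (\<Sum>i<m. \<Sum>l<m. \<Sum>r<m. v i * (d_form \<eta> l r (\<Psi> y) * ?K i l y * ?K j r y))"
      by (rule sum.cong) (auto simp: d\<eta>'[OF y _ j] sum_distrib_left)
    also have "\<dots> = (\<Sum>r<m. \<Sum>l<m. \<Sum>i<m. v i * (d_form \<eta> l r (\<Psi> y) * ?K i l y * ?K j r y))"
      by (subst (2) sum.swap, subst sum.swap, subst (2) sum.swap) simp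
    also have "\<dots> = (\<Sum>r<m. (\<Sum>l<m. (\<Sum>i<m. ?K i l y * v i) * d_form \<eta> l r (\<Psi> y)) * ?K j r y)"
      unfolding sum_distrib_right by (simp add: mult_ac)
    finally show ?thesis .
  qed
  have pairing: "(\<Sum>i<m. v i * \<eta>' i y) = (\<Sum>l<m. (\<Sum>i<m. ?K i l y * v i) * \<eta> l (\<Psi> y))" for v y
    unfolding \<eta>'_def pull_back_def sum_distrib_left sum_distrib_right
    by (subst sum.swap) (simp add: mult_ac)
  have KX': "(\<Sum>i<m. ?K i l y * X' i y) = X l (\<Psi> y)" if y: "y \<in> V1" and l: "l < m" for l y
  proof -
    have "(\<Sum>i<m. ?K i l y * X' i y) = (\<Sum>r<m. X r (\<Psi> y) * (\<Sum>i<m. ?K i l y * ?J r i (\<Psi> y)))"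
      unfolding X'_def dir_deriv_def sum_distrib_left by (subst sum.swap) (simp add: mult_ac)
    also have "\<dots> = (\<Sum>r<m. X r (\<Psi> y) * (if r = l then 1 else 0))" using KJ[OF y l] by simp
    also have "\<dots> = X l (\<Psi> y)" using l by (simp add: if_distrib sum.delta cong: if_cong)
    finally show ?thesis .
  qed
  have H': "hamiltonian m \<eta>' X' y = hamiltonian m \<eta> X (\<Psi> y)" if y: "y \<in> V1" for y
  proof -
    have "hamiltonian m \<eta>' X' y = (\<Sum>i<m. X' i y * \<eta>' i y)"
      by (simp add: hamiltonian_def mult.commute)
    also have "\<dots> = (\<Sum>l<m. (\<Sum>i<m. ?K i l y * X' i y) * \<eta> l (\<Psi> y))"
      by (rule pairing)
    also have "\<dots> = hamiltonian m \<eta> X (\<Psi> y)"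
      using KX'[OF y] by (simp add: hamiltonian_def mult.commute[of "X _ _"])
    finally show ?thesis .
  qed
  have HU: "C_infinity_on m U (hamiltonian m \<eta> X)"
    by (rule C_infinity_on_hamiltonian[OF U quad_smooth_smooth[OF X] quad_smooth_smooth[OF \<eta>]])

  have tangent': "X' i y = 0" if i: "i \<in> S" and y: "y \<in> V1" for i y
  proof -
    obtain j where j: "j < k" "\<forall>x\<in>U1. \<Phi> x i = f j x" using \<Phi>S i by auto
    have "X' i y = dir_deriv m X (f j) (\<Psi> y)"
      unfolding X'_def by (rule dir_deriv_cong[OF d(1) _ d(5)[OF y]]) (use j in auto)
    then show ?thesis using tangent[OF j(1) \<Psi>U[OF y]] by simp
  qed
  have isotropic': "d_form \<eta>' i j y = 0" if ij: "i \<in> {..<m} - S" "j \<in> {..<m} - S" and y: "y \<in> V1" for i j y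
  proof -
    have *: "(\<Sum>l<m. ?K i l y * partial_deriv l (f s) (\<Psi> y)) = 0" if i: "i \<in> {..<m} - S" and s: "s < k" for i s
    proof -
      have im: "i < m" using i by auto
      obtain r where r: "r \<in> S" "\<forall>x\<in>U1. \<Phi> x r = f s x" using fS[OF s] by auto
      have "partial_deriv i (\<lambda>y. f s (\<Psi> y)) y = partial_deriv i (\<lambda>y. y r) y"
        by (rule partial_deriv_cong[OF d(2) y im]) (use r d(5,6) in metis)
      moreover have "partial_deriv i (\<lambda>y. f s (\<Psi> y)) y = (\<Sum>l<m. partial_deriv l (f s) (\<Psi> y) * ?K i l y)"
        by (rule partial_deriv_compose[OF d(2) U quad_smooth_smooth[OF f[OF s]] \<Psi>U d(10) y im])
      ultimately show ?thesis using r i by (auto simp: partial_deriv_coord mult.commute)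
    qed
    show ?thesis
      using isotropic[OF \<Psi>U[OF y] *[OF ij(1)] *[OF ij(2)]] d\<eta>'[OF y] ij by simp
  qed
  have contact': "(\<Sum>i<m. X' i y * d_form \<eta>' i j y) = - partial_deriv j (hamiltonian m \<eta>' X') y"
    if j: "j < m" and y: "y \<in> V1" for j y
  proof -
    have "(\<Sum>i<m. X' i y * d_form \<eta>' i j y) = (\<Sum>r<m. (\<Sum>l<m. X l (\<Psi> y) * d_form \<eta> l r (\<Psi> y)) * ?K j r y)"
      unfolding contract[OF y j] using KX'[OF y] by simp
    also have "\<dots> = - (\<Sum>r<m. partial_deriv r (hamiltonian m \<eta> X) (\<Psi> y) * ?K j r y)"
      using contact[OF _ \<Psi>U[OF y]] by (simp add: sum_negf)
    also have "(\<Sum>r<m. partial_deriv r (hamiltonian m \<eta> X) (\<Psi> y) * ?K j r y) =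
        partial_deriv j (\<lambda>y. hamiltonian m \<eta> X (\<Psi> y)) y"
      by (rule partial_deriv_compose[OF d(2) U HU \<Psi>U d(10) y j, symmetric])
    also have "\<dots> = partial_deriv j (hamiltonian m \<eta>' X') y"
      by (rule partial_deriv_cong[OF d(2) y j]) (simp add: H')
    finally show ?thesis .
  qed
  have nondegenerate': "v i = 0"
    if v: "(\<Sum>i<m. v i * \<eta>' i (\<Phi> p)) = 0" "\<And>j. j < m \<Longrightarrow> (\<Sum>i<m. v i * d_form \<eta>' i j (\<Phi> p)) = 0" and i: "i < m" for v i
  proof -
    define w where "w l = (\<Sum>i<m. ?K i l (\<Phi> p) * v i)" for l
    have 1: "(\<Sum>l<m. w l * \<eta> l p) = 0" using v(1) pairing[of v "\<Phi> p"] by (simp add: w_def \<Phi>pV(2))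
    have 2: "(\<Sum>l<m. w l * d_form \<eta> l s p) = 0" if s: "s < m" for s
    proof -
      let ?a = "\<lambda>r. \<Sum>l<m. w l * d_form \<eta> l r p"
      have "0 = (\<Sum>j<m. (\<Sum>i<m. v i * d_form \<eta>' i j (\<Phi> p)) * ?J s j p)" using v(2) by simp
      also have "\<dots> = (\<Sum>j<m. (\<Sum>r<m. ?a r * ?K j r (\<Phi> p)) * ?J s j p)"
        by (rule sum.cong) (use contract[OF \<Phi>pV(1), of _ v] in \<open>auto simp: w_def \<Phi>pV(2)\<close>)
      also have "\<dots> = (\<Sum>r<m. ?a r * (\<Sum>j<m. ?K j r (\<Phi> p) * ?J s j p))"
        unfolding sum_distrib_left[of "sum _ _"] sum_distrib_right[of _ _ "?J s _ p"]
        by (subst sum.swap) (simp add: mult_ac sum_distrib_left)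
      also have "\<dots> = (\<Sum>r<m. ?a r * (if s = r then 1 else 0))"
        using KJ[OF \<Phi>pV(1) _ s] by (simp add: \<Phi>pV(2))
      also have "\<dots> = ?a s" using s by (simp add: if_distrib sum.delta' cong: if_cong)
      finally show ?thesis by simp
    qed
    have w0: "w l = 0" if "l < m" for l by (rule nondegenerate[OF 1 2 that])
    have "0 = (\<Sum>l<m. ?J l i p * w l)" using w0 by simp
    also have "\<dots> = (\<Sum>r<m. v r * (\<Sum>l<m. ?J l i p * ?K r l (\<Phi> p)))"
      unfolding w_def sum_distrib_left by (subst sum.swap) (simp add: mult_ac)
    also have "\<dots> = (\<Sum>r<m. v r * (if r = i then 1 else 0))"
      using JK[OF \<Phi>pV(1) i] by (simp add: \<Phi>pV(2))
    also have "\<dots> = v i" using i by (simp add: if_distrib sum.delta cong: if_cong)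
    finally show ?thesis by simp
  qed
  obtain U2 V2 \<Phi>2 \<Psi>2 where c2: "coord_change D m U2 V2 \<Phi>2 \<Psi>2" and U2: "U2 \<subseteq> V1" "\<Phi> p \<in> U2"
    and st: "straightens m U2 S X' \<Phi>2"
    by (rule straightening_in_adapted_coordinates[where X = X' and \<eta> = \<eta>' and q = "\<Phi> p", OF d(2) \<Phi>pV(1) S])
      (rule qX' q\<eta>' tangent' isotropic' contact' nondegenerate' that; assumption)+
  note d2 = coord_changeD[OF c2]
  let ?U = "{x \<in> U1. \<Phi> x \<in> U2}"
  have c3: "coord_change D m ?U V2 (\<lambda>x. \<Phi>2 (\<Phi> x)) (\<lambda>y. \<Psi> (\<Psi>2 y))"
    by (rule coord_change_compose[OF c c2 U2(1)])
  note d3 = coord_changeD[OF c3]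
  have "dir_deriv m X (\<lambda>x. \<Phi>2 (\<Phi> x) i) x = dir_deriv m X' (\<lambda>y. \<Phi>2 y i) (\<Phi> x)" if x: "x \<in> ?U" and i: "i < m" for x i
  proof -
    have "partial_deriv l (\<lambda>x. \<Phi>2 (\<Phi> x) i) x = (\<Sum>r<m. partial_deriv r (\<lambda>y. \<Phi>2 y i) (\<Phi> x) * ?J l r x)" if "l < m" for l
      by (rule partial_deriv_compose[OF d3(1) d2(1) d2(9)[OF i] _ C_infinity_on_subset[OF d(9) d3(1) _ d(1)] x that]) auto
    then have "dir_deriv m X (\<lambda>x. \<Phi>2 (\<Phi> x) i) x =
        (\<Sum>l<m. X l x * (\<Sum>r<m. partial_deriv r (\<lambda>y. \<Phi>2 y i) (\<Phi> x) * ?J l r x))"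
      by (simp add: dir_deriv_def)
    also have "\<dots> = dir_deriv m X' (\<lambda>y. \<Phi>2 y i) (\<Phi> x)"
      unfolding dir_deriv_def X'_def sum_distrib_left sum_distrib_right
      using d(4) x by (subst sum.swap) (simp add: mult_ac)
    finally show ?thesis .
  qed
  then have "straightens m ?U S X (\<lambda>x. \<Phi>2 (\<Phi> x))"
    using st S unfolding straightens_def by (auto simp: subset_iff)
  from quad_flow_of_straightening[OF c3 _ quad_smooth_subset[OF X d3(1)] this S]
  have "quad_flow D m ?U X p" using pU1 U2 U1U by auto
  then show ?thesis by (rule quad_flow_superset) (use U1U in auto)
qed


section \<open>Tangent vectors and one-forms in a chart\<close>

lemma chart_facts:
  assumes M: "smooth_manifold M" and c: "c \<in> matlas M"
  shows chart_openin: "openin (mtop M) (cdom c)"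
    and chart_image_eopen: "eopen (mdim M) (cmap c ` cdom c)"
    and chart_homeo: "homeomorphic_map (subtopology (mtop M) (cdom c))
       (subtopology (Euclidean_space (mdim M)) (cmap c ` cdom c)) (cmap c)"
  using assms by (auto simp: smooth_manifold_def is_chart_def)

lemma chart_subset_topspace: "smooth_manifold M \<Longrightarrow> c \<in> matlas M \<Longrightarrow> cdom c \<subseteq> topspace (mtop M)"
  by (rule openin_subset[OF chart_openin])

lemma chart_inj:
  assumes M: "smooth_manifold M" and c: "c \<in> matlas M"
  shows "inj_on (cmap c) (cdom c)"
proof -
  have "inj_on (cmap c) (topspace (subtopology (mtop M) (cdom c)))"
    using chart_homeo[OF assms] by (rule homeomorphic_imp_injective_map)
  then show ?thesis using chart_subset_topspace[OF assms] by (simp add: Int_absorb1)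
qed

lemma cinv_cmap: "smooth_manifold M \<Longrightarrow> c \<in> matlas M \<Longrightarrow> q \<in> cdom c \<Longrightarrow> cinv c (cmap c q) = q"
  unfolding cinv_def by (rule inv_into_f_f[OF chart_inj])

lemma cinv_in: "x \<in> cmap c ` cdom c \<Longrightarrow> cinv c x \<in> cdom c"
  unfolding cinv_def by (rule inv_into_into)

lemma cmap_cinv: "x \<in> cmap c ` cdom c \<Longrightarrow> cmap c (cinv c x) = x"
  unfolding cinv_def by (rule f_inv_into_f)

lemma eopen_chart_image:
  assumes M: "smooth_manifold M" and c: "c \<in> matlas M" and W: "openin (mtop M) W"
  shows "eopen (mdim M) (cmap c ` (cdom c \<inter> W))"
proof -
  have "open_map (subtopology (mtop M) (cdom c))
       (subtopology (Euclidean_space (mdim M)) (cmap c ` cdom c)) (cmap c)"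
    using chart_homeo[OF M c] by (rule homeomorphic_imp_open_map)
  moreover have "openin (subtopology (mtop M) (cdom c)) (cdom c \<inter> W)"
    using W openin_subtopology_Int2 by blast
  ultimately have "openin (subtopology (Euclidean_space (mdim M)) (cmap c ` cdom c)) (cmap c ` (cdom c \<inter> W))"
    unfolding open_map_def by blast
  then show ?thesis using chart_image_eopen[OF M c] openin_trans_full by blast
qed

lemma openin_chart_preimage:
  assumes M: "smooth_manifold M" and c: "c \<in> matlas M" and V: "eopen (mdim M) V"
  shows "openin (mtop M) {q \<in> cdom c. cmap c q \<in> V}"
proof -
  have "continuous_map (subtopology (mtop M) (cdom c)) (subtopology (Euclidean_space (mdim M)) (cmap c ` cdom c)) (cmap c)"
    using chart_homeo[OF M c] by (rule homeomorphic_imp_continuous_map)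
  then have "continuous_map (subtopology (mtop M) (cdom c)) (Euclidean_space (mdim M)) (cmap c)"
    by (simp add: continuous_map_in_subtopology)
  from openin_continuous_map_preimage[OF this V]
  have "openin (subtopology (mtop M) (cdom c)) {q \<in> cdom c. cmap c q \<in> V}"
    using chart_subset_topspace[OF M c] by (simp add: Int_absorb1)
  then show ?thesis using chart_openin[OF M c] openin_trans_full by blast
qed

text \<open>
Smoothness near \<open>p\<close> involves all charts. By smoothness of the transition maps it can be tested in a
single one, and this predicate names the neighbourhood on which the test succeeds.
\<close>

definition smooth_in_chart :: "'a mfd \<Rightarrow> 'a chart \<Rightarrow> 'a \<Rightarrow> (nat \<Rightarrow> real) set \<Rightarrow> ('a \<Rightarrow> real) \<Rightarrow> bool" where
  "smooth_in_chart M c p V f \<longleftrightarrow> eopen (mdim M) V \<and> cmap c p \<in> V \<and> V \<subseteq> cmap c ` cdom c \<and>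
     C_infinity_on (mdim M) V (\<lambda>x. f (cinv c x))"

lemma transition_smooth:
  assumes "smooth_manifold M" "c \<in> matlas M" "d \<in> matlas M" "j < mdim M"
  shows "C_infinity_on (mdim M) (cmap c ` (cdom c \<inter> cdom d)) (\<lambda>x. cmap d (cinv c x) j)"
  using assms unfolding smooth_manifold_def by blast

lemma smooth_nearI:
  assumes M: "smooth_manifold M" and c: "c \<in> charts_at M p" and V: "smooth_in_chart M c p V f"
  shows "smooth_near M p f"
proof -
  have cM: "c \<in> matlas M" and pc: "p \<in> cdom c" using c by (auto simp: charts_at_def)
  let ?W = "{q \<in> cdom c. cmap c q \<in> V}"
  have Vo: "eopen (mdim M) V" and Vf: "C_infinity_on (mdim M) V (\<lambda>x. f (cinv c x))"
    using V by (auto simp: smooth_in_chart_def)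
  have W: "openin (mtop M) ?W" by (rule openin_chart_preimage[OF M cM Vo])
  have "C_infinity_on (mdim M) (cmap d ` (cdom d \<inter> ?W)) (\<lambda>x. f (cinv d x))" if d: "d \<in> matlas M" for d
  proof -
    let ?A = "cmap d ` (cdom d \<inter> ?W)"
    have A: "eopen (mdim M) ?A" by (rule eopen_chart_image[OF M d W])
    have in_: "cinv d x \<in> cdom d" "cinv d x \<in> ?W" if "x \<in> ?A" for x
      using that cinv_cmap[OF M d] by auto
    have sub: "?A \<subseteq> cmap d ` (cdom d \<inter> cdom c)" by auto
    have "C_infinity_on (mdim M) ?A (\<lambda>x. f (cinv c (cmap c (cinv d x))))"
      by (rule C_infinity_on_compose[OF A Vo Vf _ C_infinity_on_subset[OF transition_smooth[OF M d cM] A sub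
              eopen_chart_image[OF M d chart_openin[OF M cM]]]])
        (use in_ in auto)
    then show ?thesis
      by (rule C_infinity_on_cong[OF A, rotated]) (use in_ cinv_cmap[OF M cM] in auto)
  qed
  then have "smooth_fun_on M ?W f" by (simp add: smooth_fun_on_def)
  moreover have "p \<in> ?W" using V pc by (auto simp: smooth_in_chart_def)
  ultimately show ?thesis using W unfolding smooth_near_def by blast
qed

lemma smooth_nearE:
  assumes M: "smooth_manifold M" and c: "c \<in> charts_at M p" and f: "smooth_near M p f"
  obtains V where "smooth_in_chart M c p V f"
proof -
  have cM: "c \<in> matlas M" and pc: "p \<in> cdom c" using c by (auto simp: charts_at_def)
  obtain W where W: "openin (mtop M) W" "p \<in> W" "smooth_fun_on M W f"
    using f unfolding smooth_near_def by blast
  have "smooth_in_chart M c p (cmap c ` (cdom c \<inter> W)) f"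
    unfolding smooth_in_chart_def using eopen_chart_image[OF M cM W(1)] W cM pc by (auto simp: smooth_fun_on_def)
  then show ?thesis using that by blast
qed

lemma smooth_in_chart_subset:
  assumes "smooth_in_chart M c p V f" "eopen (mdim M) V'" "V' \<subseteq> V" "cmap c p \<in> V'"
  shows "smooth_in_chart M c p V' f"
  using assms C_infinity_on_subset[of "mdim M" V "\<lambda>x. f (cinv c x)" V'] by (auto simp: smooth_in_chart_def)

lemma smooth_near2E:
  assumes M: "smooth_manifold M" and c: "c \<in> charts_at M p" and f: "smooth_near M p f" and g: "smooth_near M p g"
  obtains V where "smooth_in_chart M c p V f" "smooth_in_chart M c p V g"
proof -
  obtain V1 where 1: "smooth_in_chart M c p V1 f" by (rule smooth_nearE[OF M c f])
  obtain V2 where 2: "smooth_in_chart M c p V2 g" by (rule smooth_nearE[OF M c g])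
  have "eopen (mdim M) (V1 \<inter> V2)" "cmap c p \<in> V1 \<inter> V2" using 1 2 by (auto simp: smooth_in_chart_def)
  then show ?thesis using smooth_in_chart_subset[OF 1] smooth_in_chart_subset[OF 2] that by blast
qed

lemma smooth_near_const:
  assumes M: "smooth_manifold M" and c: "c \<in> charts_at M p"
  shows "smooth_near M p (\<lambda>q. k)"
  by (rule smooth_nearI[OF M c, of "cmap c ` cdom c"])
    (use c chart_image_eopen[OF M, of c] in \<open>auto simp: smooth_in_chart_def charts_at_def intro: C_infinity_on_const\<close>)

lemma smooth_near_add:
  assumes M: "smooth_manifold M" and c: "c \<in> charts_at M p" and f: "smooth_near M p f" and g: "smooth_near M p g"
  shows "smooth_near M p (\<lambda>q. f q + g q)"
proof -
  obtain V where V: "smooth_in_chart M c p V f" "smooth_in_chart M c p V g" by (rule smooth_near2E[OF M c f g])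
  then have "smooth_in_chart M c p V (\<lambda>q. f q + g q)"
    by (auto simp: smooth_in_chart_def intro: C_infinity_on_add)
  then show ?thesis by (rule smooth_nearI[OF M c])
qed

lemma smooth_near_mult:
  assumes M: "smooth_manifold M" and c: "c \<in> charts_at M p" and f: "smooth_near M p f" and g: "smooth_near M p g"
  shows "smooth_near M p (\<lambda>q. f q * g q)"
proof -
  obtain V where V: "smooth_in_chart M c p V f" "smooth_in_chart M c p V g" by (rule smooth_near2E[OF M c f g])
  then have "smooth_in_chart M c p V (\<lambda>q. f q * g q)"
    by (auto simp: smooth_in_chart_def intro: C_infinity_on_mult)
  then show ?thesis by (rule smooth_nearI[OF M c])
qed

lemma smooth_near_sum:
  assumes M: "smooth_manifold M" and c: "c \<in> charts_at M p"
  shows "(\<And>i. i \<in> I \<Longrightarrow> smooth_near M p (f i)) \<Longrightarrow> smooth_near M p (\<lambda>q. \<Sum>i\<in>I. f i q)"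
  by (induction I rule: infinite_finite_induct)
    (auto intro: smooth_near_const[OF M c] smooth_near_add[OF M c])

lemma smooth_near_coord:
  assumes M: "smooth_manifold M" and c: "c \<in> charts_at M p"
  shows "smooth_near M p (\<lambda>q. cmap c q i)"
proof -
  have cM: "c \<in> matlas M" using c by (auto simp: charts_at_def)
  have o: "eopen (mdim M) (cmap c ` cdom c)" by (rule chart_image_eopen[OF M cM])
  have "C_infinity_on (mdim M) (cmap c ` cdom c) (\<lambda>x. cmap c (cinv c x) i)"
    by (rule C_infinity_on_cong[OF o _ C_infinity_on_coord[OF o, of i]]) (simp add: cmap_cinv)
  then have "smooth_in_chart M c p (cmap c ` cdom c) (\<lambda>q. cmap c q i)"
    using o c by (auto simp: smooth_in_chart_def charts_at_def)
  then show ?thesis by (rule smooth_nearI[OF M c])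
qed

definition tvec_comp :: "'a chart \<Rightarrow> 'a tvec \<Rightarrow> nat \<Rightarrow> real" where
  "tvec_comp c v i = v (\<lambda>q. cmap c q i)"

lemma tangent_linear:
  "v \<in> tangent_space M p \<Longrightarrow> smooth_near M p f \<Longrightarrow> smooth_near M p g \<Longrightarrow>
    v (\<lambda>q. a * f q + b * g q) = a * v f + b * v g"
  and tangent_Leibniz:
  "v \<in> tangent_space M p \<Longrightarrow> smooth_near M p f \<Longrightarrow> smooth_near M p g \<Longrightarrow>
    v (\<lambda>q. f q * g q) = f p * v g + g p * v f"
  and tangent_not_smooth: "v \<in> tangent_space M p \<Longrightarrow> \<not> smooth_near M p f \<Longrightarrow> v f = 0"
  unfolding tangent_space_def by blast+

lemma tangent_const:
  assumes M: "smooth_manifold M" and c: "c \<in> charts_at M p" and v: "v \<in> tangent_space M p"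
  shows "v (\<lambda>q. k) = 0"
proof -
  have "v (\<lambda>q. 1) = 0" using tangent_Leibniz[OF v smooth_near_const[OF M c, of 1] smooth_near_const[OF M c, of 1]] by simp
  then show ?thesis
    using tangent_linear[OF v smooth_near_const[OF M c, of 1] smooth_near_const[OF M c, of 1], of k 0] by simp
qed

text \<open>
The indicator function of the neighbourhood is smooth near \<open>p\<close>, since smoothness near \<open>p\<close> puts no
condition on the values far away. It is idempotent, hence annihilated by every derivation, and
multiplying by it makes \<open>f\<close> and \<open>g\<close> equal everywhere.
\<close>

lemma tangent_local:
  assumes M: "smooth_manifold M" and c: "c \<in> charts_at M p" and v: "v \<in> tangent_space M p"
    and V: "eopen (mdim M) V" "cmap c p \<in> V"
    and f: "smooth_near M p f" and g: "smooth_near M p g"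
    and eq: "\<And>q. q \<in> cdom c \<Longrightarrow> cmap c q \<in> V \<Longrightarrow> f q = g q"
  shows "v f = v g"
proof -
  have cM: "c \<in> matlas M" and pc: "p \<in> cdom c" using c by (auto simp: charts_at_def)
  define \<iota> where "\<iota> q = (if q \<in> cdom c \<and> cmap c q \<in> V then 1 else 0 :: real)" for q
  let ?V = "V \<inter> cmap c ` cdom c"
  have Vo: "eopen (mdim M) ?V" using V chart_image_eopen[OF M cM] by auto
  have "C_infinity_on (mdim M) ?V (\<lambda>x. \<iota> (cinv c x))"
    by (rule C_infinity_on_cong[OF Vo _ C_infinity_on_const[OF Vo, of 1]]) (auto simp: \<iota>_def cinv_cmap[OF M cM])
  then have \<iota>: "smooth_near M p \<iota>"
    using Vo V(2) pc by (intro smooth_nearI[OF M c, of ?V]) (auto simp: smooth_in_chart_def)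
  have \<iota>p: "\<iota> p = 1" using V(2) pc by (simp add: \<iota>_def)
  have "(\<lambda>q. \<iota> q * \<iota> q) = \<iota>" by (auto simp: \<iota>_def)
  then have \<iota>0: "v \<iota> = 0" using tangent_Leibniz[OF v \<iota> \<iota>] \<iota>p by simp
  have "(\<lambda>q. f q * \<iota> q) = (\<lambda>q. g q * \<iota> q)" using eq by (auto simp: \<iota>_def)
  then have "v (\<lambda>q. f q * \<iota> q) = v (\<lambda>q. g q * \<iota> q)" by simp
  then show ?thesis using tangent_Leibniz[OF v f \<iota>] tangent_Leibniz[OF v g \<iota>] \<iota>0 \<iota>p by simp
qed

lemma tangent_sum:
  assumes M: "smooth_manifold M" and c: "c \<in> charts_at M p" and v: "v \<in> tangent_space M p"
  shows "finite I \<Longrightarrow> (\<And>i. i \<in> I \<Longrightarrow> smooth_near M p (f i)) \<Longrightarrow> v (\<lambda>q. \<Sum>i\<in>I. f i q) = (\<Sum>i\<in>I. v (f i))"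
proof (induction I rule: finite_induct)
  case empty
  then show ?case using tangent_const[OF M c v] by simp
next
  case (insert i I)
  have "v (\<lambda>q. 1 * f i q + 1 * (\<Sum>i\<in>I. f i q)) = 1 * v (f i) + 1 * v (\<lambda>q. \<Sum>i\<in>I. f i q)"
    using insert by (intro tangent_linear[OF v] smooth_near_sum[OF M c]) auto
  then show ?case using insert by simp
qed

text \<open>
A derivation is a combination of coordinate vectors: apply it to the Hadamard expansion around \<open>p\<close>,
where each coordinate difference vanishes.
\<close>

theorem tangent_components:
  assumes M: "smooth_manifold M" and c: "c \<in> charts_at M p" and v: "v \<in> tangent_space M p"
    and f: "smooth_near M p f"
  shows "v f = (\<Sum>i<mdim M. tvec_comp c v i * partial_deriv i (\<lambda>x. f (cinv c x)) (cmap c p))"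
proof -
  have cM: "c \<in> matlas M" and pc: "p \<in> cdom c" using c by (auto simp: charts_at_def)
  let ?x = "cmap c p" and ?f = "\<lambda>x. f (cinv c x)"
  obtain V where V: "smooth_in_chart M c p V f" by (rule smooth_nearE[OF M c f])
  have Vo: "eopen (mdim M) V" and xV: "?x \<in> V" and Vsub: "V \<subseteq> cmap c ` cdom c" and Vf: "C_infinity_on (mdim M) V ?f"
    using V by (auto simp: smooth_in_chart_def)
  obtain e where e: "e > 0" "ebox (mdim M) ?x e \<subseteq> V" "?x \<in> ebox (mdim M) ?x e"
    by (rule eopen_contains_ebox[OF Vo xV])
  define B where "B = ebox (mdim M) ?x e"
  have Bo: "eopen (mdim M) B" and BV: "B \<subseteq> V" and xB: "?x \<in> B" using e eopen_ebox by (auto simp: B_def)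
  have xE: "?x \<in> Euclid (mdim M)" using xV eopen_subset[OF Vo] by auto
  have Bf: "C_infinity_on (mdim M) B ?f" by (rule C_infinity_on_subset[OF Vf Bo BV Vo])
  have st: "radial {} ?x s x \<in> B" if "x \<in> B" "0 \<le> s" "s \<le> 1" for x s
    using radial_in_ebox[OF xE] that unfolding B_def by blast
  define h where "h i = radial_integral {} ?x 0 (partial_deriv i ?f)" for i
  have h: "C_infinity_on (mdim M) B (h i)" if "i < mdim M" for i
    unfolding h_def by (rule C_infinity_on_radial_integral[OF Bo C_infinity_on_partial[OF Bf that] st])
  have hs: "smooth_near M p (\<lambda>q. h i (cmap c q))" if "i < mdim M" for i
  proof (rule smooth_nearI[OF M c])
    have "C_infinity_on (mdim M) B (\<lambda>x. h i (cmap c (cinv c x)))"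
    proof (rule C_infinity_on_cong[OF Bo _ h[OF that]])
      show "h i x = h i (cmap c (cinv c x))" if "x \<in> B" for x
        using cmap_cinv[of x c] that BV Vsub by auto
    qed
    then show "smooth_in_chart M c p B (\<lambda>q. h i (cmap c q))"
      using Bo xB BV Vsub by (auto simp: smooth_in_chart_def)
  qed
  have xs: "smooth_near M p (\<lambda>q. cmap c q i + - ?x i)" for i
    by (rule smooth_near_add[OF M c smooth_near_coord[OF M c] smooth_near_const[OF M c]])
  let ?t = "\<lambda>i q. (cmap c q i + - ?x i) * h i (cmap c q)"
  have ts: "smooth_near M p (?t i)" if "i < mdim M" for i
    by (rule smooth_near_mult[OF M c xs hs[OF that]])
  have tsum: "smooth_near M p (\<lambda>q. \<Sum>i<mdim M. ?t i q)"
    by (rule smooth_near_sum[OF M c]) (use ts in auto)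
  have "v f = v (\<lambda>q. 1 * f p + 1 * (\<Sum>i<mdim M. ?t i q))"
  proof (rule tangent_local[OF M c v Bo xB f])
    show "smooth_near M p (\<lambda>q. 1 * f p + 1 * (\<Sum>i<mdim M. ?t i q))"
      using smooth_near_add[OF M c smooth_near_const[OF M c] tsum, of "f p"] by simp
    fix q assume q: "q \<in> cdom c" "cmap c q \<in> B"
    show "f q = 1 * f p + 1 * (\<Sum>i<mdim M. ?t i q)"
      using Hadamard_expansion[OF Bo Bf xE st q(2)] by (simp add: h_def cinv_cmap[OF M cM q(1)] cinv_cmap[OF M cM pc])
  qed
  also have "\<dots> = v (\<lambda>q. \<Sum>i<mdim M. ?t i q)"
    using tangent_linear[OF v smooth_near_const[OF M c, of "f p"] tsum, of 1 1] tangent_const[OF M c v] by simp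
  also have "\<dots> = (\<Sum>i<mdim M. v (?t i))"
    by (rule tangent_sum[OF M c v]) (use ts in auto)
  also have "\<dots> = (\<Sum>i<mdim M. tvec_comp c v i * partial_deriv i ?f ?x)"
  proof (rule sum.cong[OF refl])
    fix i assume "i \<in> {..<mdim M}"
    then have i: "i < mdim M" by simp
    have "v (?t i) = h i ?x * v (\<lambda>q. cmap c q i + - ?x i)"
      using tangent_Leibniz[OF v xs hs[OF i], of i] by simp
    also have "v (\<lambda>q. cmap c q i + - ?x i) = tvec_comp c v i"
      using tangent_linear[OF v smooth_near_coord[OF M c, of i] smooth_near_const[OF M c, of "- ?x i"], of 1 1]
        tangent_const[OF M c v] by (simp add: tvec_comp_def)
    finally show "v (?t i) = tvec_comp c v i * partial_deriv i ?f ?x"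
      by (simp add: h_def radial_integral_at_centre mult.commute)
  qed
  finally show ?thesis .
qed

lemma coord_vec_tangent:
  assumes M: "smooth_manifold M" and c: "c \<in> charts_at M p" and i: "i < mdim M"
  shows "coord_vec M c i p \<in> tangent_space M p"
proof -
  have cM: "c \<in> matlas M" and pc: "p \<in> cdom c" using c by (auto simp: charts_at_def)
  have "coord_vec M c i p (\<lambda>q. a * f q + b * g q) = a * coord_vec M c i p f + b * coord_vec M c i p g"
    and "coord_vec M c i p (\<lambda>q. f q * g q) = f p * coord_vec M c i p g + g p * coord_vec M c i p f"
    if f: "smooth_near M p f" and g: "smooth_near M p g" for f g a b
  proof -
    obtain V where V: "smooth_in_chart M c p V f" "smooth_in_chart M c p V g" by (rule smooth_near2E[OF M c f g])
    have Vo: "eopen (mdim M) V" and xV: "cmap c p \<in> V"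
      and sm: "C_infinity_on (mdim M) V (\<lambda>x. f (cinv c x))" "C_infinity_on (mdim M) V (\<lambda>x. g (cinv c x))"
      using V by (auto simp: smooth_in_chart_def)
    have k: "C_infinity_on (mdim M) V (\<lambda>x. k)" for k by (rule C_infinity_on_const[OF Vo])
    have "smooth_near M p (\<lambda>q. a * f q + b * g q)"
      by (intro smooth_near_add[OF M c] smooth_near_mult[OF M c] smooth_near_const[OF M c] f g)
    moreover have "partial_deriv i (\<lambda>x. a * f (cinv c x) + b * g (cinv c x)) (cmap c p) =
        a * partial_deriv i (\<lambda>x. f (cinv c x)) (cmap c p) + b * partial_deriv i (\<lambda>x. g (cinv c x)) (cmap c p)"
      by (subst partial_deriv_add[OF C_infinity_on_mult[OF Vo k sm(1)] C_infinity_on_mult[OF Vo k sm(2)] i xV])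
        (simp add: partial_deriv_mult[OF k sm(1) i xV] partial_deriv_mult[OF k sm(2) i xV] partial_deriv_const)
    ultimately show "coord_vec M c i p (\<lambda>q. a * f q + b * g q) = a * coord_vec M c i p f + b * coord_vec M c i p g"
      using f g by (simp add: coord_vec_def)
    show "coord_vec M c i p (\<lambda>q. f q * g q) = f p * coord_vec M c i p g + g p * coord_vec M c i p f"
      using f g smooth_near_mult[OF M c f g] partial_deriv_mult[OF sm i xV]
      by (simp add: coord_vec_def cinv_cmap[OF M cM pc])
  qed
  then show ?thesis unfolding tangent_space_def by (auto simp: coord_vec_def)
qed

lemma comp_coord_vec:
  assumes M: "smooth_manifold M" and c: "c \<in> charts_at M p" and i: "i < mdim M"
  shows "tvec_comp c (coord_vec M c i p) j = (if i = j then 1 else 0)"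
proof -
  have cM: "c \<in> matlas M" and pc: "p \<in> cdom c" using c by (auto simp: charts_at_def)
  have "partial_deriv i (\<lambda>x. cmap c (cinv c x) j) (cmap c p) = partial_deriv i (\<lambda>x. x j) (cmap c p)"
    by (rule partial_deriv_cong[OF chart_image_eopen[OF M cM] imageI[OF pc] i]) (simp only: cmap_cinv)
  then show ?thesis
    using smooth_near_coord[OF M c] by (simp add: tvec_comp_def coord_vec_def partial_deriv_coord)
qed

lemma tangent_space_zero: "(\<lambda>f. 0) \<in> tangent_space M p"
  by (simp add: tangent_space_def)

lemma tangent_space_add:
  "v \<in> tangent_space M p \<Longrightarrow> w \<in> tangent_space M p \<Longrightarrow> (\<lambda>f. a * v f + b * w f) \<in> tangent_space M p"
  unfolding tangent_space_def by (auto simp: algebra_simps)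

lemma tangent_space_sum:
  assumes "finite I" "\<And>i. i \<in> I \<Longrightarrow> v i \<in> tangent_space M p"
  shows "(\<lambda>f. \<Sum>i\<in>I. a i * v i f) \<in> tangent_space M p"
  using assms
proof (induction I rule: finite_induct)
  case (insert i I)
  have "(\<lambda>f. a i * v i f + 1 * (\<Sum>i\<in>I. a i * v i f)) \<in> tangent_space M p"
    using insert by (intro tangent_space_add) auto
  then show ?case using insert by simp
qed (simp add: tangent_space_zero)

lemma tangent_eqI:
  assumes M: "smooth_manifold M" and c: "c \<in> charts_at M p"
    and v: "v \<in> tangent_space M p" and w: "w \<in> tangent_space M p"
    and eq: "\<And>i. i < mdim M \<Longrightarrow> tvec_comp c v i = tvec_comp c w i"
  shows "v = w"
proof
  fix f show "v f = w f"
  proof (cases "smooth_near M p f")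
    case True
    then show ?thesis using tangent_components[OF M c v True] tangent_components[OF M c w True] eq by simp
  qed (simp add: tangent_not_smooth[OF v] tangent_not_smooth[OF w])
qed

definition vec_of :: "'a mfd \<Rightarrow> 'a chart \<Rightarrow> 'a \<Rightarrow> (nat \<Rightarrow> real) \<Rightarrow> 'a tvec" where
  "vec_of M c p a = (\<lambda>f. \<Sum>i<mdim M. a i * coord_vec M c i p f)"

lemma vec_of_tangent: "smooth_manifold M \<Longrightarrow> c \<in> charts_at M p \<Longrightarrow> vec_of M c p a \<in> tangent_space M p"
  unfolding vec_of_def by (intro tangent_space_sum coord_vec_tangent) auto

lemma comp_vec_of:
  assumes M: "smooth_manifold M" and c: "c \<in> charts_at M p" and i: "i < mdim M"
  shows "tvec_comp c (vec_of M c p a) i = a i"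
proof -
  have "tvec_comp c (vec_of M c p a) i = (\<Sum>j<mdim M. a j * tvec_comp c (coord_vec M c j p) i)"
    by (simp add: tvec_comp_def vec_of_def)
  also have "\<dots> = (\<Sum>j<mdim M. a j * (if j = i then 1 else 0))"
    by (rule sum.cong) (auto simp: comp_coord_vec[OF M c])
  also have "\<dots> = a i" using i by (simp add: if_distrib sum.delta cong: if_cong)
  finally show ?thesis .
qed

lemma vec_of_comp:
  assumes M: "smooth_manifold M" and c: "c \<in> charts_at M p" and v: "v \<in> tangent_space M p"
  shows "vec_of M c p (tvec_comp c v) = v"
  by (rule tangent_eqI[OF M c vec_of_tangent[OF M c] v comp_vec_of[OF M c]])

definition form_comp :: "'a mfd \<Rightarrow> 'a chart \<Rightarrow> ('a \<Rightarrow> 'a tvec \<Rightarrow> real) \<Rightarrow> nat \<Rightarrow> (nat \<Rightarrow> real) \<Rightarrow> real" where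
  "form_comp M c \<alpha> i x = \<alpha> (cinv c x) (coord_vec M c i (cinv c x))"

lemma one_form_linear:
  "one_form_on M W \<alpha> \<Longrightarrow> p \<in> W \<Longrightarrow> v \<in> tangent_space M p \<Longrightarrow> w \<in> tangent_space M p \<Longrightarrow>
    \<alpha> p (\<lambda>f. a * v f + b * w f) = a * \<alpha> p v + b * \<alpha> p w"
  unfolding one_form_on_def by blast

lemma one_form_sum:
  assumes \<alpha>: "one_form_on M W \<alpha>" "p \<in> W" and "finite I" "\<And>i. i \<in> I \<Longrightarrow> v i \<in> tangent_space M p"
  shows "\<alpha> p (\<lambda>f. \<Sum>i\<in>I. a i * v i f) = (\<Sum>i\<in>I. a i * \<alpha> p (v i))"
  using assms(3,4)
proof (induction I rule: finite_induct)
  case empty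
  show ?case using one_form_linear[OF \<alpha> tangent_space_zero tangent_space_zero, of 0 0] by simp
next
  case (insert i I)
  have "\<alpha> p (\<lambda>f. a i * v i f + 1 * (\<Sum>i\<in>I. a i * v i f)) = a i * \<alpha> p (v i) + 1 * \<alpha> p (\<lambda>f. \<Sum>i\<in>I. a i * v i f)"
    using insert by (intro one_form_linear[OF \<alpha>] tangent_space_sum) auto
  then show ?case using insert by simp
qed

lemma one_form_components:
  assumes M: "smooth_manifold M" and c: "c \<in> charts_at M p" and \<alpha>: "one_form_on M W \<alpha>" "p \<in> W"
    and v: "v \<in> tangent_space M p"
  shows "\<alpha> p v = (\<Sum>i<mdim M. tvec_comp c v i * form_comp M c \<alpha> i (cmap c p))"
proof -
  have cM: "c \<in> matlas M" and pc: "p \<in> cdom c" using c by (auto simp: charts_at_def)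
  have "\<alpha> p v = \<alpha> p (vec_of M c p (tvec_comp c v))" using vec_of_comp[OF M c v] by simp
  also have "\<dots> = (\<Sum>i<mdim M. tvec_comp c v i * \<alpha> p (coord_vec M c i p))"
    unfolding vec_of_def by (rule one_form_sum[OF \<alpha>]) (auto intro: coord_vec_tangent[OF M c])
  finally show ?thesis by (simp add: form_comp_def cinv_cmap[OF M cM pc])
qed

lemma form_comp_smooth:
  assumes M: "smooth_manifold M" and c: "c \<in> matlas M" and \<alpha>: "one_form_on M (topspace (mtop M)) \<alpha>" and i: "i < mdim M"
  shows "C_infinity_on (mdim M) (cmap c ` cdom c) (form_comp M c \<alpha> i)"
proof -
  have "cdom c \<inter> topspace (mtop M) = cdom c" using chart_subset_topspace[OF M c] by auto
  then show ?thesis using \<alpha> c i unfolding one_form_on_def form_comp_def[abs_def] by metis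
qed

text \<open>
The components of a one-form in two charts are related by pull-back along the transition map, so
the transformation of its exterior derivative is a case of \<open>d_form_pull_back\<close>.
\<close>

lemma form_comp_transition:
  assumes M: "smooth_manifold M" and c: "c \<in> matlas M" and d: "d \<in> matlas M"
    and \<alpha>: "one_form_on M (topspace (mtop M)) \<alpha>" and i: "i < mdim M" and x: "x \<in> cmap c ` (cdom c \<inter> cdom d)"
  shows "form_comp M c \<alpha> i x = pull_back (mdim M) (\<lambda>x. cmap d (cinv c x)) (form_comp M d \<alpha>) i x"
proof -
  obtain q where q: "q \<in> cdom c" "q \<in> cdom d" "x = cmap c q" using x by auto
  have qc: "c \<in> charts_at M q" "d \<in> charts_at M q" using q c d by (auto simp: charts_at_def)
  have cx: "cinv c x = q" using cinv_cmap[OF M c q(1)] q(3) by simp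
  have qM: "q \<in> topspace (mtop M)" using q chart_subset_topspace[OF M c] by auto
  have "form_comp M c \<alpha> i x = (\<Sum>l<mdim M. tvec_comp d (coord_vec M c i q) l * form_comp M d \<alpha> l (cmap d q))"
    using one_form_components[OF M qc(2) \<alpha> qM coord_vec_tangent[OF M qc(1) i]] by (simp add: form_comp_def cx)
  moreover have "tvec_comp d (coord_vec M c i q) l = partial_deriv i (\<lambda>x. cmap d (cinv c x) l) x" for l
    using smooth_near_coord[OF M qc(2)] by (simp add: tvec_comp_def coord_vec_def q(3))
  ultimately show ?thesis by (simp add: pull_back_def cx mult.commute)
qed

lemma comp_transition:
  assumes M: "smooth_manifold M" and c: "c \<in> charts_at M p" and d: "d \<in> charts_at M p" and v: "v \<in> tangent_space M p"
  shows "tvec_comp d v l = (\<Sum>i<mdim M. tvec_comp c v i * partial_deriv i (\<lambda>x. cmap d (cinv c x) l) (cmap c p))"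
  using tangent_components[OF M c v smooth_near_coord[OF M d, of l]] by (simp add: tvec_comp_def)

lemma d_form_cong:
  assumes "eopen m U" "x \<in> U" "i < m" "j < m" "\<And>k y. k < m \<Longrightarrow> y \<in> U \<Longrightarrow> \<alpha> k y = \<beta> k y"
  shows "d_form \<alpha> i j x = d_form \<beta> i j x"
proof -
  have "partial_deriv i (\<alpha> j) x = partial_deriv i (\<beta> j) x"
    by (rule partial_deriv_cong[OF assms(1-3)]) (rule assms(5)[OF assms(4)])
  moreover have "partial_deriv j (\<alpha> i) x = partial_deriv j (\<beta> i) x"
    by (rule partial_deriv_cong[OF assms(1,2,4)]) (rule assms(5)[OF assms(3)])
  ultimately show ?thesis by (simp add: d_form_def)
qed

lemma sum_swap_pairs:
  "(\<Sum>i\<in>A. \<Sum>j\<in>B. \<Sum>l\<in>C. \<Sum>r\<in>E. g i j l r) = (\<Sum>l\<in>C. \<Sum>r\<in>E. \<Sum>i\<in>A. \<Sum>j\<in>B. g i j l r)"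
proof -
  have swap3: "(\<Sum>j\<in>B. \<Sum>l\<in>C. \<Sum>r\<in>E. h j l r) = (\<Sum>l\<in>C. \<Sum>r\<in>E. \<Sum>j\<in>B. h j l r)" for h B
    by (subst sum.swap, rule sum.cong[OF refl], rule sum.swap)
  show ?thesis unfolding swap3[of _ B] by (rule swap3)
qed

text \<open>
The definition of \<^const>\<open>ext_deriv\<close> chooses a chart; this is the independence of the choice.
\<close>

theorem ext_deriv_in_chart:
  assumes M: "smooth_manifold M" and d: "d \<in> charts_at M p" and \<alpha>: "one_form_on M (topspace (mtop M)) \<alpha>"
    and v: "v \<in> tangent_space M p" and w: "w \<in> tangent_space M p"
  shows "ext_deriv M \<alpha> p v w =
    (\<Sum>i<mdim M. \<Sum>j<mdim M. d_form (form_comp M d \<alpha>) i j (cmap d p) * tvec_comp d v i * tvec_comp d w j)"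
proof -
  let ?m = "mdim M"
  define c where "c = (SOME c. c \<in> charts_at M p)"
  have c: "c \<in> charts_at M p" unfolding c_def using d by (metis someI_ex)
  have cM: "c \<in> matlas M" and pc: "p \<in> cdom c" and dM: "d \<in> matlas M" and pd: "p \<in> cdom d"
    using c d by (auto simp: charts_at_def)
  let ?A = "form_comp M c \<alpha>" and ?x = "cmap c p" and ?\<tau> = "\<lambda>x. cmap d (cinv c x)"
  let ?U = "cmap c ` (cdom c \<inter> cdom d)"
  have U: "eopen ?m ?U" by (rule eopen_chart_image[OF M cM chart_openin[OF M dM]])
  have xU: "?x \<in> ?U" using pc pd by auto
  have \<tau>: "?\<tau> x \<in> cmap d ` cdom d" if "x \<in> ?U" for x using that cinv_cmap[OF M cM] by auto
  have \<tau>x: "?\<tau> ?x = cmap d p" using cinv_cmap[OF M cM pc] by simp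
  have "ext_deriv M \<alpha> p v w = (\<Sum>i<?m. \<Sum>j<?m. partial_deriv i (?A j) ?x * (tvec_comp c v i * tvec_comp c w j - tvec_comp c w i * tvec_comp c v j))"
    by (simp add: ext_deriv_def Let_def c_def[symmetric] tvec_comp_def form_comp_def[abs_def])
  also have "\<dots> = (\<Sum>i<?m. \<Sum>j<?m. partial_deriv i (?A j) ?x * tvec_comp c v i * tvec_comp c w j) -
      (\<Sum>i<?m. \<Sum>j<?m. partial_deriv i (?A j) ?x * tvec_comp c w i * tvec_comp c v j)"
    by (simp add: algebra_simps sum_subtractf)
  also have "(\<Sum>i<?m. \<Sum>j<?m. partial_deriv i (?A j) ?x * tvec_comp c w i * tvec_comp c v j) =
      (\<Sum>i<?m. \<Sum>j<?m. partial_deriv j (?A i) ?x * tvec_comp c v i * tvec_comp c w j)"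
    by (subst sum.swap) (simp add: mult_ac)
  also have "(\<Sum>i<?m. \<Sum>j<?m. partial_deriv i (?A j) ?x * tvec_comp c v i * tvec_comp c w j) - \<dots> =
      (\<Sum>i<?m. \<Sum>j<?m. d_form ?A i j ?x * tvec_comp c v i * tvec_comp c w j)"
    by (simp add: d_form_def algebra_simps flip: sum_subtractf)
  also have "\<dots> = (\<Sum>i<?m. \<Sum>j<?m. (\<Sum>l<?m. \<Sum>r<?m. d_form (form_comp M d \<alpha>) l r (cmap d p) *
      partial_deriv i (\<lambda>x. ?\<tau> x l) ?x * partial_deriv j (\<lambda>x. ?\<tau> x r) ?x) * tvec_comp c v i * tvec_comp c w j)"
  proof -
    have "d_form ?A i j ?x = (\<Sum>l<?m. \<Sum>r<?m. d_form (form_comp M d \<alpha>) l r (cmap d p) *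
      partial_deriv i (\<lambda>x. ?\<tau> x l) ?x * partial_deriv j (\<lambda>x. ?\<tau> x r) ?x)" if ij: "i < ?m" "j < ?m" for i j
    proof -
      have "d_form ?A i j ?x = d_form (pull_back ?m ?\<tau> (form_comp M d \<alpha>)) i j ?x"
        by (rule d_form_cong[OF U xU ij form_comp_transition[OF M cM dM \<alpha>]])
      then show ?thesis
        using d_form_pull_back[OF U chart_image_eopen[OF M dM] \<tau> transition_smooth[OF M cM dM]
            form_comp_smooth[OF M dM \<alpha>] ij xU] \<tau>x by simp
    qed
    then show ?thesis by simp
  qed
  also have "\<dots> = (\<Sum>i<?m. \<Sum>j<?m. \<Sum>l<?m. \<Sum>r<?m. d_form (form_comp M d \<alpha>) l r (cmap d p) *
      (tvec_comp c v i * partial_deriv i (\<lambda>x. ?\<tau> x l) ?x) * (tvec_comp c w j * partial_deriv j (\<lambda>x. ?\<tau> x r) ?x))"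
    unfolding sum_distrib_right by (simp add: mult_ac)
  also have "\<dots> = (\<Sum>l<?m. \<Sum>r<?m. \<Sum>i<?m. \<Sum>j<?m. d_form (form_comp M d \<alpha>) l r (cmap d p) *
      (tvec_comp c v i * partial_deriv i (\<lambda>x. ?\<tau> x l) ?x) * (tvec_comp c w j * partial_deriv j (\<lambda>x. ?\<tau> x r) ?x))"
    by (rule sum_swap_pairs)
  also have "\<dots> = (\<Sum>l<?m. \<Sum>r<?m. d_form (form_comp M d \<alpha>) l r (cmap d p) * tvec_comp d v l * tvec_comp d w r)"
    unfolding comp_transition[OF M c d v] comp_transition[OF M c d w]
    by (simp add: sum_product sum_distrib_left mult_ac)
  finally show ?thesis .
qed


section \<open>Null vectors of contact forms\<close>

text \<open>
By elimination of the unknown \<open>i0\<close> from the equation \<open>j\<close>.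
\<close>

lemma homogeneous_system_nontrivial:
  fixes A :: "nat \<Rightarrow> nat \<Rightarrow> real"
  assumes "finite J" "finite I" "card J < card I"
  shows "\<exists>a. (\<exists>i\<in>I. a i \<noteq> 0) \<and> (\<forall>j\<in>J. (\<Sum>i\<in>I. a i * A i j) = 0)"
  using assms
proof (induction J arbitrary: I A rule: finite_induct)
  case empty
  then have "I \<noteq> {}" by auto
  then show ?case by (intro exI[of _ "\<lambda>_. 1"]) auto
next
  case (insert j J)
  show ?case
  proof (cases "\<forall>i\<in>I. A i j = 0")
    case True
    have "card J < card I" using insert by simp
    then obtain a where "\<exists>i\<in>I. a i \<noteq> 0" "\<forall>j\<in>J. (\<Sum>i\<in>I. a i * A i j) = 0"
      using insert.IH[OF insert.prems(1)] by blast
    then show ?thesis using True by (intro exI[of _ a]) auto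
  next
    case False
    then obtain i0 where i0: "i0 \<in> I" "A i0 j \<noteq> 0" by auto
    let ?I = "I - {i0}"
    define B where "B i j' = A i j' - A i j / A i0 j * A i0 j'" for i j'
    have "finite ?I" "card J < card ?I" using insert i0 by auto
    then obtain a where a: "\<exists>i\<in>?I. a i \<noteq> 0" "\<forall>j\<in>J. (\<Sum>i\<in>?I. a i * B i j) = 0"
      using insert.IH[of ?I B] by blast
    define b where "b = a(i0 := - (\<Sum>i\<in>?I. a i * A i j) / A i0 j)"
    have split: "(\<Sum>i\<in>I. b i * A i k) = - (\<Sum>i\<in>?I. a i * A i j) / A i0 j * A i0 k + (\<Sum>i\<in>?I. a i * A i k)" for k
      by (subst sum.remove[OF insert.prems(1) i0(1)]) (simp add: b_def)
    have "(\<Sum>i\<in>I. b i * A i k) = 0" if "k \<in> insert j J" for k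
    proof (cases "k = j")
      case True
      then show ?thesis unfolding split using i0 by simp
    next
      case False
      have "(\<Sum>i\<in>I. b i * A i k) = (\<Sum>i\<in>?I. a i * B i k)"
        unfolding split B_def
        by (simp add: right_diff_distrib sum_subtractf sum_distrib_left sum_distrib_right sum_divide_distrib mult_ac)
      then show ?thesis using a(2) that False by auto
    qed
    moreover have "\<exists>i\<in>I. b i \<noteq> 0" using a(1) by (auto simp: b_def)
    ultimately show ?thesis by blast
  qed
qed

text \<open>
Multilinearity in the first \<open>k\<close> entries includes that the later ones do not matter, since the
factors of \<^const>\<open>wedge\<close> are applied to sequences with arbitrary tails.
\<close>

definition k_linear :: "'a tvec set \<Rightarrow> nat \<Rightarrow> 'a ext_form \<Rightarrow> bool" where
  "k_linear T k \<omega> \<longleftrightarrow>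
     (\<forall>v w. (\<forall>i<k. v i = w i) \<longrightarrow> \<omega> v = \<omega> w) \<and>
     (\<forall>v s x y a b. (\<forall>i. v i \<in> T) \<longrightarrow> s < k \<longrightarrow> x \<in> T \<longrightarrow> y \<in> T \<longrightarrow>
        \<omega> (v(s := \<lambda>f. a * x f + b * y f)) = a * \<omega> (v(s := x)) + b * \<omega> (v(s := y)))"

definition annihilated_by :: "'a tvec set \<Rightarrow> 'a tvec \<Rightarrow> nat \<Rightarrow> 'a ext_form \<Rightarrow> bool" where
  "annihilated_by T u k \<omega> \<longleftrightarrow> (\<forall>v s. (\<forall>i. v i \<in> T) \<longrightarrow> s < k \<longrightarrow> v s = u \<longrightarrow> \<omega> v = 0)"

lemma k_linear_local: "k_linear T k \<omega> \<Longrightarrow> (\<And>i. i < k \<Longrightarrow> v i = w i) \<Longrightarrow> \<omega> v = \<omega> w"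
  unfolding k_linear_def by blast

lemma k_linear_slot:
  "k_linear T k \<omega> \<Longrightarrow> (\<And>i. v i \<in> T) \<Longrightarrow> s < k \<Longrightarrow> x \<in> T \<Longrightarrow> y \<in> T \<Longrightarrow>
    \<omega> (v(s := \<lambda>f. a * x f + b * y f)) = a * \<omega> (v(s := x)) + b * \<omega> (v(s := y))"
  unfolding k_linear_def by blast

lemma permutes_slot:
  assumes \<sigma>: "\<sigma> permutes {..<n}" and s: "s < (n :: nat)"
  obtains r where "r < n" "\<And>i. \<sigma> i = s \<longleftrightarrow> i = r"
proof -
  obtain r where r: "r < n" "\<sigma> r = s"
    using s permutes_image[OF \<sigma>] by (metis imageE lessThan_iff)
  have "\<sigma> i = s \<longleftrightarrow> i = r" for i using permutes_inj[OF \<sigma>] r(2) by (auto dest: injD)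
  then show ?thesis using that r by blast
qed

lemma k_linear_wedge:
  assumes a: "k_linear T k a" and b: "k_linear T l b"
  shows "k_linear T (k + l) (wedge k l a b)"
  unfolding k_linear_def
proof (intro conjI allI impI)
  fix v w :: "nat \<Rightarrow> 'a tvec" assume vw: "\<forall>i<k + l. v i = w i"
  have "a (\<lambda>i. v (\<sigma> i)) = a (\<lambda>i. w (\<sigma> i))" "b (\<lambda>i. v (\<sigma> (k + i))) = b (\<lambda>i. w (\<sigma> (k + i)))"
    if \<sigma>: "\<sigma> permutes {..<k + l}" for \<sigma>
  proof -
    have *: "v (\<sigma> i) = w (\<sigma> i)" if "i < k + l" for i
      using vw permutes_in_image[OF \<sigma>, of i] that by simp
    show "a (\<lambda>i. v (\<sigma> i)) = a (\<lambda>i. w (\<sigma> i))" by (rule k_linear_local[OF a]) (rule *, simp)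
    show "b (\<lambda>i. v (\<sigma> (k + i))) = b (\<lambda>i. w (\<sigma> (k + i)))" by (rule k_linear_local[OF b]) (rule *, simp)
  qed
  then show "wedge k l a b v = wedge k l a b w" by (simp add: wedge_def)
next
  fix v :: "nat \<Rightarrow> 'a tvec" and s x y and c d :: real
  assume v: "\<forall>i. v i \<in> T" and s: "s < k + l" and xy: "x \<in> T" "y \<in> T"
  let ?t = "\<lambda>\<sigma> (v :: nat \<Rightarrow> 'a tvec). of_int (sign \<sigma>) * a (\<lambda>i. v (\<sigma> i)) * b (\<lambda>i. v (\<sigma> (k + i)))"
  let ?z = "\<lambda>f. c * x f + d * y f"
  have t: "?t \<sigma> (v(s := ?z)) = c * ?t \<sigma> (v(s := x)) + d * ?t \<sigma> (v(s := y))" if \<sigma>: "\<sigma> permutes {..<k + l}" for \<sigma>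
  proof -
    obtain r where r: "r < k + l" "\<And>i. \<sigma> i = s \<longleftrightarrow> i = r" using permutes_slot[OF \<sigma> s] by blast
    show ?thesis
    proof (cases "r < k")
      case True
      have A: "(\<lambda>i. (v(s := z)) (\<sigma> i)) = (\<lambda>i. v (\<sigma> i))(r := z)" for z using r(2) by (auto simp: fun_eq_iff)
      have B: "(\<lambda>i. (v(s := z)) (\<sigma> (k + i))) = (\<lambda>i. v (\<sigma> (k + i)))" for z using r(2) True by (auto simp: fun_eq_iff)
      have "a ((\<lambda>i. v (\<sigma> i))(r := ?z)) = c * a ((\<lambda>i. v (\<sigma> i))(r := x)) + d * a ((\<lambda>i. v (\<sigma> i))(r := y))"
        by (rule k_linear_slot[OF a _ True xy]) (use v in auto)
      then show ?thesis unfolding A B by (simp add: algebra_simps)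
    next
      case False
      have A: "a (\<lambda>i. (v(s := z)) (\<sigma> i)) = a (\<lambda>i. v (\<sigma> i))" for z
        by (rule k_linear_local[OF a]) (use r(2) False in auto)
      have B: "(\<lambda>i. (v(s := z)) (\<sigma> (k + i))) = (\<lambda>i. v (\<sigma> (k + i)))(r - k := z)" for z
        using r(2) False by (auto simp: fun_eq_iff)
      have "b ((\<lambda>i. v (\<sigma> (k + i)))(r - k := ?z)) =
          c * b ((\<lambda>i. v (\<sigma> (k + i)))(r - k := x)) + d * b ((\<lambda>i. v (\<sigma> (k + i)))(r - k := y))"
        by (rule k_linear_slot[OF b _ _ xy]) (use v r(1) False in auto)
      then show ?thesis unfolding A B by (simp add: algebra_simps)
    qed
  qed
  have "(\<Sum>\<sigma> | \<sigma> permutes {..<k + l}. ?t \<sigma> (v(s := ?z))) =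
      c * (\<Sum>\<sigma> | \<sigma> permutes {..<k + l}. ?t \<sigma> (v(s := x))) + d * (\<Sum>\<sigma> | \<sigma> permutes {..<k + l}. ?t \<sigma> (v(s := y)))"
    unfolding sum_distrib_left sum.distrib[symmetric] by (rule sum.cong[OF refl]) (rule t, simp)
  then show "wedge k l a b (v(s := ?z)) = c * wedge k l a b (v(s := x)) + d * wedge k l a b (v(s := y))"
    unfolding wedge_def by (simp add: add_divide_distrib)
qed

lemma annihilated_by_wedge:
  assumes a: "annihilated_by T u k a" and b: "annihilated_by T u l b"
  shows "annihilated_by T u (k + l) (wedge k l a b)"
  unfolding annihilated_by_def
proof (intro allI impI)
  fix v s assume v: "\<forall>i. v i \<in> T" and s: "s < k + l" "v s = u"
  have "a (\<lambda>i. v (\<sigma> i)) * b (\<lambda>i. v (\<sigma> (k + i))) = 0" if \<sigma>: "\<sigma> permutes {..<k + l}" for \<sigma>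
  proof -
    obtain r where r: "r < k + l" "\<And>i. \<sigma> i = s \<longleftrightarrow> i = r" using permutes_slot[OF \<sigma> s(1)] by blast
    show ?thesis
    proof (cases "r < k")
      case True
      have "a (\<lambda>i. v (\<sigma> i)) = 0"
        by (rule a[unfolded annihilated_by_def, rule_format, of _ r]) (use v True r(2)[of r] s(2) in auto)
      then show ?thesis by simp
    next
      case False
      have "b (\<lambda>i. v (\<sigma> (k + i))) = 0"
        by (rule b[unfolded annihilated_by_def, rule_format, of _ "r - k"]) (use v False r(1) r(2)[of r] s(2) in auto)
      then show ?thesis by simp
    qed
  qed
  then show "wedge k l a b v = 0" unfolding wedge_def by (simp add: sum.neutral mult.assoc)
qed

lemma wedge_power2_k_linear: "k_linear T 2 a \<Longrightarrow> k_linear T (2 * n) (wedge_power2 a n)"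
proof (induction n)
  case (Suc n)
  then show ?case using k_linear_wedge[of T 2 a "2 * n" "wedge_power2 a n"] by simp
qed (simp add: k_linear_def)

lemma wedge_power2_annihilated: "annihilated_by T u 2 a \<Longrightarrow> annihilated_by T u (2 * n) (wedge_power2 a n)"
proof (induction n)
  case (Suc n)
  then show ?case using annihilated_by_wedge[of T u 2 a "2 * n" "wedge_power2 a n"] by simp
qed (simp add: annihilated_by_def)

text \<open>
Composing with the transposition of \<open>i\<close> and \<open>j\<close> permutes the terms of the sum and changes their sign.
\<close>

lemma wedge_alternating:
  assumes "i < k + l" "j < k + l" "i \<noteq> j" "v i = v j"
  shows "wedge k l a b v = 0"
proof -
  let ?P = "{\<sigma>. \<sigma> permutes {..<k + l}}" and ?\<tau> = "Transposition.transpose i j"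
  let ?t = "\<lambda>\<sigma>. of_int (sign \<sigma>) * a (\<lambda>i. v (\<sigma> i)) * b (\<lambda>i. v (\<sigma> (k + i)))"
  have \<tau>: "?\<tau> permutes {..<k + l}" using assms by (intro permutes_swap_id) auto
  have v\<tau>: "v (?\<tau> x) = v x" for x using assms(4) by (auto simp: Transposition.transpose_def)
  have "sum ?t ?P = (\<Sum>\<sigma>\<in>?P. ?t (?\<tau> \<circ> \<sigma>))"
    by (rule setum_permutations_compose_left[OF \<tau>])
  also have "\<dots> = (\<Sum>\<sigma>\<in>?P. - ?t \<sigma>)"
  proof (rule sum.cong[OF refl])
    fix \<sigma> assume "\<sigma> \<in> ?P"
    then have "permutation \<sigma>" "permutation ?\<tau>" using \<tau> by (auto intro: permutes_imp_permutation[of "{..<k + l}"])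
    then have "sign (?\<tau> \<circ> \<sigma>) = - sign \<sigma>" using assms(3) by (simp add: sign_compose sign_swap_id)
    then show "?t (?\<tau> \<circ> \<sigma>) = - ?t \<sigma>" by (simp add: v\<tau>)
  qed
  also have "\<dots> = - sum ?t ?P" by (rule sum_negf)
  finally have "sum ?t ?P = 0" by simp
  then show ?thesis by (simp add: wedge_def)
qed

lemma k_linear_sum:
  assumes \<omega>: "k_linear (tangent_space M p) k \<omega>" and v: "\<And>i. v i \<in> tangent_space M p" and s: "s < k"
  shows "finite I \<Longrightarrow> (\<And>i. i \<in> I \<Longrightarrow> x i \<in> tangent_space M p) \<Longrightarrow>
    \<omega> (v(s := \<lambda>f. \<Sum>i\<in>I. a i * x i f)) = (\<Sum>i\<in>I. a i * \<omega> (v(s := x i)))"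
proof (induction I rule: finite_induct)
  case empty
  have "\<omega> (v(s := \<lambda>f. 0)) = 0"
    using k_linear_slot[where v = v and a = 0 and b = 0, OF \<omega> v s tangent_space_zero tangent_space_zero] by simp
  then show ?case by (simp only: sum.empty)
next
  case (insert i I)
  have IH: "\<omega> (v(s := \<lambda>f. \<Sum>i\<in>I. a i * x i f)) = (\<Sum>i\<in>I. a i * \<omega> (v(s := x i)))"
    by (rule insert.IH) (rule insert.prems, simp)
  have "(\<lambda>f. \<Sum>i\<in>insert i I. a i * x i f) = (\<lambda>f. a i * x i f + 1 * (\<Sum>i\<in>I. a i * x i f))"
    using insert.hyps by simp
  moreover have "\<omega> (v(s := \<lambda>f. a i * x i f + 1 * (\<Sum>i\<in>I. a i * x i f))) =
      a i * \<omega> (v(s := x i)) + 1 * \<omega> (v(s := \<lambda>f. \<Sum>i\<in>I. a i * x i f))"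
    using insert by (intro k_linear_slot[OF \<omega> v s] tangent_space_sum) auto
  ultimately show ?case by (simp only: IH sum.insert[OF insert.hyps] mult_1)
qed

text \<open>
Modulo \<open>u\<close>, the \<open>k\<close> vectors \<open>v i\<close> live in a space of dimension \<open>k - 1\<close>, so they are dependent modulo
\<open>u\<close>. Replacing one of them by the corresponding combination, which is a multiple of \<open>u\<close>, multiplies the
value of \<open>\<omega>\<close> by a non-zero factor and at the same time makes it zero.
\<close>

theorem top_form_degenerate:
  assumes M: "smooth_manifold M" and c: "c \<in> charts_at M p" and m: "mdim M = k"
    and \<omega>: "k_linear (tangent_space M p) k \<omega>" "annihilated_by (tangent_space M p) u k \<omega>"
    and alt: "\<And>v i j. i < k \<Longrightarrow> j < k \<Longrightarrow> i \<noteq> j \<Longrightarrow> v i = v j \<Longrightarrow> \<omega> v = 0"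
    and u: "u \<in> tangent_space M p" and l: "l < k" "tvec_comp c u l \<noteq> 0"
    and v: "\<And>i. v i \<in> tangent_space M p"
  shows "\<omega> v = 0"
proof -
  \<comment> \<open>Subtracting \<open>r i\<close> times \<open>u\<close> from \<open>v i\<close> makes the component \<open>l\<close> zero, so one equation is void.\<close>
  define r where "r i = tvec_comp c (v i) l / tvec_comp c u l" for i
  define A where "A i j = tvec_comp c (v i) j - r i * tvec_comp c u j" for i j
  have "card ({..<k} - {l}) < card {..<k}" using l by (intro psubset_card_mono) auto
  then obtain a where a: "\<exists>i\<in>{..<k}. a i \<noteq> 0" "\<forall>j\<in>{..<k} - {l}. (\<Sum>i<k. a i * A i j) = 0"
    using homogeneous_system_nontrivial[of "{..<k} - {l}" "{..<k}" A] by auto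
  have Al: "A i l = 0" for i using l(2) by (simp add: A_def r_def)
  have Aj: "(\<Sum>i<k. a i * A i j) = 0" if "j < k" for j
    using a(2) Al that by (cases "j = l") auto
  define R where "R = (\<Sum>i<k. a i * r i)"
  have eq: "(\<lambda>f. \<Sum>i<k. a i * v i f) = (\<lambda>f. R * u f + 0 * u f)"
  proof (rule tangent_eqI[OF M c tangent_space_sum tangent_space_add])
    fix j assume "j < mdim M"
    then have "(\<Sum>i<k. a i * tvec_comp c (v i) j) = R * tvec_comp c u j"
      using Aj[of j] m by (simp add: A_def R_def right_diff_distrib sum_subtractf sum_distrib_left sum_distrib_right mult_ac)
    then show "tvec_comp c (\<lambda>f. \<Sum>i<k. a i * v i f) j = tvec_comp c (\<lambda>f. R * u f + 0 * u f) j" by (simp add: tvec_comp_def)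
  qed (use u v in auto)
  obtain s where s: "s < k" "a s \<noteq> 0" using a(1) by auto
  have "\<omega> (v(s := \<lambda>f. \<Sum>i<k. a i * v i f)) = (\<Sum>i<k. a i * \<omega> (v(s := v i)))"
    by (rule k_linear_sum[OF \<omega>(1) v s(1)]) (use v in auto)
  also have "\<dots> = (\<Sum>i<k. if i = s then a s * \<omega> v else 0)"
  proof (rule sum.cong[OF refl])
    fix i assume i: "i \<in> {..<k}"
    show "a i * \<omega> (v(s := v i)) = (if i = s then a s * \<omega> v else 0)"
      using alt[of i s "v(s := v i)"] i s(1) by auto
  qed
  also have "\<dots> = a s * \<omega> v" using s by simp
  finally have "a s * \<omega> v = \<omega> (v(s := \<lambda>f. R * u f + 0 * u f))" unfolding eq by simp
  also have "\<dots> = R * \<omega> (v(s := u)) + 0 * \<omega> (v(s := u))"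
    by (rule k_linear_slot[OF \<omega>(1) v s(1) u u])
  also have "\<omega> (v(s := u)) = 0"
    by (rule \<omega>(2)[unfolded annihilated_by_def, rule_format, of _ s]) (use v u s in auto)
  finally show ?thesis using s(2) by simp
qed

text \<open>
A non-zero vector \<open>v\<close> with \<open>\<eta>(v) = 0\<close> and \<open>d\<eta>(v, \<cdot>) = 0\<close> would annihilate every factor of
\<open>(d\<eta>)\<^sup>n \<and> \<eta>\<close>, and a form of top degree annihilated by a non-zero vector is zero.
\<close>

lemma contact_nondegenerate_coordinates:
  assumes M: "smooth_manifold M" and c: "c \<in> charts_at M p" and m: "mdim M = 2 * n + 1"
    and \<alpha>: "one_form_on M (topspace (mtop M)) \<alpha>" and nd: "contact_nondegenerate_at M n \<alpha> p"
    and v\<alpha>: "(\<Sum>i<mdim M. v i * form_comp M c \<alpha> i (cmap c p)) = 0"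
    and vd: "\<And>j. j < mdim M \<Longrightarrow> (\<Sum>i<mdim M. v i * d_form (form_comp M c \<alpha>) i j (cmap c p)) = 0"
    and l: "l < mdim M"
  shows "v l = 0"
proof (rule ccontr)
  assume vl: "v l \<noteq> 0"
  have pM: "p \<in> topspace (mtop M)"
    using c chart_subset_topspace[OF M, of c] by (auto simp: charts_at_def)
  let ?T = "tangent_space M p" and ?u = "vec_of M c p v"
  let ?d = "\<lambda>u. ext_deriv M \<alpha> p (u 0) (u 1)"
  have u: "?u \<in> ?T" by (rule vec_of_tangent[OF M c])
  have cu: "tvec_comp c ?u i = v i" if "i < mdim M" for i by (rule comp_vec_of[OF M c that])
  note ed = ext_deriv_in_chart[OF M c \<alpha>]
  let ?D = "\<lambda>i j. d_form (form_comp M c \<alpha>) i j (cmap c p)"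
  have \<alpha>u: "\<alpha> p ?u = 0" using one_form_components[OF M c \<alpha> pM u] v\<alpha> cu by simp
  have du: "ext_deriv M \<alpha> p ?u w = 0" if w: "w \<in> ?T" for w
  proof -
    have "ext_deriv M \<alpha> p ?u w = (\<Sum>j<mdim M. (\<Sum>i<mdim M. v i * ?D i j) * tvec_comp c w j)"
      unfolding ed[OF u w] sum_distrib_right using cu by (subst sum.swap) (simp add: mult_ac)
    then show ?thesis using vd by simp
  qed
  have skew: "ext_deriv M \<alpha> p w ?u = - ext_deriv M \<alpha> p ?u w" if w: "w \<in> ?T" for w
    unfolding ed[OF u w] ed[OF w u]
    by (subst sum.swap) (simp add: d_form_def algebra_simps flip: sum_negf)
  have lin1: "ext_deriv M \<alpha> p (\<lambda>f. a * x f + b * y f) w = a * ext_deriv M \<alpha> p x w + b * ext_deriv M \<alpha> p y w"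
    and lin2: "ext_deriv M \<alpha> p w (\<lambda>f. a * x f + b * y f) = a * ext_deriv M \<alpha> p w x + b * ext_deriv M \<alpha> p w y"
    if xy: "x \<in> ?T" "y \<in> ?T" and w: "w \<in> ?T" for x y w a b
  proof -
    have z: "tvec_comp c (\<lambda>f. a * x f + b * y f) i = a * tvec_comp c x i + b * tvec_comp c y i" for i by (simp add: tvec_comp_def)
    show "ext_deriv M \<alpha> p (\<lambda>f. a * x f + b * y f) w = a * ext_deriv M \<alpha> p x w + b * ext_deriv M \<alpha> p y w"
      unfolding ed[OF tangent_space_add[OF xy] w] ed[OF xy(1) w] ed[OF xy(2) w] z
      by (simp add: sum_distrib_left algebra_simps sum.distrib)
    show "ext_deriv M \<alpha> p w (\<lambda>f. a * x f + b * y f) = a * ext_deriv M \<alpha> p w x + b * ext_deriv M \<alpha> p w y"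
      unfolding ed[OF w tangent_space_add[OF xy]] ed[OF w xy(1)] ed[OF w xy(2)] z
      by (simp add: sum_distrib_left algebra_simps sum.distrib)
  qed
  have d2: "k_linear ?T 2 ?d"
    unfolding k_linear_def using lin1 lin2 by (auto simp: less_2_cases_iff)
  have da: "annihilated_by ?T ?u 2 ?d"
    unfolding annihilated_by_def using du skew by (auto simp: less_2_cases_iff)
  have \<alpha>1: "k_linear ?T 1 (\<lambda>u. \<alpha> p (u 0))"
    unfolding k_linear_def using one_form_linear[OF \<alpha> pM] by auto
  have \<alpha>a: "annihilated_by ?T ?u 1 (\<lambda>u. \<alpha> p (u 0))"
    unfolding annihilated_by_def using \<alpha>u by auto
  let ?\<omega> = "wedge (2 * n) 1 (wedge_power2 ?d n) (\<lambda>u. \<alpha> p (u 0))"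
  have "?\<omega> w = 0" if "\<And>i. w i \<in> ?T" for w
  proof (rule top_form_degenerate[OF M c m _ _ _ u _ _ that])
    show "k_linear ?T (2 * n + 1) ?\<omega>" by (rule k_linear_wedge[OF wedge_power2_k_linear[OF d2] \<alpha>1])
    show "annihilated_by ?T ?u (2 * n + 1) ?\<omega>" by (rule annihilated_by_wedge[OF wedge_power2_annihilated[OF da] \<alpha>a])
    show "?\<omega> w = 0" if "i < 2 * n + 1" "j < 2 * n + 1" "i \<noteq> j" "w i = w j" for w i j
      by (rule wedge_alternating[OF that])
    show "l < 2 * n + 1" "tvec_comp c ?u l \<noteq> 0" using l m vl cu[OF l] by auto
  qed
  then show False using nd unfolding contact_nondegenerate_at_def by blast
qed


section \<open>Contact systems in a chart\<close>

definition field_comp :: "'a chart \<Rightarrow> ('a \<Rightarrow> 'a tvec) \<Rightarrow> nat \<Rightarrow> (nat \<Rightarrow> real) \<Rightarrow> real" where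
  "field_comp c X i x = tvec_comp c (X (cinv c x)) i"

lemma field_comp_smooth:
  assumes M: "smooth_manifold M" and c: "c \<in> matlas M" and X: "vector_field_on M (topspace (mtop M)) X" and i: "i < mdim M"
  shows "C_infinity_on (mdim M) (cmap c ` cdom c) (field_comp c X i)"
proof -
  have "cdom c \<inter> topspace (mtop M) = cdom c" using chart_subset_topspace[OF M c] by auto
  then show ?thesis using X c i unfolding vector_field_on_def field_comp_def[abs_def] tvec_comp_def by metis
qed

lemma vector_field_tangent: "vector_field_on M W X \<Longrightarrow> p \<in> W \<Longrightarrow> X p \<in> tangent_space M p"
  unfolding vector_field_on_def by blast

lemma form_of_field:
  assumes M: "smooth_manifold M" and c: "c \<in> matlas M" and x: "x \<in> cmap c ` cdom c"
    and \<alpha>: "one_form_on M (topspace (mtop M)) \<alpha>" and X: "vector_field_on M (topspace (mtop M)) X"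
  shows "\<alpha> (cinv c x) (X (cinv c x)) = (\<Sum>i<mdim M. form_comp M c \<alpha> i x * field_comp c X i x)"
proof -
  have q: "cinv c x \<in> cdom c" "cmap c (cinv c x) = x" using cinv_in[OF x] cmap_cinv[OF x] by auto
  have qM: "cinv c x \<in> topspace (mtop M)" using q(1) chart_subset_topspace[OF M c] by auto
  have cq: "c \<in> charts_at M (cinv c x)" using c q by (simp add: charts_at_def)
  show ?thesis
    using one_form_components[OF M cq \<alpha> qM vector_field_tangent[OF X qM]]
    by (simp add: q(2) field_comp_def mult.commute)
qed

lemma ext_deriv_field_coord_vec:
  assumes M: "smooth_manifold M" and c: "c \<in> matlas M" and x: "x \<in> cmap c ` cdom c" and j: "j < mdim M"
    and \<alpha>: "one_form_on M (topspace (mtop M)) \<alpha>" and X: "vector_field_on M (topspace (mtop M)) X"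
  shows "ext_deriv M \<alpha> (cinv c x) (X (cinv c x)) (coord_vec M c j (cinv c x)) =
    (\<Sum>i<mdim M. field_comp c X i x * d_form (form_comp M c \<alpha>) i j x)"
proof -
  have q: "cinv c x \<in> cdom c" "cmap c (cinv c x) = x" using cinv_in[OF x] cmap_cinv[OF x] by auto
  have qM: "cinv c x \<in> topspace (mtop M)" using q(1) chart_subset_topspace[OF M c] by auto
  have cq: "c \<in> charts_at M (cinv c x)" using c q by (simp add: charts_at_def)
  have "(\<Sum>r<mdim M. d_form (form_comp M c \<alpha>) i r x * tvec_comp c (X (cinv c x)) i * tvec_comp c (coord_vec M c j (cinv c x)) r) =
      (\<Sum>r<mdim M. if r = j then field_comp c X i x * d_form (form_comp M c \<alpha>) i j x else 0)" for i
    by (rule sum.cong) (auto simp: comp_coord_vec[OF M cq j] field_comp_def)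
  then have "(\<Sum>r<mdim M. d_form (form_comp M c \<alpha>) i r x * tvec_comp c (X (cinv c x)) i * tvec_comp c (coord_vec M c j (cinv c x)) r) =
      field_comp c X i x * d_form (form_comp M c \<alpha>) i j x" for i
    using j by simp
  then show ?thesis
    using ext_deriv_in_chart[OF M cq \<alpha> vector_field_tangent[OF X qM] coord_vec_tangent[OF M cq j]] by (simp add: q(2))
qed

text \<open>
With \<open>\<eta> = g \<eta>'\<close>, the product rule turns \<open>d\<eta>'(X, \<cdot>) = - dH' + \<xi>'(H') \<eta>'\<close> into
\<open>d\<eta>(X, \<cdot>) = - dH + k \<eta>'\<close>, where \<open>H = g H' = \<eta>(X)\<close> and \<open>k\<close> is a function. The field \<open>\<xi>\<close> then detects
that \<open>k = 0\<close>.
\<close>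

lemma contact_relation:
  assumes M: "smooth_manifold M" and ham: "hamiltonian_contact_field M n \<H> X"
    and \<eta>: "global_contact_form M n \<H> \<eta>" and \<xi>: "Reeb_field M \<eta> \<xi>"
    and inv: "\<forall>p\<in>topspace (mtop M). \<xi> p (hamiltonian_function \<eta> X) = 0"
    and c: "c \<in> matlas M" and x: "x \<in> cmap c ` cdom c" and j: "j < mdim M"
  shows "(\<Sum>i<mdim M. field_comp c X i x * d_form (form_comp M c \<eta>) i j x) =
    - partial_deriv j (hamiltonian (mdim M) (form_comp M c \<eta>) (field_comp c X)) x"
proof -
  let ?m = "mdim M" and ?T = "topspace (mtop M)" and ?U = "cmap c ` cdom c"
  obtain \<eta>' \<xi>' H' where \<eta>': "global_contact_form M n \<H> \<eta>'" and \<xi>': "Reeb_field M \<eta>' \<xi>'"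
    and H': "smooth_fun_on M ?T H'" and X': "contact_field M \<eta>' \<xi>' H' X"
    using ham unfolding hamiltonian_contact_field_def by blast
  have f: "one_form_on M ?T \<eta>" "one_form_on M ?T \<eta>'" using \<eta> \<eta>' by (auto simp: global_contact_form_def)
  have X: "vector_field_on M ?T X" using X' by (simp add: contact_field_def)
  have \<xi>v: "vector_field_on M ?T \<xi>" "vector_field_on M ?T \<xi>'" using \<xi> \<xi>' by (auto simp: Reeb_field_def)
  have U: "eopen ?m ?U" by (rule chart_image_eopen[OF M c])
  have inT: "cinv c y \<in> ?T" if "y \<in> ?U" for y using cinv_in[OF that] chart_subset_topspace[OF M c] by auto
  have cq: "c \<in> charts_at M (cinv c y)" if "y \<in> ?U" for y using c cinv_in[OF that] by (simp add: charts_at_def)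
  let ?e = "form_comp M c \<eta>" and ?e' = "form_comp M c \<eta>'" and ?X = "field_comp c X"
    and ?z = "field_comp c \<xi>" and ?z' = "field_comp c \<xi>'" and ?h' = "\<lambda>x. H' (cinv c x)"
  let ?H = "hamiltonian ?m ?e ?X"
  define g where "g y = (\<Sum>i<?m. ?e i y * ?z' i y)" for y
  have sme: "C_infinity_on ?m ?U (?e i)" "C_infinity_on ?m ?U (?e' i)" if "i < ?m" for i
    by (rule form_comp_smooth[OF M c f(1) that], rule form_comp_smooth[OF M c f(2) that])
  have smX: "C_infinity_on ?m ?U (?X i)" "C_infinity_on ?m ?U (?z i)" "C_infinity_on ?m ?U (?z' i)" if "i < ?m" for i
    by (rule field_comp_smooth[OF M c X that], rule field_comp_smooth[OF M c \<xi>v(1) that], rule field_comp_smooth[OF M c \<xi>v(2) that])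
  have smg: "C_infinity_on ?m ?U g"
    unfolding g_def[abs_def] by (intro C_infinity_on_sum C_infinity_on_mult U sme smX) auto
  have smh: "C_infinity_on ?m ?U ?h'"
  proof -
    have "cdom c \<inter> ?T = cdom c" using chart_subset_topspace[OF M c] by auto
    then show ?thesis using H' c unfolding smooth_fun_on_def by metis
  qed
  have smH: "C_infinity_on ?m ?U ?H" by (rule C_infinity_on_hamiltonian[OF U smX(1) sme(1)])
  \<comment> \<open>Both forms have kernel \<open>\<H>\<close>, hence \<open>\<eta> = g \<eta>'\<close> with \<open>g = \<eta>(\<xi>')\<close>.\<close>
  have conf: "?e i y = g y * ?e' i y" if i: "i < ?m" and y: "y \<in> ?U" for i y
  proof -
    let ?q = "cinv c y"
    let ?v = "coord_vec M c i ?q"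
    let ?w = "\<lambda>f. 1 * ?v f + (- \<eta>' ?q ?v) * \<xi>' ?q f"
    have v: "?v \<in> tangent_space M ?q" by (rule coord_vec_tangent[OF M cq[OF y] i])
    have z: "\<xi>' ?q \<in> tangent_space M ?q" by (rule vector_field_tangent[OF \<xi>v(2) inT[OF y]])
    have w: "?w \<in> tangent_space M ?q" by (rule tangent_space_add[OF v z])
    have "\<eta>' ?q (\<xi>' ?q) = 1" using \<xi>' inT[OF y] by (simp add: Reeb_field_def)
    then have "\<eta>' ?q ?w = 0" using one_form_linear[OF f(2) inT[OF y] v z, of 1 "- \<eta>' ?q ?v"] by simp
    then have "?w \<in> kernel_at M \<eta>' ?q" using w by (simp add: kernel_at_def)
    moreover have "kernel_at M \<eta>' ?q = kernel_at M \<eta> ?q"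
      using \<eta> \<eta>' inT[OF y] by (simp add: global_contact_form_def)
    ultimately have "?w \<in> kernel_at M \<eta> ?q" by (simp only:)
    then have "\<eta> ?q ?w = 0" unfolding kernel_at_def by blast
    then have "\<eta> ?q ?v = \<eta>' ?q ?v * \<eta> ?q (\<xi>' ?q)"
      using one_form_linear[OF f(1) inT[OF y] v z, of 1 "- \<eta>' ?q ?v"] by simp
    then show ?thesis
      using form_of_field[OF M c y f(1) \<xi>v(2)] by (simp add: form_comp_def g_def)
  qed
  have eX: "(\<Sum>i<?m. ?e' i y * ?X i y) = ?h' y" if y: "y \<in> ?U" for y
    using form_of_field[OF M c y f(2) X] X' inT[OF y] by (simp add: contact_field_def)
  have Hg: "?H y = g y * ?h' y" if y: "y \<in> ?U" for y
    using eX[OF y] conf[OF _ y] by (simp add: hamiltonian_def mult.assoc flip: sum_distrib_left)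
  define k' where "k' = \<xi>' (cinv c x) H'"
  define k where "k = g x * k' + (\<Sum>i<?m. ?X i x * partial_deriv i g x)"
  have H'near: "smooth_near M (cinv c x) H'"
    using H' inT[OF x] unfolding smooth_near_def by (intro exI[of _ ?T]) auto
  have ct': "(\<Sum>i<?m. ?X i x * d_form ?e' i j x) = - partial_deriv j ?h' x + k' * ?e' j x" if j: "j < ?m" for j
  proof -
    have v: "coord_vec M c j (cinv c x) \<in> tangent_space M (cinv c x)" by (rule coord_vec_tangent[OF M cq[OF x] j])
    have "ext_deriv M \<eta>' (cinv c x) (X (cinv c x)) (coord_vec M c j (cinv c x)) =
        - coord_vec M c j (cinv c x) H' + k' * \<eta>' (cinv c x) (coord_vec M c j (cinv c x))"
      using X' inT[OF x] v unfolding contact_field_def k'_def by blast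
    moreover have "coord_vec M c j (cinv c x) H' = partial_deriv j ?h' x"
      using H'near by (simp add: coord_vec_def cmap_cinv[OF x])
    ultimately show ?thesis
      using ext_deriv_field_coord_vec[OF M c x j f(2) X] by (simp add: form_comp_def)
  qed
  have ct: "(\<Sum>i<?m. ?X i x * d_form ?e i j x) = - partial_deriv j ?H x + k * ?e' j x" if j: "j < ?m" for j
  proof -
    have pe: "partial_deriv a (?e b) x = partial_deriv a g x * ?e' b x + g x * partial_deriv a (?e' b) x"
      if "a < ?m" "b < ?m" for a b
    proof -
      have "partial_deriv a (?e b) x = partial_deriv a (\<lambda>y. g y * ?e' b y) x"
        by (rule partial_deriv_cong[OF U x that(1)]) (rule conf[OF that(2)])
      then show ?thesis using partial_deriv_mult[OF smg sme(2)[OF that(2)] that(1) x] by simp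
    qed
    have pH: "partial_deriv j ?H x = partial_deriv j g x * ?h' x + g x * partial_deriv j ?h' x"
    proof -
      have "partial_deriv j ?H x = partial_deriv j (\<lambda>y. g y * ?h' y) x"
        by (rule partial_deriv_cong[OF U x j]) (rule Hg)
      then show ?thesis using partial_deriv_mult[OF smg smh j x] by simp
    qed
    have "(\<Sum>i<?m. ?X i x * d_form ?e i j x) =
        (\<Sum>i<?m. g x * (?X i x * d_form ?e' i j x) + (?X i x * partial_deriv i g x) * ?e' j x - partial_deriv j g x * (?e' i x * ?X i x))"
      by (rule sum.cong) (auto simp: d_form_def pe j algebra_simps)
    also have "\<dots> = g x * (\<Sum>i<?m. ?X i x * d_form ?e' i j x) + (\<Sum>i<?m. ?X i x * partial_deriv i g x) * ?e' j x -
        partial_deriv j g x * (\<Sum>i<?m. ?e' i x * ?X i x)"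
      by (simp add: sum.distrib sum_subtractf sum_distrib_left sum_distrib_right)
    also have "\<dots> = - partial_deriv j ?H x + k * ?e' j x"
      unfolding ct'[OF j] eX[OF x] pH k_def by (simp add: algebra_simps)
    finally show ?thesis .
  qed
  \<comment> \<open>Evaluating at \<open>\<xi>\<close>, where \<open>d\<eta>(X, \<xi>) = 0\<close> and \<open>\<xi>(H) = 0\<close>, gives \<open>k = 0\<close>.\<close>
  have \<xi>H: "(\<Sum>j<?m. partial_deriv j ?H x * ?z j x) = 0"
  proof -
    have H: "hamiltonian_function \<eta> X (cinv c y) = ?H y" if "y \<in> ?U" for y
      using form_of_field[OF M c that f(1) X] by (simp add: hamiltonian_function_def hamiltonian_def)
    have smHf: "C_infinity_on ?m ?U (\<lambda>y. hamiltonian_function \<eta> X (cinv c y))"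
      by (rule C_infinity_on_cong[OF U _ smH]) (simp add: H)
    have "smooth_near M (cinv c x) (hamiltonian_function \<eta> X)"
      by (rule smooth_nearI[OF M cq[OF x], of ?U]) (use U smHf x cmap_cinv[OF x] in \<open>auto simp: smooth_in_chart_def\<close>)
    from tangent_components[OF M cq[OF x] vector_field_tangent[OF \<xi>v(1) inT[OF x]] this]
    have "\<xi> (cinv c x) (hamiltonian_function \<eta> X) =
        (\<Sum>i<?m. ?z i x * partial_deriv i (\<lambda>y. hamiltonian_function \<eta> X (cinv c y)) x)"
      by (simp add: cmap_cinv[OF x] field_comp_def)
    also have "\<dots> = (\<Sum>j<?m. partial_deriv j ?H x * ?z j x)"
    proof (rule sum.cong[OF refl])
      fix i assume "i \<in> {..<?m}"
      then have "partial_deriv i (\<lambda>y. hamiltonian_function \<eta> X (cinv c y)) x = partial_deriv i ?H x"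
        by (intro partial_deriv_cong[OF U x]) (auto simp: H)
      then show "?z i x * partial_deriv i (\<lambda>y. hamiltonian_function \<eta> X (cinv c y)) x = partial_deriv i ?H x * ?z i x"
        by simp
    qed
    finally show ?thesis using inv inT[OF x] by simp
  qed
  have dz: "(\<Sum>i<?m. ?z i x * d_form ?e i j x) = 0" if j: "j < ?m" for j
    using ext_deriv_field_coord_vec[OF M c x j f(1) \<xi>v(1)] \<xi> inT[OF x] coord_vec_tangent[OF M cq[OF x] j]
    by (simp add: Reeb_field_def)
  have "(\<Sum>j<?m. (\<Sum>i<?m. ?X i x * d_form ?e i j x) * ?z j x) = - (\<Sum>i<?m. ?X i x * (\<Sum>j<?m. ?z j x * d_form ?e j i x))"
    unfolding sum_distrib_left sum_distrib_right
    by (subst sum.swap) (simp add: d_form_def algebra_simps flip: sum_negf)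
  also have "\<dots> = 0" using dz by simp
  finally have "0 = (\<Sum>j<?m. (- partial_deriv j ?H x + k * ?e' j x) * ?z j x)" using ct by simp
  also have "\<dots> = - (\<Sum>j<?m. partial_deriv j ?H x * ?z j x) + k * (\<Sum>j<?m. ?e' j x * ?z j x)"
    by (simp add: algebra_simps sum.distrib sum_distrib_left sum_subtractf)
  finally have k0: "k * (\<Sum>j<?m. ?e' j x * ?z j x) = 0" using \<xi>H by simp
  have "1 = (\<Sum>j<?m. ?e j x * ?z j x)"
    using form_of_field[OF M c x f(1) \<xi>v(1)] \<xi> inT[OF x] by (simp add: Reeb_field_def)
  also have "\<dots> = g x * (\<Sum>j<?m. ?e' j x * ?z j x)"
    using conf[OF _ x] by (simp add: sum_distrib_left mult.assoc)
  finally have "(\<Sum>j<?m. ?e' j x * ?z j x) \<noteq> 0" by auto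
  then have "k = 0" using k0 by simp
  then show ?thesis using ct[OF j] by simp
qed

lemma map_domain_eopen:
  assumes M: "smooth_manifold M" and N: "smooth_manifold N" and F: "smooth_map M N F" and c: "c \<in> matlas M" and d: "d \<in> matlas N"
  shows "eopen (mdim M) (cmap c ` {q \<in> cdom c. F q \<in> cdom d})"
proof -
  have "openin (mtop M) {q \<in> topspace (mtop M). F q \<in> cdom d}"
    using F chart_openin[OF N d] unfolding smooth_map_def by (blast intro: openin_continuous_map_preimage)
  from eopen_chart_image[OF M c this]
  have "eopen (mdim M) (cmap c ` (cdom c \<inter> {q \<in> topspace (mtop M). F q \<in> cdom d}))" .
  moreover have "cdom c \<inter> {q \<in> topspace (mtop M). F q \<in> cdom d} = {q \<in> cdom c. F q \<in> cdom d}"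
    using chart_subset_topspace[OF M c] by auto
  ultimately show ?thesis by simp
qed

lemma smooth_near_compose_map:
  assumes M: "smooth_manifold M" and N: "smooth_manifold N" and F: "smooth_map M N F"
    and c: "c \<in> charts_at M q" and d: "d \<in> charts_at N (F q)" and g: "smooth_near N (F q) g"
  shows "smooth_near M q (\<lambda>y. g (F y))"
    and "i < mdim M \<Longrightarrow> partial_deriv i (\<lambda>x. g (F (cinv c x))) (cmap c q) =
      (\<Sum>l<mdim N. partial_deriv l (\<lambda>y. g (cinv d y)) (cmap d (F q)) *
         partial_deriv i (\<lambda>x. cmap d (F (cinv c x)) l) (cmap c q))"
proof -
  have cM: "c \<in> matlas M" and qc: "q \<in> cdom c" and dN: "d \<in> matlas N" and qd: "F q \<in> cdom d"
    using c d by (auto simp: charts_at_def)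
  let ?f = "\<lambda>x. cmap d (F (cinv c x))"
  let ?A = "cmap c ` {q \<in> cdom c. F q \<in> cdom d}"
  have A: "eopen (mdim M) ?A" by (rule map_domain_eopen[OF M N F cM dN])
  have inA: "cinv c x \<in> cdom c" "F (cinv c x) \<in> cdom d" if "x \<in> ?A" for x
    using that cinv_cmap[OF M cM] by auto
  have smf: "C_infinity_on (mdim M) ?A (\<lambda>x. ?f x l)" if "l < mdim N" for l
    using F cM dN that unfolding smooth_map_def by blast
  obtain V where V: "smooth_in_chart N d (F q) V g" by (rule smooth_nearE[OF N d g])
  have Vo: "eopen (mdim N) V" and qV: "cmap d (F q) \<in> V" and Vg: "C_infinity_on (mdim N) V (\<lambda>y. g (cinv d y))"
    using V by (auto simp: smooth_in_chart_def)
  have fE: "?f x \<in> Euclid (mdim N)" if "x \<in> ?A" for x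
    using inA(2)[OF that] eopen_subset[OF chart_image_eopen[OF N dN]] by auto
  have fc: "continuous_on ?A ?f"
    by (rule continuous_on_Euclid_components[OF fE C_infinity_on_continuous[OF A smf]])
  let ?B = "{x \<in> ?A. ?f x \<in> V}"
  have B: "eopen (mdim M) ?B" by (rule eopen_preimage[OF A Vo fc fE])
  have qq: "cinv c (cmap c q) = q" by (rule cinv_cmap[OF M cM qc])
  have qB: "cmap c q \<in> ?B" using qc qd qV qq by auto
  have smf': "C_infinity_on (mdim M) ?B (\<lambda>x. ?f x l)" if "l < mdim N" for l
    by (rule C_infinity_on_subset[OF smf[OF that] B _ A]) auto
  have fV: "?f x \<in> V" if "x \<in> ?B" for x using that by simp
  have eq: "g (cinv d (?f x)) = g (F (cinv c x))" if "x \<in> ?B" for x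
    using cinv_cmap[OF N dN inA(2)] that by simp
  have "C_infinity_on (mdim M) ?B (\<lambda>x. g (cinv d (?f x)))"
    by (rule C_infinity_on_compose[OF B Vo Vg fV smf'])
  then have "C_infinity_on (mdim M) ?B (\<lambda>x. g (F (cinv c x)))"
    by (rule C_infinity_on_cong[OF B, rotated]) (rule eq)
  then have "smooth_in_chart M c q ?B (\<lambda>y. g (F y))"
    using B qB by (auto simp: smooth_in_chart_def)
  then show "smooth_near M q (\<lambda>y. g (F y))" by (rule smooth_nearI[OF M c])
  assume i: "i < mdim M"
  have "partial_deriv i (\<lambda>x. g (F (cinv c x))) (cmap c q) = partial_deriv i (\<lambda>x. g (cinv d (?f x))) (cmap c q)"
    by (rule partial_deriv_cong[OF B qB i]) (rule eq[symmetric])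
  also have "\<dots> = (\<Sum>l<mdim N. partial_deriv l (\<lambda>y. g (cinv d y)) (?f (cmap c q)) * partial_deriv i (\<lambda>x. ?f x l) (cmap c q))"
    by (rule partial_deriv_compose[OF B Vo Vg fV smf' qB i])
  finally show "partial_deriv i (\<lambda>x. g (F (cinv c x))) (cmap c q) =
      (\<Sum>l<mdim N. partial_deriv l (\<lambda>y. g (cinv d y)) (cmap d (F q)) * partial_deriv i (\<lambda>x. ?f x l) (cmap c q))"
    by (simp add: qq)
qed

lemma pushforward_chart:
  assumes M: "smooth_manifold M" and N: "smooth_manifold N" and F: "smooth_map M N F"
    and c: "c \<in> charts_at M q" and d: "d \<in> charts_at N (F q)" and v: "v \<in> tangent_space M q"
    and j: "j < mdim N"
  shows "pushforward N F q v (\<lambda>y. cmap d y j) = (\<Sum>i<mdim M. tvec_comp c v i * partial_deriv i (\<lambda>x. cmap d (F (cinv c x)) j) (cmap c q))"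
proof -
  have g: "smooth_near N (F q) (\<lambda>y. cmap d y j)" by (rule smooth_near_coord[OF N d])
  show ?thesis
    using tangent_components[OF M c v smooth_near_compose_map(1)[OF M N F c d g]] g by (simp add: pushforward_def)
qed

text \<open>
The kernel of \<open>F\<^sub>*\<close> is defined by testing against all smooth functions; the chain rule reduces this to
the coordinate functions of one chart of the target.
\<close>

lemma ker_push_chart:
  assumes M: "smooth_manifold M" and N: "smooth_manifold N" and F: "smooth_map M N F"
    and c: "c \<in> charts_at M q" and d: "d \<in> charts_at N (F q)" and v: "v \<in> tangent_space M q"
  shows "v \<in> ker_push M N F q \<longleftrightarrow>
    (\<forall>j<mdim N. (\<Sum>i<mdim M. tvec_comp c v i * partial_deriv i (\<lambda>x. cmap d (F (cinv c x)) j) (cmap c q)) = 0)"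
proof
  assume "v \<in> ker_push M N F q"
  then show "\<forall>j<mdim N. (\<Sum>i<mdim M. tvec_comp c v i * partial_deriv i (\<lambda>x. cmap d (F (cinv c x)) j) (cmap c q)) = 0"
    using pushforward_chart[OF M N F c d v] by (simp add: ker_push_def)
next
  assume *: "\<forall>j<mdim N. (\<Sum>i<mdim M. tvec_comp c v i * partial_deriv i (\<lambda>x. cmap d (F (cinv c x)) j) (cmap c q)) = 0"
  have "pushforward N F q v g = 0" for g
  proof (cases "smooth_near N (F q) g")
    case True
    note sm = smooth_near_compose_map[OF M N F c d True]
    let ?J = "\<lambda>i l. partial_deriv i (\<lambda>x. cmap d (F (cinv c x)) l) (cmap c q)"
    let ?g = "\<lambda>l. partial_deriv l (\<lambda>y. g (cinv d y)) (cmap d (F q))"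
    have "v (\<lambda>y. g (F y)) = (\<Sum>i<mdim M. tvec_comp c v i * (\<Sum>l<mdim N. ?g l * ?J i l))"
      using tangent_components[OF M c v sm(1)] sm(2) by simp
    also have "\<dots> = (\<Sum>l<mdim N. ?g l * (\<Sum>i<mdim M. tvec_comp c v i * ?J i l))"
      unfolding sum_distrib_left by (subst sum.swap) (simp add: mult_ac)
    also have "\<dots> = 0" using * by simp
    finally show ?thesis using True by (simp add: pushforward_def)
  qed (simp add: pushforward_def)
  then show "v \<in> ker_push M N F q" using v by (auto simp: ker_push_def)
qed

lemma flow_by_quadratures_of_chart:
  assumes M: "smooth_manifold M" and c: "c \<in> charts_at M p" and X: "vector_field_on M (topspace (mtop M)) X"
    and U: "U \<subseteq> cmap c ` cdom c" and flow: "quad_flow D (mdim M) U (field_comp c X) (cmap c p)"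
  shows "flow_by_quadratures_at D M c X p"
proof -
  let ?m = "mdim M" and ?x = "cmap c p"
  have cM: "c \<in> matlas M" and pc: "p \<in> cdom c" using c by (auto simp: charts_at_def)
  obtain e u where e: "0 < e" "ebox ?m ?x e \<subseteq> U" "?x \<in> ebox ?m ?x e"
    and u: "\<forall>x\<in>ebox ?m ?x e. u x 0 = x \<and> (\<forall>t. \<bar>t\<bar> < e \<longrightarrow> u x t \<in> U \<and>
        (\<forall>l<?m. ((\<lambda>s. u x s l) has_real_derivative field_comp c X l (u x t)) (at t)))"
    and qu: "\<forall>l<?m. quad D (Suc ?m) {z \<in> Euclid (Suc ?m). tuple ?m z \<in> ebox ?m ?x e \<and> \<bar>z ?m\<bar> < e}
        (\<lambda>z. u (tuple ?m z) (z ?m) l)"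
    using flow unfolding quad_flow_def by (elim exE conjE) (rule that; assumption)
  let ?B = "ebox ?m ?x e"
  let ?N = "{q \<in> cdom c. cmap c q \<in> ?B}"
  define \<Gamma> where "\<Gamma> t q = cinv c (u (cmap c q) t)" for t q
  have N: "openin (mtop M) ?N" by (rule openin_chart_preimage[OF M cM eopen_ebox])
  have BU: "?B \<subseteq> cmap c ` cdom c" using e U by auto
  have imN: "cmap c ` ?N = ?B" using BU by auto
  have UE: "U \<subseteq> Euclid ?m" using U eopen_subset[OF chart_image_eopen[OF M cM]] by auto
  have uU: "u (cmap c q) t \<in> cmap c ` cdom c" "u (cmap c q) t \<in> Euclid ?m" if "q \<in> ?N" "\<bar>t\<bar> < e" for q t
    using u that U UE by auto
  have \<Gamma>c: "\<Gamma> t q \<in> cdom c" "cmap c (\<Gamma> t q) = u (cmap c q) t" if "q \<in> ?N" "\<bar>t\<bar> < e" for q t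
    unfolding \<Gamma>_def by (rule cinv_in[OF uU(1)[OF that]], rule cmap_cinv[OF uU(1)[OF that]])
  have \<Gamma>0: "\<Gamma> 0 q = q" if "q \<in> ?N" for q
    using u that cinv_cmap[OF M cM] by (simp add: \<Gamma>_def)
  have curve: "integral_curve_on M X {-e<..<e} (\<lambda>t. \<Gamma> t q)" if q: "q \<in> ?N" for q
    unfolding integral_curve_on_def
  proof (intro ballI conjI allI impI)
    fix t assume "t \<in> {-e<..<e}"
    then have t: "\<bar>t\<bar> < e" by auto
    let ?q = "\<Gamma> t q" and ?u = "u (cmap c q)"
    show qM: "?q \<in> topspace (mtop M)" using \<Gamma>c(1)[OF q t] chart_subset_topspace[OF M cM] by auto
    have cq: "c \<in> charts_at M ?q" using \<Gamma>c(1)[OF q t] cM by (simp add: charts_at_def)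
    fix f assume f: "smooth_near M ?q f"
    obtain V where V: "smooth_in_chart M c ?q V f" by (rule smooth_nearE[OF M cq f])
    then have Vo: "eopen ?m V" and Vf: "C_infinity_on ?m V (\<lambda>x. f (cinv c x))" and uV: "?u t \<in> V"
      using \<Gamma>c(2)[OF q t] by (auto simp: smooth_in_chart_def)
    have "((\<lambda>s. f (cinv c (?u s))) has_real_derivative
        (\<Sum>i<?m. partial_deriv i (\<lambda>x. f (cinv c x)) (?u t) * field_comp c X i (?u t))) (at t)"
    proof (rule chain_rule_curve[where \<gamma> = ?u, OF Vo C_infinity_onD[OF Vf] uV])
      show "((\<lambda>s. ?u s i) has_real_derivative field_comp c X i (?u t)) (at t)" if "i < ?m" for i
        using u q t that by blast
      have "\<forall>\<^sub>F s in nhds t. s \<in> {-e<..<e}" using t by (intro eventually_nhds_in_open) auto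
      then show "\<forall>\<^sub>F s in at t. ?u s \<in> Euclid ?m"
        unfolding eventually_at_filter by eventually_elim (use uU(2)[OF q] in auto)
    qed
    moreover have "X ?q f = (\<Sum>i<?m. partial_deriv i (\<lambda>x. f (cinv c x)) (?u t) * field_comp c X i (?u t))"
      using tangent_components[OF M cq vector_field_tangent[OF X qM] f] \<Gamma>c(2)[OF q t]
      by (simp add: field_comp_def \<Gamma>_def mult.commute)
    ultimately show "((\<lambda>s. f (\<Gamma> s q)) has_real_derivative X ?q f) (at t)" by (simp add: \<Gamma>_def)
  qed
  let ?Z = "{z \<in> Euclid (Suc ?m). tuple ?m z \<in> cmap c ` ?N \<and> z ?m \<in> {-e<..<e}}"
  have Z: "?Z = {z \<in> Euclid (Suc ?m). tuple ?m z \<in> ?B \<and> \<bar>z ?m\<bar> < e}" unfolding imN by auto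
  have "eopen (Suc ?m) {z \<in> {z \<in> Euclid (Suc ?m). tuple ?m z \<in> ?B}. z ?m \<in> {-e<..<e}}"
    by (rule eopen_preimage_Int_open[OF eopen_tuple_preimage[OF eopen_ebox] continuous_on_coord]) simp
  also have "{z \<in> {z \<in> Euclid (Suc ?m). tuple ?m z \<in> ?B}. z ?m \<in> {-e<..<e}} = ?Z" unfolding imN by auto
  finally have Zo: "eopen (Suc ?m) ?Z" .
  have "quad D (Suc ?m) ?Z (\<lambda>z. cmap c (\<Gamma> (z ?m) (cinv c (tuple ?m z))) i)" if i: "i < ?m" for i
  proof (rule quad.restriction[OF qu[rule_format, OF i] Zo])
    show "?Z \<subseteq> {z \<in> Euclid (Suc ?m). tuple ?m z \<in> ?B \<and> \<bar>z ?m\<bar> < e}" unfolding Z by simp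
    fix z assume z: "z \<in> ?Z"
    have zN: "cinv c (tuple ?m z) \<in> ?N" "cmap c (cinv c (tuple ?m z)) = tuple ?m z"
      using z BU cinv_in[of "tuple ?m z" c] cmap_cinv[of "tuple ?m z" c] unfolding Z by auto
    show "cmap c (\<Gamma> (z ?m) (cinv c (tuple ?m z))) i = u (tuple ?m z) (z ?m) i"
      using \<Gamma>c(2)[OF zN(1), of "z ?m"] zN(2) z unfolding Z by auto
  qed
  moreover have "p \<in> ?N" using pc e(3) by simp
  moreover have "\<forall>q\<in>?N. \<Gamma> 0 q = q \<and> integral_curve_on M X {-e<..<e} (\<lambda>t. \<Gamma> t q) \<and> (\<forall>t\<in>{-e<..<e}. \<Gamma> t q \<in> cdom c)"
    using \<Gamma>0 curve \<Gamma>c(1) by auto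
  ultimately show ?thesis
    unfolding flow_by_quadratures_at_def using N e(1)
    by (intro exI[of _ ?N] exI[of _ e] exI[of _ \<Gamma>]) blast
qed

theorem theorem7:
  fixes M :: "'a mfd" and \<Lambda> :: "'b mfd" and n :: nat
    and \<H> :: "'a \<Rightarrow> 'a tvec set"
    and X \<xi> :: "'a \<Rightarrow> 'a tvec"
    and \<eta> :: "'a \<Rightarrow> 'a tvec \<Rightarrow> real"
    and F :: "'a \<Rightarrow> 'b"
  assumes "contact_system M n \<H> X"
    and "global_contact_form M n \<H> \<eta>"
    and "Reeb_field M \<eta> \<xi>"
    and "\<forall>p\<in>topspace (mtop M). \<xi> p (hamiltonian_function \<eta> X) = 0"
    and "pseudo_isotropic_first_integrals M \<eta> X \<Lambda> F"
  shows "integrable_by_quadratures M X \<eta> \<Lambda> F"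
  unfolding integrable_by_quadratures_def
proof (intro ballI)
  fix p c d assume p: "p \<in> topspace (mtop M)" and c: "c \<in> charts_at M p" and d: "d \<in> charts_at \<Lambda> (F p)"
  let ?m = "mdim M" and ?k = "mdim \<Lambda>" and ?D = "known_data M X \<eta> \<Lambda> F c d"
  have M: "smooth_manifold M" and ham: "hamiltonian_contact_field M n \<H> X" and m: "?m = 2 * n + 1"
    using assms(1) by (auto simp: contact_system_def contact_structure_def)
  have L: "smooth_manifold \<Lambda>" and sub: "submersion_onto M \<Lambda> F"
    and tang: "\<And>q. q \<in> topspace (mtop M) \<Longrightarrow> X q \<in> ker_push M \<Lambda> F q"
    and iso: "\<And>q. q \<in> topspace (mtop M) \<Longrightarrow> ker_push M \<Lambda> F q \<subseteq> orthogonal_at M \<eta> q (ker_push M \<Lambda> F q)"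
    using assms(5) by (auto simp: pseudo_isotropic_first_integrals_def)
  have F: "smooth_map M \<Lambda> F"
    and onto: "\<And>q. q \<in> topspace (mtop M) \<Longrightarrow> pushforward \<Lambda> F q ` tangent_space M q = tangent_space \<Lambda> (F q)"
    using sub by (auto simp: submersion_onto_def)
  have X: "vector_field_on M (topspace (mtop M)) X"
    using ham by (auto simp: hamiltonian_contact_field_def contact_field_def)
  have \<eta>: "one_form_on M (topspace (mtop M)) \<eta>"
    and nd: "contact_nondegenerate_at M n \<eta> p"
    using assms(2) p by (auto simp: global_contact_form_def)
  have cM: "c \<in> matlas M" and pc: "p \<in> cdom c" and dL: "d \<in> matlas \<Lambda>" and pd: "F p \<in> cdom d"
    using c d by (auto simp: charts_at_def)
  let ?U = "cmap c ` {q \<in> cdom c. F q \<in> cdom d}" and ?f = "\<lambda>j x. cmap d (F (cinv c x)) j"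
  let ?X = "field_comp c X" and ?e = "form_comp M c \<eta>" and ?x = "cmap c p"
  have U: "eopen ?m ?U" by (rule map_domain_eopen[OF M L F cM dL])
  have Usub: "?U \<subseteq> cmap c ` cdom c" by auto
  have pU: "?x \<in> ?U" using pc pd by auto
  have inU: "cinv c x \<in> topspace (mtop M)" "c \<in> charts_at M (cinv c x)" "d \<in> charts_at \<Lambda> (F (cinv c x))"
    "cmap c (cinv c x) = x" if "x \<in> ?U" for x
    using that cM dL chart_subset_topspace[OF M cM] cinv_cmap[OF M cM] by (auto simp: charts_at_def)
  have Co: "eopen ?m (cmap c ` cdom c)" by (rule chart_image_eopen[OF M cM])
  have qX: "quad_smooth ?D ?m ?U (?X i)" if i: "i < ?m" for i
  proof (rule quad_smooth_subset[OF _ U Usub])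
    have "quad ?D ?m (cmap c ` cdom c) (?X i)"
      by (rule quad.known) (use i in \<open>auto simp: known_data_def field_comp_def[abs_def] tvec_comp_def\<close>)
    then show "quad_smooth ?D ?m (cmap c ` cdom c) (?X i)"
      using Co field_comp_smooth[OF M cM X i] by (simp add: quad_smooth_def)
  qed
  have q\<eta>: "quad_smooth ?D ?m ?U (?e i)" if i: "i < ?m" for i
  proof (rule quad_smooth_subset[OF _ U Usub])
    have "quad ?D ?m (cmap c ` cdom c) (?e i)"
      by (rule quad.known) (use i in \<open>auto simp: known_data_def form_comp_def[abs_def]\<close>)
    then show "quad_smooth ?D ?m (cmap c ` cdom c) (?e i)"
      using Co form_comp_smooth[OF M cM \<eta> i] by (simp add: quad_smooth_def)
  qed
  have qf: "quad_smooth ?D ?m ?U (?f j)" if j: "j < ?k" for j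
  proof -
    have "quad ?D ?m ?U (?f j)"
      by (rule quad.known) (use j in \<open>auto simp: known_data_def\<close>)
    moreover have "C_infinity_on ?m ?U (?f j)" using F cM dL j unfolding smooth_map_def by blast
    ultimately show ?thesis using U by (simp add: quad_smooth_def)
  qed
  have "quad_flow ?D ?m ?U ?X ?x"
  proof (rule quad_flow_of_isotropic_integrals[where X = ?X and \<eta> = ?e and f = ?f and k = ?k, OF U pU qX q\<eta> qf])
    fix j assume j: "j < ?k"
    have "coord_vec \<Lambda> d j (F p) \<in> pushforward \<Lambda> F p ` tangent_space M p"
      using onto[OF p] coord_vec_tangent[OF L d j] by simp
    then obtain v where v: "v \<in> tangent_space M p" "pushforward \<Lambda> F p v = coord_vec \<Lambda> d j (F p)" by auto
    have "(\<Sum>i<?m. tvec_comp c v i * partial_deriv i (?f l) ?x) = (if l = j then 1 else 0)" if "l < ?k" for l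
      using pushforward_chart[OF M L F c d v(1) that] comp_coord_vec[OF L d j, of l] v(2)
      by (auto simp: tvec_comp_def)
    then show "\<exists>v. \<forall>l<?k. (\<Sum>i<?m. v i * partial_deriv i (?f l) ?x) = (if l = j then 1 else 0)" by blast
  next
    fix j x assume j: "j < ?k" and x: "x \<in> ?U"
    note q = inU[OF x]
    have "X (cinv c x) \<in> tangent_space M (cinv c x)" by (rule vector_field_tangent[OF X q(1)])
    from ker_push_chart[OF M L F q(2,3) this] tang[OF q(1)] j
    show "dir_deriv ?m ?X (?f j) x = 0" by (simp add: dir_deriv_def field_comp_def q(4))
  next
    fix v w x assume x: "x \<in> ?U"
      and v: "\<And>j. j < ?k \<Longrightarrow> (\<Sum>i<?m. v i * partial_deriv i (?f j) x) = 0"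
      and w: "\<And>j. j < ?k \<Longrightarrow> (\<Sum>i<?m. w i * partial_deriv i (?f j) x) = 0"
    note q = inU[OF x]
    let ?v = "\<lambda>v. vec_of M c (cinv c x) v"
    have T: "?v v \<in> tangent_space M (cinv c x)" for v by (rule vec_of_tangent[OF M q(2)])
    have ker: "?v v \<in> ker_push M \<Lambda> F (cinv c x)"
      if "\<And>j. j < ?k \<Longrightarrow> (\<Sum>i<?m. v i * partial_deriv i (?f j) x) = 0" for v
      using ker_push_chart[OF M L F q(2,3) T] that by (simp add: comp_vec_of[OF M q(2)] q(4))
    have "ext_deriv M \<eta> (cinv c x) (?v v) (?v w) = 0"
      using iso[OF q(1)] ker[OF v] ker[OF w] by (auto simp: orthogonal_at_def)
    then show "(\<Sum>i<?m. \<Sum>j<?m. d_form ?e i j x * v i * w j) = 0"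
      using ext_deriv_in_chart[OF M q(2) \<eta> T T] by (simp add: comp_vec_of[OF M q(2)] q(4))
  next
    fix j x assume "j < ?m" "x \<in> ?U"
    then show "(\<Sum>i<?m. ?X i x * d_form ?e i j x) = - partial_deriv j (hamiltonian ?m ?e ?X) x"
      using contact_relation[OF M ham assms(2,3,4) cM] Usub by blast
  next
    fix v i assume "(\<Sum>i<?m. v i * ?e i ?x) = 0" "\<And>j. j < ?m \<Longrightarrow> (\<Sum>i<?m. v i * d_form ?e i j ?x) = 0" "i < ?m"
    then show "v i = 0" by (rule contact_nondegenerate_coordinates[OF M c m \<eta> nd])
  qed
  then show "flow_by_quadratures_at ?D M c X p"
    by (rule flow_by_quadratures_of_chart[OF M c X Usub])
qed

end
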